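(* Let $(M,g)$ be a spacetime with regular cosmological time function $\tau_g$. Then $\tau_g$ is locally anti-Lipschitz, and thus the induced null distance function $\hat{d}_{\tau_g}$ is definite on $M$ (i.e. $\hat{d}_{\tau_g}(p,q)=0$ implies $p=q$).
   Context: A spacetime is a connected smooth manifold $M$ with a smooth Lorentzian metric $g$ of signature $(-,+,\dots,+)$ and a time orientation. A piecewise smooth curve is future (resp. past) causal or timelike if all its tangent vectors, including one-sided tangents at breaks and endpoints, are future (resp. past) pointing causal or timelike; nontrivial curves are assumed regularly parametrized, and constant curves count as causal. Write $x\le y$ if there is a future causal curve from $x$ to $y$ (or $x=y$). For a future causal curve $\alpha:[a,b]\to M$, its Lorentzian length is $L_g(\alpha)=\int_a^b\sqrt{|g(\alpha',\alpha')|}\,ds$. The Lorentzian distance is $d_g(p,q)=\sup\{L_g(\alpha): \alpha \text{ future causal from } p \text{ to } q\}$ (and $0$ if there is no such curve). The cosmological time function is $\tau_g(q)=\sup_{p\le q} d_g(p,q)$. It is called regular if $\tau_g$ is finite everywhere on $M$ and $\tau_g\to 0$ along every past-inextendible causal curve. A generalized time function is a function $\tau:M\to\mathbb{R}$ strictly increasing along every nontrivial future causal curve. A piecewise causal curve $\beta:[a,b]\to M$ is one admitting a partition $a=s_0<\dots<s_k=b$ such that each restriction $\beta|_{[s_{i-1},s_i]}$ is a smooth future or past causal curve; its null length is $\hat{L}_\tau(\beta)=\sum_{i=1}^k|\tau(\beta(s_i))-\tau(\beta(s_{i-1}))|$, and the null distance is $\hat{d}_\tau(p,q)=\inf\{\hat{L}_\tau(\beta):\beta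 \text{ piecewise causal from } p \text{ to } q\}$. A function $f:M\to\mathbb{R}$ is locally anti-Lipschitz if every point $p\in M$ has a neighborhood $U$ carrying a (definite) distance function $d_U$ on $U$ such that for all $x,y\in U$, $x\le y$ implies $f(y)-f(x)\ge d_U(x,y)$. *)

theory Defs
  imports "HOL-Analysis.Analysis"
begin

inductive_set iter_derivs ::
  "('x::real_normed_vector) set \<Rightarrow> ('x \<Rightarrow> 'y::real_normed_vector) \<Rightarrow> ('x \<Rightarrow> 'y) set"
  for S f where
  base: "f \<in> iter_derivs S f"
| step: "h \<in> iter_derivs S f \<Longrightarrow> (\<lambda>x. frechet_derivative h (at x) v) \<in> iter_derivs S f"

text \<open>f is C-infinity on the open set S: all iterated derivatives exist (hence are continuous).\<close>
definition smooth_on :: "('x::real_normed_vector) set \<Rightarrow> ('x \<Rightarrow> 'y::real_normed_vector) \<Rightarrow> bool" where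
  "smooth_on S f \<longleftrightarrow> open S \<and> (\<forall>h \<in> iter_derivs S f. h differentiable_on S)"

type_synonym ('a, 'n) chart = "'a set \<times> ('a \<Rightarrow> real^'n)"

definition is_chart :: "('a::topological_space, 'n::finite) chart \<Rightarrow> bool" where
  "is_chart c \<longleftrightarrow> open (fst c) \<and> open (snd c ` fst c) \<and>
     (\<exists>\<psi>. homeomorphism (fst c) (snd c ` fst c) (snd c) \<psi>)"

definition transition :: "('a, 'n::finite) chart \<Rightarrow> ('a, 'n) chart \<Rightarrow> real^'n \<Rightarrow> real^'n" where
  "transition c d = snd d \<circ> inv_into (fst c) (snd c)"

definition smooth_atlas :: "('a::topological_space, 'n::finite) chart set \<Rightarrow> bool" where
  "smooth_atlas A \<longleftrightarrow> (\<forall>c\<in>A. is_chart c) \<and> (\<Union>c\<in>A. fst c) = UNIV \<and>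
     (\<forall>c\<in>A. \<forall>d\<in>A. smooth_on (snd c ` (fst c \<inter> fst d)) (transition c d))"

definition jac :: "('a, 'n::finite) chart \<Rightarrow> ('a, 'n) chart \<Rightarrow> 'a \<Rightarrow> real^'n \<Rightarrow> real^'n" where
  "jac c d p = frechet_derivative (transition c d) (at (snd c p))"

definition bform :: "real^'n^'n \<Rightarrow> real^'n \<Rightarrow> real^'n \<Rightarrow> real" where
  "bform M v w = v \<bullet> (M *v w)"

text \<open>Symmetric bilinear form of signature (-,+,...,+).\<close>
definition lorentzian_form :: "real^'n^'n \<Rightarrow> bool" where
  "lorentzian_form M \<longleftrightarrow> transpose M = M \<and>
     (\<exists>v. bform M v v < 0 \<and> (\<forall>w. w \<noteq> 0 \<and> bform M v w = 0 \<longrightarrow> bform M w w > 0))"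

text \<open>G c p is the coefficient matrix of the metric at p in chart c.\<close>
definition lorentz_metric ::
  "('a::topological_space, 'n::finite) chart set \<Rightarrow> (('a,'n) chart \<Rightarrow> 'a \<Rightarrow> real^'n^'n) \<Rightarrow> bool" where
  "lorentz_metric A G \<longleftrightarrow>
     (\<forall>c\<in>A. smooth_on (snd c ` fst c) (\<lambda>y. G c (inv_into (fst c) (snd c) y))) \<and>
     (\<forall>c\<in>A. \<forall>p\<in>fst c. lorentzian_form (G c p)) \<and>
     (\<forall>c\<in>A. \<forall>d\<in>A. \<forall>p\<in>fst c \<inter> fst d. \<forall>v w.
        bform (G c p) v w = bform (G d p) (jac c d p v) (jac c d p w))"

definition time_orientation ::
  "('a::topological_space, 'n::finite) chart set \<Rightarrow> (('a,'n) chart \<Rightarrow> 'a \<Rightarrow> real^'n^'n)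
     \<Rightarrow> (('a,'n) chart \<Rightarrow> 'a \<Rightarrow> real^'n) \<Rightarrow> bool" where
  "time_orientation A G T \<longleftrightarrow>
     (\<forall>c\<in>A. continuous_on (snd c ` fst c) (\<lambda>y. T c (inv_into (fst c) (snd c) y))) \<and>
     (\<forall>c\<in>A. \<forall>p\<in>fst c. bform (G c p) (T c p) (T c p) < 0) \<and>
     (\<forall>c\<in>A. \<forall>d\<in>A. \<forall>p\<in>fst c \<inter> fst d. T d p = jac c d p (T c p))"

definition spacetime ::
  "('a::{t2_space,second_countable_topology}, 'n::finite) chart set \<Rightarrow> (('a,'n) chart \<Rightarrow> 'a \<Rightarrow> real^'n^'n)
     \<Rightarrow> (('a,'n) chart \<Rightarrow> 'a \<Rightarrow> real^'n) \<Rightarrow> bool" where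
  "spacetime A G T \<longleftrightarrow> connected (UNIV :: 'a set) \<and> smooth_atlas A \<and> lorentz_metric A G \<and>
     time_orientation A G T"

definition fut_causal_vec where
  "fut_causal_vec G T c p v \<longleftrightarrow> v \<noteq> 0 \<and> bform (G c p) v v \<le> 0 \<and> bform (G c p) v (T c p) < 0"

definition past_causal_vec where
  "past_causal_vec G T c p v \<longleftrightarrow> v \<noteq> 0 \<and> bform (G c p) v v \<le> 0 \<and> bform (G c p) v (T c p) > 0"

definition smooth_curve_on :: "('a::topological_space, 'n::finite) chart set \<Rightarrow> real set \<Rightarrow> (real \<Rightarrow> 'a) \<Rightarrow> bool" where
  "smooth_curve_on A I \<beta> \<longleftrightarrow> continuous_on I \<beta> \<and>
     (\<forall>c\<in>A. smooth_on (I \<inter> \<beta> -` fst c) (snd c \<circ> \<beta>))"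

definition smooth_seg :: "('a::topological_space, 'n::finite) chart set \<Rightarrow> real \<Rightarrow> real \<Rightarrow> (real \<Rightarrow> 'a) \<Rightarrow> bool" where
  "smooth_seg A s t \<alpha> \<longleftrightarrow> s < t \<and>
     (\<exists>\<epsilon>>0. \<exists>\<beta>. smooth_curve_on A {s-\<epsilon><..<t+\<epsilon>} \<beta> \<and> (\<forall>\<tau>\<in>{s..t}. \<beta> \<tau> = \<alpha> \<tau>))"

definition tangent :: "('a, 'n::finite) chart \<Rightarrow> real \<Rightarrow> real \<Rightarrow> (real \<Rightarrow> 'a) \<Rightarrow> real \<Rightarrow> real^'n" where
  "tangent c s t \<alpha> \<tau> = vector_derivative (snd c \<circ> \<alpha>) (at \<tau> within {s..t})"

definition fut_causal_seg where
  "fut_causal_seg A G T s t \<alpha> \<longleftrightarrow> smooth_seg A s t \<alpha> \<and>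
     (\<forall>\<tau>\<in>{s..t}. \<forall>c\<in>A. \<alpha> \<tau> \<in> fst c \<longrightarrow> fut_causal_vec G T c (\<alpha> \<tau>) (tangent c s t \<alpha> \<tau>))"

definition past_causal_seg where
  "past_causal_seg A G T s t \<alpha> \<longleftrightarrow> smooth_seg A s t \<alpha> \<and>
     (\<forall>\<tau>\<in>{s..t}. \<forall>c\<in>A. \<alpha> \<tau> \<in> fst c \<longrightarrow> past_causal_vec G T c (\<alpha> \<tau>) (tangent c s t \<alpha> \<tau>))"

definition is_partition :: "real \<Rightarrow> real \<Rightarrow> nat \<Rightarrow> (nat \<Rightarrow> real) \<Rightarrow> bool" where
  "is_partition a b k s \<longleftrightarrow> s 0 = a \<and> s k = b \<and> (\<forall>i<k. s i < s (Suc i))"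

definition fut_causal_curve where
  "fut_causal_curve A G T \<alpha> a b k s \<longleftrightarrow> is_partition a b k s \<and>
     (\<forall>i<k. fut_causal_seg A G T (s i) (s (Suc i)) \<alpha>)"

definition causal_curve_on where
  "causal_curve_on A G T \<alpha> a b \<longleftrightarrow> a \<le> b \<and>
     ((\<forall>\<tau>\<in>{a..b}. \<alpha> \<tau> = \<alpha> a) \<or> (\<exists>k s. fut_causal_curve A G T \<alpha> a b k s))"

definition causal_le where
  "causal_le A G T x y \<longleftrightarrow> x = y \<or> (\<exists>\<alpha> a b. causal_curve_on A G T \<alpha> a b \<and> \<alpha> a = x \<and> \<alpha> b = y)"

text \<open>Speed sqrt|g(alpha',alpha')| at tau (chart independent by the transformation law).\<close>
definition lspeed where
  "lspeed A G s t \<alpha> \<tau> = (SOME r. \<exists>c\<in>A. \<alpha> \<tau> \<in> fst c \<and>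
       r = sqrt \<bar>bform (G c (\<alpha> \<tau>)) (tangent c s t \<alpha> \<tau>) (tangent c s t \<alpha> \<tau>)\<bar>)"

definition lor_length where
  "lor_length A G \<alpha> k s = (\<Sum>i<k. integral {s i..s (Suc i)} (lspeed A G (s i) (s (Suc i)) \<alpha>))"

text \<open>Lorentzian distance (extended real; 0 if there is no causal curve; constant curves have length 0).\<close>
definition lor_dist :: "('a::topological_space, 'n::finite) chart set \<Rightarrow> (('a,'n) chart \<Rightarrow> 'a \<Rightarrow> real^'n^'n)
     \<Rightarrow> (('a,'n) chart \<Rightarrow> 'a \<Rightarrow> real^'n) \<Rightarrow> 'a \<Rightarrow> 'a \<Rightarrow> ereal" where
  "lor_dist A G T p q = Sup ({0} \<union> {ereal (lor_length A G \<alpha> k s) | \<alpha> a b k s.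
       fut_causal_curve A G T \<alpha> a b k s \<and> \<alpha> a = p \<and> \<alpha> b = q})"

definition cosmo_time where
  "cosmo_time A G T q = (SUP p\<in>{p. causal_le A G T p q}. lor_dist A G T p q)"

definition past_inext_causal_curve where
  "past_inext_causal_curve A G T \<gamma> a b \<longleftrightarrow> a < b \<and>
     (\<forall>c\<in>{a<..<b}. causal_curve_on A G T \<gamma> c b) \<and> \<not> (\<exists>p. (\<gamma> \<longlongrightarrow> p) (at_right a))"

definition regular_cosmo_time where
  "regular_cosmo_time A G T \<longleftrightarrow> (\<forall>q. cosmo_time A G T q \<noteq> \<infinity>) \<and>
     (\<forall>\<gamma> a b. past_inext_causal_curve A G T \<gamma> a b \<longrightarrow>
        ((\<lambda>t. cosmo_time A G T (\<gamma> t)) \<longlongrightarrow> 0) (at_right a))"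

definition piecewise_causal where
  "piecewise_causal A G T \<beta> a b k s \<longleftrightarrow> is_partition a b k s \<and>
     (\<forall>i<k. fut_causal_seg A G T (s i) (s (Suc i)) \<beta> \<or> past_causal_seg A G T (s i) (s (Suc i)) \<beta> \<or>
            (\<forall>\<tau>\<in>{s i..s (Suc i)}. \<beta> \<tau> = \<beta> (s i)))"

definition null_length :: "('a \<Rightarrow> real) \<Rightarrow> (real \<Rightarrow> 'a) \<Rightarrow> nat \<Rightarrow> (nat \<Rightarrow> real) \<Rightarrow> real" where
  "null_length f \<beta> k s = (\<Sum>i<k. \<bar>f (\<beta> (s (Suc i))) - f (\<beta> (s i))\<bar>)"

definition null_dist where
  "null_dist A G T f p q = Inf {null_length f \<beta> k s | \<beta> a b k s.
       piecewise_causal A G T \<beta> a b k s \<and> \<beta> a = p \<and> \<beta> b = q}"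

definition distance_on :: "'a set \<Rightarrow> ('a \<Rightarrow> 'a \<Rightarrow> real) \<Rightarrow> bool" where
  "distance_on U d \<longleftrightarrow> (\<forall>x\<in>U. \<forall>y\<in>U. d x y \<ge> 0 \<and> (d x y = 0 \<longleftrightarrow> x = y) \<and> d x y = d y x) \<and>
     (\<forall>x\<in>U. \<forall>y\<in>U. \<forall>z\<in>U. d x z \<le> d x y + d y z)"

definition locally_anti_lipschitz where
  "locally_anti_lipschitz A G T f \<longleftrightarrow> (\<forall>p. \<exists>U d. open U \<and> p \<in> U \<and> distance_on U d \<and>
     (\<forall>x\<in>U. \<forall>y\<in>U. causal_le A G T x y \<longrightarrow> f y - f x \<ge> d x y))"

end

theory Submission
  imports Defs
begin

text \<open>The core is that a regular cosmological time \<open>\<tau>\<close> is locally Lipschitz. Suppose it is not at \<open>p\<close>, and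
  take almost maximal curves ending at points \<open>y\<close> near \<open>p\<close> where \<open>\<tau>(y) - \<tau>(y - h e)\<close> is huge compared with \<open>h\<close>
  (\<open>e\<close> a timelike chart vector). Shifting the curve along \<open>-e\<close> shows that \<open>\<tau>\<close> is as steep at every earlier point
  of the curve. Where the curve is uniformly timelike, dilating it towards its initial point bounds the
  steepness, so the curve is almost null and \<open>\<tau>\<close> hardly drops along it. In the limit the failure propagates to a point on the boundary
  of a fixed chart ball, with \<open>\<tau>\<close> bounded below by the same constant; iterating and moving slightly to the future yields a past inextendible
  causal curve on which \<open>\<tau>\<close> does not tend to \<open>0\<close>, contradicting regularity.

  The anti-Lipschitz bound follows by comparing powers. For a causal curve from \<open>x\<close> to \<open>y\<close> of chart length \<open>l\<close>,
  the tilted curve from \<open>x - k l e\<close> to \<open>y\<close> has Lorentzian length at least a multiple of \<open>\<surd>k l\<close>,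
  while \<open>\<tau>(x) - \<tau>(x - k l e)\<close> is at most a multiple of \<open>k l\<close>; take \<open>k\<close> small.\<close>

section \<open>Smooth maps\<close>

text \<open>Every step loses only an arbitrarily small part of that bound, and the loss vanishes in
  the limit point, so infinitely many steps cost nothing. Limits of curves are never formed: only
  end points converge, and the relation \<open>beyond\<close>, which is open in the lower point,
  lets a point slightly above the limit replace a limit curve.

  The obstacle to deforming curves is that the metric varies: a chart translate of a causal curve
  need not be causal. Each deformation therefore adds to the velocity a small multiple of
  \<open>e\<close> proportional to its size. The quadratic form gains linearly in this tilt, which
  absorbs the Lipschitz variation of the metric; the length, being a square root, gains like the
  square root of the tilt. The same fact drives the final comparison of powers.

  Two radii occur throughout: curves in the ball of radius \<open>R\<close> are deformed inside the
  ball of radius \<open>2 * R\<close>.\<close>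

lemma smooth_on_coinduct:
  assumes "open S" "u \<in> X"
    and "\<And>u. u \<in> X \<Longrightarrow> u differentiable_on S"
    and "\<And>u v. u \<in> X \<Longrightarrow> \<exists>w\<in>X. \<forall>x\<in>S. w x = frechet_derivative u (at x) v"
  shows "smooth_on S u"
proof -
  have eq: "frechet_derivative h (at x) = frechet_derivative w (at x)"
    if "\<forall>x\<in>S. h x = w x" "x \<in> S" for h w :: "'a \<Rightarrow> 'b" and x
  proof -
    have "(h has_derivative D) (at x) \<longleftrightarrow> (w has_derivative D) (at x)" for D
      using that \<open>open S\<close> by (metis has_derivative_transform_within_open)
    then show ?thesis unfolding frechet_derivative_def by simp
  qed
  \<comment> \<open>Agreement on \<open>S\<close> is the right invariant: on an open set derivatives
    depend only on the values there, and off \<open>S\<close> nothing is known about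
    \<open>frechet_derivative\<close>.\<close>
  have ex: "\<exists>w\<in>X. \<forall>x\<in>S. h x = w x" if "h \<in> iter_derivs S u" for h
    using that
  proof induction
    case base
    then show ?case using assms(2) by auto
  next
    case (step h v)
    then obtain w where w: "w \<in> X" "\<forall>x\<in>S. h x = w x" by auto
    obtain w' where "w' \<in> X" "\<forall>x\<in>S. w' x = frechet_derivative w (at x) v"
      using assms(4)[OF w(1)] by blast
    then show ?case using eq[OF w(2)] by (metis (no_types, lifting))
  qed
  show ?thesis unfolding smooth_on_def
  proof (intro conjI ballI)
    fix h assume "h \<in> iter_derivs S u"
    then obtain w where w: "w \<in> X" "\<forall>x\<in>S. h x = w x" using ex by blast
    show "h differentiable_on S"
      using assms(3)[OF w(1)] w(2) unfolding differentiable_on_def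
      by (metis differentiable_transform_within zero_less_one)
  qed fact
qed

lemma smooth_on_differentiable_on: "smooth_on S f \<Longrightarrow> f differentiable_on S"
  by (auto simp: smooth_on_def intro: iter_derivs.base)

lemma smooth_on_open: "smooth_on S f \<Longrightarrow> open S"
  by (simp add: smooth_on_def)

lemma smooth_on_has_derivative:
  assumes "smooth_on S f" "x \<in> S"
  shows "(f has_derivative frechet_derivative f (at x)) (at x)"
  using smooth_on_differentiable_on[OF assms(1)] smooth_on_open[OF assms(1)] assms(2)
  by (metis at_within_open differentiable_on_def frechet_derivative_works)

lemma iter_derivs_smooth_on:
  assumes "smooth_on S f" "h \<in> iter_derivs S f"
  shows "smooth_on S h"
proof -
  have "k \<in> iter_derivs S f" if "k \<in> iter_derivs S h" for k
    using that by induction (auto intro: assms(2) iter_derivs.step)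
  then show ?thesis using assms(1) by (auto simp: smooth_on_def)
qed

lemma smooth_on_frechet:
  assumes "smooth_on S f"
  shows "smooth_on S (\<lambda>x. frechet_derivative f (at x) v)"
  by (rule iter_derivs_smooth_on[OF assms]) (intro iter_derivs.intros)

lemma smooth_on_continuous_on: "smooth_on S f \<Longrightarrow> continuous_on S f"
  by (simp add: smooth_on_differentiable_on differentiable_imp_continuous_on)

lemma smooth_on_subset:
  assumes "smooth_on S f" "open T" "T \<subseteq> S"
  shows "smooth_on T f"
proof -
  have "h \<in> iter_derivs S f" if "h \<in> iter_derivs T f" for h
    using that by induction (auto intro: iter_derivs.intros)
  then show ?thesis using assms unfolding smooth_on_def
    by (meson differentiable_on_subset)
qed

lemma has_derivative_imp_frechet_eq:
  "(f has_derivative D) (at x) \<Longrightarrow> frechet_derivative f (at x) v = D v"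
  by (metis frechet_derivative_at)

lemma smooth_on_affine_image:
  assumes "smooth_on S f" "bounded_linear L"
  shows "smooth_on S (\<lambda>x. b + L (f x))"
proof -
  let ?X = "{g. \<exists>f b. smooth_on S f \<and> g = (\<lambda>x. b + L (f x))}"
  have op: "open S" using assms(1) by (rule smooth_on_open)
  have D: "((\<lambda>x. b + L (f x)) has_derivative (\<lambda>v. L (frechet_derivative f (at x) v))) (at x)"
    if "smooth_on S f" "x \<in> S" for f :: "_ \<Rightarrow> _" and b x
    using smooth_on_has_derivative[OF that] 
    by (auto intro!: derivative_eq_intros bounded_linear.has_derivative[OF assms(2)])
  show ?thesis
  proof (rule smooth_on_coinduct[OF op, of _ ?X])
    show "(\<lambda>x. b + L (f x)) \<in> ?X" using assms by auto
  next
    fix u assume "u \<in> ?X"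
    then show "u differentiable_on S"
      unfolding differentiable_on_def differentiable_def
      using D by (blast intro: has_derivative_at_withinI)
  next
    fix u v assume "u \<in> ?X"
    then obtain f b where f: "smooth_on S f" "u = (\<lambda>x. b + L (f x))" by auto
    \<comment> \<open>The zero keeps the derivative in the shape \<open>b + L (f x)\<close> that
      defines \<open>?X\<close>.\<close>
    have "0 + L (frechet_derivative f (at x) v) = frechet_derivative u (at x) v" if "x \<in> S" for x
      using has_derivative_imp_frechet_eq[OF D[OF f(1) that]] f(2) by auto
    then show "\<exists>w\<in>?X. \<forall>x\<in>S. w x = frechet_derivative u (at x) v"
      using smooth_on_frechet[OF f(1), of v] 
      by (intro bexI[of _ "\<lambda>x. 0 + L (frechet_derivative f (at x) v)"]) blast+
  qed
qed

lemma smooth_on_compose_affine: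
  fixes f :: "real \<Rightarrow> 'b::real_normed_vector"
  assumes "smooth_on S f"
  shows "smooth_on ((\<lambda>t. m * t + b) -` S) (\<lambda>t. f (m * t + b))"
proof -
  let ?A = "\<lambda>t. m * t + b"
  let ?X = "{g. \<exists>f :: real \<Rightarrow> 'b. smooth_on S f \<and> g = (\<lambda>x. f (?A x))}"
  have op: "open (?A -` S)" 
    by (intro open_vimage smooth_on_open[OF assms] continuous_intros)
  have D: "((\<lambda>x. f (?A x)) has_derivative (\<lambda>v. frechet_derivative f (at (?A x)) (m * v))) (at x)"
    if "smooth_on S f" "?A x \<in> S" for f :: "real \<Rightarrow> 'b" and x
  proof -
    have "(?A has_derivative (\<lambda>v. m * v)) (at x)" by (auto intro!: derivative_eq_intros)
    from has_derivative_compose[OF this smooth_on_has_derivative[OF that]]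
    show ?thesis .
  qed
  show ?thesis
  proof (rule smooth_on_coinduct[OF op, of _ ?X])
    show "(\<lambda>x. f (?A x)) \<in> ?X" using assms by auto
  next
    fix u assume "u \<in> ?X"
    then obtain f where f: "smooth_on S f" "u = (\<lambda>x. f (?A x))" by auto
    show "u differentiable_on (?A -` S)"
      unfolding differentiable_on_def differentiable_def f(2)
      using D[OF f(1)] has_derivative_at_withinI by (metis vimageD)
  next
    fix u v assume "u \<in> ?X"
    then obtain f where f: "smooth_on S f" "u = (\<lambda>x. f (?A x))" by auto
    have "frechet_derivative f (at (?A x)) (m * v) = frechet_derivative u (at x) v" if "x \<in> ?A -` S" for x
      using has_derivative_imp_frechet_eq[OF D[OF f(1)]] f(2) that by auto
    then show "\<exists>w\<in>?X. \<forall>x\<in>?A -` S. w x = frechet_derivative u (at x) v"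
      using smooth_on_frechet[OF f(1), of "m * v"] 
      by (intro bexI[of _ "\<lambda>x. frechet_derivative f (at (?A x)) (m * v)"]) blast+
  qed
qed

text \<open>Closed under differentiation by the chain and product rules, whence \<open>smooth_on_coinduct\<close> applies.\<close>

inductive_set comp_derivs :: "real set \<Rightarrow> 'x::real_normed_vector set \<Rightarrow> (real \<Rightarrow> 'x) \<Rightarrow> (real \<Rightarrow> 'y::real_normed_vector) set"
  for I S u where
  comp: "smooth_on S g \<Longrightarrow> (\<lambda>t. g (u t)) \<in> comp_derivs I S u"
| zero: "(\<lambda>t. 0) \<in> comp_derivs I S u"
| add: "p \<in> comp_derivs I S u \<Longrightarrow> q \<in> comp_derivs I S u \<Longrightarrow> (\<lambda>t. p t + q t) \<in> comp_derivs I S u"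
| scale: "smooth_on I a \<Longrightarrow> p \<in> comp_derivs I S u \<Longrightarrow> (\<lambda>t. (a t :: real) *\<^sub>R p t) \<in> comp_derivs I S u"

lemma comp_derivs_sum:
  "finite B \<Longrightarrow> (\<And>b. b \<in> B \<Longrightarrow> p b \<in> comp_derivs I S u) \<Longrightarrow> (\<lambda>t. \<Sum>b\<in>B. p b t) \<in> comp_derivs I S u"
  by (induction B rule: finite_induct) (auto intro: comp_derivs.zero comp_derivs.add)

lemma smooth_on_compose:
  fixes u :: "real \<Rightarrow> 'x::euclidean_space" and f :: "'x \<Rightarrow> 'y::real_normed_vector"
  assumes f: "smooth_on S f" and u: "smooth_on I u" and sub: "u ` I \<subseteq> S"
  shows "smooth_on I (\<lambda>t. f (u t))"
proof -
  have op: "open I" using u by (rule smooth_on_open)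
  have scal: "smooth_on I (\<lambda>t. frechet_derivative u (at t) v \<bullet> b)" for b v
    using smooth_on_affine_image[OF smooth_on_frechet[OF u, of v], of "\<lambda>x. x \<bullet> b" 0]
    by (simp add: bounded_linear_inner_left)
  have key: "\<exists>D. (\<forall>t\<in>I. (p has_derivative D t) (at t)) \<and> (\<forall>v. (\<lambda>t. D t v) \<in> comp_derivs I S u)"
    if "p \<in> comp_derivs I S u" for p :: "real \<Rightarrow> 'y"
    using that
  proof induction
    case (comp g)
    let ?D = "\<lambda>t v. frechet_derivative g (at (u t)) (frechet_derivative u (at t) v)"
    \<comment> \<open>In \<open>?D\<close> the direction in which \<open>g\<close> is differentiated
      varies with \<open>t\<close>, so it is not a fixed map composed with \<open>u\<close>.
      Expanding that direction in the basis gives scalar smooth functions times such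
      composites.\<close>
    let ?E = "\<lambda>t v. \<Sum>b\<in>Basis. (frechet_derivative u (at t) v \<bullet> b) *\<^sub>R frechet_derivative g (at (u t)) b"
    have "((\<lambda>t. g (u t)) has_derivative ?E t) (at t)" if "t \<in> I" for t
    proof -
      have g: "(g has_derivative frechet_derivative g (at (u t))) (at (u t))"
        using smooth_on_has_derivative[OF comp] sub that by auto
      then have lin: "linear (frechet_derivative g (at (u t)))"
        by (simp add: has_derivative_linear)
      have "((\<lambda>t. g (u t)) has_derivative ?D t) (at t)"
        using has_derivative_compose[OF smooth_on_has_derivative[OF u that] g] .
      moreover have "?D t v = ?E t v" for v
      proof -
        have "?D t v = frechet_derivative g (at (u t)) (\<Sum>b\<in>Basis. (frechet_derivative u (at t) v \<bullet> b) *\<^sub>R b)"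
          by (simp add: euclidean_representation)
        also have "\<dots> = ?E t v" using lin by (simp add: linear_sum linear_scale)
        finally show ?thesis .
      qed
      ultimately show ?thesis by (metis (no_types, lifting) ext)
    qed
    moreover have "(\<lambda>t. ?E t v) \<in> comp_derivs I S u" for v
      by (intro comp_derivs_sum finite_Basis comp_derivs.scale scal comp_derivs.comp smooth_on_frechet comp)
    ultimately show ?case by (intro exI[of _ ?E]) blast
  next
    case zero
    show ?case by (intro exI[of _ "\<lambda>t v. 0"]) (auto intro: comp_derivs.zero)
  next
    case (add p q)
    then obtain D E where "\<forall>t\<in>I. (p has_derivative D t) (at t)" "\<forall>v. (\<lambda>t. D t v) \<in> comp_derivs I S u"
      "\<forall>t\<in>I. (q has_derivative E t) (at t)" "\<forall>v. (\<lambda>t. E t v) \<in> comp_derivs I S u" by blast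
    then show ?case 
      by (intro exI[of _ "\<lambda>t v. D t v + E t v"]) (auto intro: has_derivative_add comp_derivs.add)
  next
    case (scale a p)
    then obtain D where D: "\<forall>t\<in>I. (p has_derivative D t) (at t)" "\<forall>v. (\<lambda>t. D t v) \<in> comp_derivs I S u"
      by blast
    show ?case 
    proof (intro exI[of _ "\<lambda>t v. a t *\<^sub>R D t v + frechet_derivative a (at t) v *\<^sub>R p t"] conjI ballI allI)
      fix t assume "t \<in> I"
      then show "((\<lambda>t. a t *\<^sub>R p t) has_derivative (\<lambda>v. a t *\<^sub>R D t v + frechet_derivative a (at t) v *\<^sub>R p t)) (at t)"
        using D(1) smooth_on_has_derivative[OF scale(1)] by (intro has_derivative_scaleR) auto
    next
      fix v
      show "(\<lambda>t. a t *\<^sub>R D t v + frechet_derivative a (at t) v *\<^sub>R p t) \<in> comp_derivs I S u"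
        using D(2) scale by (intro comp_derivs.add comp_derivs.scale smooth_on_frechet) auto
    qed
  qed
  show ?thesis
  proof (rule smooth_on_coinduct[OF op, of _ "comp_derivs I S u"])
    show "(\<lambda>t. f (u t)) \<in> comp_derivs I S u" using f by (rule comp_derivs.comp)
  next
    fix p :: "real \<Rightarrow> 'y" assume "p \<in> comp_derivs I S u"
    then show "p differentiable_on I"
      using key unfolding differentiable_on_def differentiable_def
      by (blast intro: has_derivative_at_withinI)
  next
    fix p :: "real \<Rightarrow> 'y" and v assume "p \<in> comp_derivs I S u"
    then obtain D where D: "\<forall>t\<in>I. (p has_derivative D t) (at t)" "(\<lambda>t. D t v) \<in> comp_derivs I S u"
      using key by blast
    then show "\<exists>w\<in>comp_derivs I S u. \<forall>t\<in>I. w t = frechet_derivative p (at t) v"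
      using has_derivative_imp_frechet_eq by (metis (no_types, lifting))
  qed
qed

lemma smooth_on_Lipschitz:
  fixes f :: "'x::euclidean_space \<Rightarrow> 'y::euclidean_space"
  assumes "smooth_on S f" "cball x r \<subseteq> S"
  obtains K where "K > 0" "\<And>y z. y \<in> cball x r \<Longrightarrow> z \<in> cball x r \<Longrightarrow> norm (f y - f z) \<le> K * norm (y - z)"
proof -
  have "\<exists>K. \<forall>y\<in>cball x r. norm (frechet_derivative f (at y) b) \<le> K" for b
  proof -
    have "compact ((\<lambda>y. frechet_derivative f (at y) b) ` cball x r)"
      using smooth_on_continuous_on[OF smooth_on_frechet[OF assms(1)]] assms(2)
      by (intro compact_continuous_image compact_cball) (auto intro: continuous_on_subset)
    from compact_imp_bounded[OF this] show ?thesis by (auto simp: bounded_iff)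
  qed
  then obtain k where k: "\<And>b y. y \<in> cball x r \<Longrightarrow> norm (frechet_derivative f (at y) b) \<le> k b"
    by metis
  let ?K = "\<Sum>b\<in>(Basis::'x set). \<bar>k b\<bar>"
  have on: "onorm (frechet_derivative f (at y)) \<le> ?K" if "y \<in> cball x r" for y
  proof (rule onorm_componentwise[THEN order_trans])
    show "bounded_linear (frechet_derivative f (at y))"
      using smooth_on_has_derivative[OF assms(1)] that assms(2) has_derivative_bounded_linear by blast
    show "(\<Sum>i\<in>Basis. norm (frechet_derivative f (at y) i)) \<le> ?K"
      using k[OF that] by (intro sum_mono) (meson abs_ge_self order_trans)
  qed
  \<comment> \<open>The added 1 makes the constant positive even if \<open>?K\<close> is
    zero.\<close>
  have "norm (f y - f z) \<le> (?K + 1) * norm (y - z)" if "y \<in> cball x r" "z \<in> cball x r" for y z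
  proof -
    have "norm (f y - f z) \<le> ?K * norm (y - z)"
    proof (rule differentiable_bound[of "cball x r" f "\<lambda>y. frechet_derivative f (at y)"])
      fix y assume "y \<in> cball x r"
      then show "(f has_derivative frechet_derivative f (at y)) (at y within cball x r)"
        using smooth_on_has_derivative[OF assms(1)] assms(2) has_derivative_at_withinI by blast
    qed (use on that in auto)
    also have "\<dots> \<le> (?K + 1) * norm (y - z)" by (simp add: mult_right_mono)
    finally show ?thesis .
  qed
  moreover have "?K + 1 > 0" by (simp add: add_nonneg_pos sum_nonneg)
  ultimately show ?thesis using that by blast
qed

section \<open>Charts and causal segments\<close>

lemma open_superset_Icc:
  fixes s t :: real
  assumes "open S" "{s..t} \<subseteq> S" "s \<le> t"
  obtains e where "e > 0" "{s-e<..<t+e} \<subseteq> S"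
proof -
  obtain e1 where e1: "e1 > 0" "ball s e1 \<subseteq> S" using assms by (meson atLeastAtMost_iff open_contains_ball order_refl subset_iff)
  obtain e2 where e2: "e2 > 0" "ball t e2 \<subseteq> S" using assms by (meson atLeastAtMost_iff open_contains_ball order_refl subset_iff)
  have "x \<in> S" if "x \<in> {s - min e1 e2<..<t + min e1 e2}" for x
  proof -
    consider "x \<in> {s..t}" | "x < s" | "x > t" by force
    then show ?thesis
    proof cases
      case 1 then show ?thesis using assms by auto
    next
      case 2 then have "x \<in> ball s e1" using that by (auto simp: dist_real_def)
      then show ?thesis using e1 by auto
    next
      case 3 then have "x \<in> ball t e2" using that by (auto simp: dist_real_def)
      then show ?thesis using e2 by auto
    qed
  qed
  then have "{s - min e1 e2<..<t + min e1 e2} \<subseteq> S" by blast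
  then show ?thesis using that[of "min e1 e2"] e1 e2 by (metis min_less_iff_conj)
qed

lemma bform_linear:
  "bform M (v + w) z = bform M v z + bform M w z"
  "bform M v (w + z) = bform M v w + bform M v z"
  "bform M (a *\<^sub>R v) z = a * bform M v z"
  "bform M v (a *\<^sub>R z) = a * bform M v z"
  "bform M v 0 = 0" "bform M 0 v = 0"
  by (simp_all add: bform_def inner_left_distrib inner_right_distrib matrix_vector_mult_scaleR matrix_vector_right_distrib)

lemma bform_minus: "bform M (- v) w = - bform M v w" "bform M v (- w) = - bform M v w"
  using bform_linear(3)[of M "-1" v w] bform_linear(4)[of M v "-1" w] by simp_all

locale spacetime_ctx =
  fixes A :: "('a::{t2_space,second_countable_topology}, 'n::finite) chart set"
    and G :: "('a,'n) chart \<Rightarrow> 'a \<Rightarrow> real^'n^'n"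
    and T :: "('a,'n) chart \<Rightarrow> 'a \<Rightarrow> real^'n"
  assumes spacetime: "spacetime A G T"
begin

abbreviation cdom :: "('a,'n) chart \<Rightarrow> (real^'n) set" where
  "cdom c \<equiv> snd c ` fst c"

definition cinv :: "('a,'n) chart \<Rightarrow> real^'n \<Rightarrow> 'a" where
  "cinv c = inv_into (fst c) (snd c)"

definition gform :: "('a,'n) chart \<Rightarrow> real^'n \<Rightarrow> real^'n \<Rightarrow> real^'n \<Rightarrow> real" where
  "gform c y = bform (G c (cinv c y))"

definition fcv :: "('a,'n) chart \<Rightarrow> real^'n \<Rightarrow> real^'n \<Rightarrow> bool" where
  "fcv c y = fut_causal_vec G T c (cinv c y)"

definition gspeed :: "('a,'n) chart \<Rightarrow> real^'n \<Rightarrow> real^'n \<Rightarrow> real" where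
  "gspeed c y v = sqrt \<bar>gform c y v v\<bar>"

definition seglen :: "real \<Rightarrow> real \<Rightarrow> (real \<Rightarrow> 'a) \<Rightarrow> real" where
  "seglen s t \<alpha> = integral {s..t} (lspeed A G s t \<alpha>)"

lemma atlas: "smooth_atlas A" and metric: "lorentz_metric A G" and orient: "time_orientation A G T"
  and conn: "connected (UNIV :: 'a set)"
  using spacetime by (auto simp: spacetime_def)

lemma chart_exists: obtains c where "c \<in> A" "p \<in> fst c"
  using atlas unfolding smooth_atlas_def by blast

text \<open>\<open>is_chart\<close> provides just some inverse; it coincides on the image with
  \<open>inv_into\<close>, the inverse in terms of which smoothness of the metric is stated.\<close>

lemma chart_homeo: "c \<in> A \<Longrightarrow> homeomorphism (fst c) (cdom c) (snd c) (cinv c)"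
proof -
  assume "c \<in> A"
  then obtain \<psi> where h: "homeomorphism (fst c) (cdom c) (snd c) \<psi>"
    using atlas unfolding smooth_atlas_def is_chart_def by blast
  have inj: "inj_on (snd c) (fst c)" using homeomorphism_apply1[OF h] by (rule inj_on_inverseI)
  have eq: "cinv c y = \<psi> y" if y: "y \<in> cdom c" for y
  proof -
    obtain x where x: "x \<in> fst c" "y = snd c x" using imageE[OF y] by metis
    then have "\<psi> y = x" using homeomorphism_apply1[OF h] by blast
    then show ?thesis unfolding cinv_def using x inv_into_f_f[OF inj x(1)] by simp
  qed
  have "cinv c ` cdom c = \<psi> ` cdom c" by (rule image_cong[OF refl]) (erule eq)
  then have "cinv c ` cdom c = fst c" using homeomorphism_image2[OF h] by (rule trans)
  moreover have "continuous_on (cdom c) (cinv c)"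
    using homeomorphism_cont2[OF h] by (rule continuous_on_eq) (simp add: eq)
  moreover have "\<forall>x\<in>fst c. cinv c (snd c x) = x" "\<forall>y\<in>cdom c. snd c (cinv c y) = y"
    using homeomorphism_apply1[OF h] homeomorphism_apply2[OF h] eq by simp_all
  ultimately show ?thesis using homeomorphism_cont1[OF h] unfolding homeomorphism_def by blast
qed

lemma chart_open: "c \<in> A \<Longrightarrow> open (fst c)" "c \<in> A \<Longrightarrow> open (cdom c)"
  using atlas unfolding smooth_atlas_def is_chart_def by blast+

lemma cinv_snd [simp]: "c \<in> A \<Longrightarrow> p \<in> fst c \<Longrightarrow> cinv c (snd c p) = p"
  using chart_homeo homeomorphism_apply1 by blast

lemma snd_cinv [simp]: "c \<in> A \<Longrightarrow> y \<in> cdom c \<Longrightarrow> snd c (cinv c y) = y"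
  using chart_homeo homeomorphism_apply2 by blast

lemma cinv_in: "c \<in> A \<Longrightarrow> y \<in> cdom c \<Longrightarrow> cinv c y \<in> fst c"
  by (metis chart_homeo homeomorphism_image2 imageI)

lemma continuous_cinv: "c \<in> A \<Longrightarrow> continuous_on (cdom c) (cinv c)"
  using chart_homeo homeomorphism_cont2 by blast

lemma continuous_snd: "c \<in> A \<Longrightarrow> continuous_on (fst c) (snd c)"
  using chart_homeo homeomorphism_cont1 by blast

lemma open_cinv_image:
  assumes "c \<in> A" "open S" "S \<subseteq> cdom c" shows "open (cinv c ` S)"
proof -
  have "cinv c ` S = fst c \<inter> snd c -` S"
    using assms by (auto simp: cinv_in) (metis assms(1) cinv_snd image_eqI)
  then show ?thesis
    using continuous_open_preimage[OF continuous_snd[OF assms(1)] chart_open(1)[OF assms(1)] assms(2)] by simp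
qed

lemma open_overlap: "c \<in> A \<Longrightarrow> d \<in> A \<Longrightarrow> open (snd c ` (fst c \<inter> fst d))"
  using atlas unfolding smooth_atlas_def smooth_on_def by blast

lemma smooth_transition: "c \<in> A \<Longrightarrow> d \<in> A \<Longrightarrow> smooth_on (snd c ` (fst c \<inter> fst d)) (transition c d)"
  using atlas unfolding smooth_atlas_def by blast

lemma transition_snd: "c \<in> A \<Longrightarrow> p \<in> fst c \<Longrightarrow> transition c d (snd c p) = snd d p"
  unfolding transition_def by (metis cinv_def cinv_snd comp_apply)

lemma transition_eq: "transition c d = snd d \<circ> cinv c"
  by (simp add: transition_def cinv_def)

lemma jac_transform:
  assumes "c \<in> A" "d \<in> A" "p \<in> fst c" "p \<in> fst d"
  shows "bform (G d p) (jac c d p v) (jac c d p w) = bform (G c p) v w"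
    "fut_causal_vec G T c p v \<Longrightarrow> fut_causal_vec G T d p (jac c d p v)"
    "past_causal_vec G T c p v \<Longrightarrow> past_causal_vec G T d p (jac c d p v)"
proof -
  have eq: "bform (G d p) (jac c d p v) (jac c d p w) = bform (G c p) v w" for v w
  proof -
    have "\<forall>c\<in>A. \<forall>d\<in>A. \<forall>p\<in>fst c \<inter> fst d. \<forall>v w.
        bform (G c p) v w = bform (G d p) (jac c d p v) (jac c d p w)"
      using metric unfolding lorentz_metric_def by blast
    then show ?thesis using assms by (metis IntI)
  qed
  show "bform (G d p) (jac c d p v) (jac c d p w) = bform (G c p) v w" by (rule eq)
  have "\<forall>c\<in>A. \<forall>d\<in>A. \<forall>p\<in>fst c \<inter> fst d. T d p = jac c d p (T c p)"
    using orient unfolding time_orientation_def by blast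
  then have T: "T d p = jac c d p (T c p)"
    using assms by (metis IntI)
  have *: "bform (G d p) (jac c d p v) (T d p) = bform (G c p) v (T c p)"
    unfolding T by (rule eq)
  \<comment> \<open>The transformed vector is nonzero because its product with \<open>T d p\<close>
    is.\<close>
  show "fut_causal_vec G T d p (jac c d p v)" if "fut_causal_vec G T c p v"
    using that bform_linear(6)[of "G d p" "T d p"] 
    unfolding fut_causal_vec_def * eq by (metis * order_less_irrefl)
  show "past_causal_vec G T d p (jac c d p v)" if "past_causal_vec G T c p v"
    using that bform_linear(6)[of "G d p" "T d p"] 
    unfolding past_causal_vec_def * eq by (metis * order_less_irrefl)
qed

lemma smooth_curve_deriv:
  assumes "smooth_curve_on A J \<beta>" "\<tau> \<in> J" "c \<in> A" "\<beta> \<tau> \<in> fst c"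
  shows "((snd c \<circ> \<beta>) has_vector_derivative vector_derivative (snd c \<circ> \<beta>) (at \<tau>)) (at \<tau>)"
proof -
  have "smooth_on (J \<inter> \<beta> -` fst c) (snd c \<circ> \<beta>)"
    using assms unfolding smooth_curve_on_def by blast
  then have "(snd c \<circ> \<beta>) differentiable (at \<tau>)"
    using smooth_on_has_derivative assms differentiableI by blast
  then show ?thesis by (simp add: vector_derivative_works)
qed

text \<open>Replaces the derivative within the closed interval by an ordinary derivative of the
  smooth extension, so that chain rules apply at the end points too.\<close>

lemma seg_tangent:
  assumes "smooth_curve_on A {s-e<..<t+e} \<beta>" "e > 0" "s < t" "\<forall>\<tau>\<in>{s..t}. \<beta> \<tau> = \<alpha> \<tau>"
    "\<tau> \<in> {s..t}" "c \<in> A" "\<alpha> \<tau> \<in> fst c"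
  shows "tangent c s t \<alpha> \<tau> = vector_derivative (snd c \<circ> \<beta>) (at \<tau>)"
proof -
  have "((snd c \<circ> \<beta>) has_vector_derivative vector_derivative (snd c \<circ> \<beta>) (at \<tau>)) (at \<tau>)"
    using assms by (intro smooth_curve_deriv[OF assms(1)]) auto
  then have "((snd c \<circ> \<beta>) has_vector_derivative vector_derivative (snd c \<circ> \<beta>) (at \<tau>)) (at \<tau> within {s..t})"
    by (rule has_vector_derivative_at_within)
  then have "((snd c \<circ> \<alpha>) has_vector_derivative vector_derivative (snd c \<circ> \<beta>) (at \<tau>)) (at \<tau> within {s..t})"
    by (rule has_vector_derivative_transform[rotated 2]) (use assms in auto)
  then show ?thesis
    unfolding tangent_def using assms
    by (intro vector_derivative_within_closed_interval) auto
qed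

lemma tangent_transform:
  assumes "smooth_seg A s t \<alpha>" "\<tau> \<in> {s..t}" "c \<in> A" "d \<in> A" "\<alpha> \<tau> \<in> fst c" "\<alpha> \<tau> \<in> fst d"
  shows "tangent d s t \<alpha> \<tau> = jac c d (\<alpha> \<tau>) (tangent c s t \<alpha> \<tau>)"
proof -
  obtain e \<beta> where b: "e > 0" "s < t" "smooth_curve_on A {s-e<..<t+e} \<beta>" "\<forall>\<tau>\<in>{s..t}. \<beta> \<tau> = \<alpha> \<tau>"
    using assms(1) unfolding smooth_seg_def by blast
  let ?J = "{s-e<..<t+e}"
  have bt: "\<beta> \<tau> = \<alpha> \<tau>" "\<tau> \<in> ?J" using b assms by auto
  have tc: "tangent c s t \<alpha> \<tau> = vector_derivative (snd c \<circ> \<beta>) (at \<tau>)"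
    and td: "tangent d s t \<alpha> \<tau> = vector_derivative (snd d \<circ> \<beta>) (at \<tau>)"
    by (rule seg_tangent[OF b(3,1,2,4)]; use assms in auto)+
  have "open (?J \<inter> \<beta> -` fst c)"
    using b(3) assms unfolding smooth_curve_on_def smooth_on_def by blast
  have v: "((snd c \<circ> \<beta>) has_vector_derivative vector_derivative (snd c \<circ> \<beta>) (at \<tau>)) (at \<tau>)"
    using smooth_curve_deriv[OF b(3)] bt assms by auto
  have "snd c (\<alpha> \<tau>) \<in> snd c ` (fst c \<inter> fst d)" using assms by auto
  then have "(transition c d has_derivative jac c d (\<alpha> \<tau>)) (at (snd c (\<alpha> \<tau>)))"
    unfolding jac_def by (rule smooth_on_has_derivative[OF smooth_transition[OF assms(3,4)]])
  then have tr: "(transition c d has_derivative jac c d (\<alpha> \<tau>)) (at ((snd c \<circ> \<beta>) \<tau>))"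
    using bt by simp
  have "((transition c d \<circ> (snd c \<circ> \<beta>)) has_vector_derivative 
      jac c d (\<alpha> \<tau>) (vector_derivative (snd c \<circ> \<beta>) (at \<tau>))) (at \<tau>)"
    using diff_chain_at[OF v[unfolded has_vector_derivative_def] tr]
    by (simp add: has_vector_derivative_def comp_def linear_scale[OF has_derivative_linear[OF tr]])
  then have "((snd d \<circ> \<beta>) has_vector_derivative 
      jac c d (\<alpha> \<tau>) (vector_derivative (snd c \<circ> \<beta>) (at \<tau>))) (at \<tau>)"
    by (rule has_vector_derivative_transform_within_open[OF _ \<open>open (?J \<inter> \<beta> -` fst c)\<close>])
      (use bt assms transition_snd in auto)
  then show ?thesis unfolding tc td by (simp add: vector_derivative_at)
qed

text \<open>Resolves the choice in \<open>lspeed\<close>: \<open>jac\<close> is an isometry, so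
  every chart gives the same value.\<close>

lemma lspeed_eq:
  assumes "smooth_seg A s t \<alpha>" "\<tau> \<in> {s..t}" "c \<in> A" "\<alpha> \<tau> \<in> fst c"
  shows "lspeed A G s t \<alpha> \<tau> = sqrt \<bar>bform (G c (\<alpha> \<tau>)) (tangent c s t \<alpha> \<tau>) (tangent c s t \<alpha> \<tau>)\<bar>"
  unfolding lspeed_def
proof (rule some_equality)
  show "\<exists>d\<in>A. \<alpha> \<tau> \<in> fst d \<and> sqrt \<bar>bform (G c (\<alpha> \<tau>)) (tangent c s t \<alpha> \<tau>) (tangent c s t \<alpha> \<tau>)\<bar> =
     sqrt \<bar>bform (G d (\<alpha> \<tau>)) (tangent d s t \<alpha> \<tau>) (tangent d s t \<alpha> \<tau>)\<bar>" using assms by auto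
next
  fix r assume "\<exists>d\<in>A. \<alpha> \<tau> \<in> fst d \<and> r = sqrt \<bar>bform (G d (\<alpha> \<tau>)) (tangent d s t \<alpha> \<tau>) (tangent d s t \<alpha> \<tau>)\<bar>"
  then obtain d where "d \<in> A" "\<alpha> \<tau> \<in> fst d" 
    and r: "r = sqrt \<bar>bform (G d (\<alpha> \<tau>)) (tangent d s t \<alpha> \<tau>) (tangent d s t \<alpha> \<tau>)\<bar>" by auto
  then show "r = sqrt \<bar>bform (G c (\<alpha> \<tau>)) (tangent c s t \<alpha> \<tau>) (tangent c s t \<alpha> \<tau>)\<bar>"
    unfolding r tangent_transform[OF assms(1-3) \<open>d \<in> A\<close> assms(4) \<open>\<alpha> \<tau> \<in> fst d\<close>]
    using jac_transform(1) assms by auto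
qed

lemma fut_causal_segI:
  assumes "smooth_seg A s t \<alpha>"
    and "\<And>\<tau>. \<tau> \<in> {s..t} \<Longrightarrow> \<exists>c\<in>A. \<alpha> \<tau> \<in> fst c \<and> fut_causal_vec G T c (\<alpha> \<tau>) (tangent c s t \<alpha> \<tau>)"
  shows "fut_causal_seg A G T s t \<alpha>"
  unfolding fut_causal_seg_def
proof (intro conjI ballI impI)
  fix \<tau> d assume "\<tau> \<in> {s..t}" "d \<in> A" "\<alpha> \<tau> \<in> fst d"
  moreover obtain c where "c \<in> A" "\<alpha> \<tau> \<in> fst c" "fut_causal_vec G T c (\<alpha> \<tau>) (tangent c s t \<alpha> \<tau>)"
    using assms(2)[OF \<open>\<tau> \<in> {s..t}\<close>] by blast
  ultimately show "fut_causal_vec G T d (\<alpha> \<tau>) (tangent d s t \<alpha> \<tau>)"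
    using tangent_transform[OF assms(1), of \<tau> c d] jac_transform(2) by auto
qed fact

lemma smooth_seg_reparam:
  assumes "smooth_seg A s t \<alpha>" "s' < t'" "m \<noteq> 0"
    and eq: "\<And>\<tau>. \<tau> \<in> {s'..t'} \<Longrightarrow> m * \<tau> + b \<in> {s..t} \<and> \<alpha>' \<tau> = \<alpha> (m * \<tau> + b)"
  shows "smooth_seg A s' t' \<alpha>'"
    and "\<And>c \<tau>. c \<in> A \<Longrightarrow> \<tau> \<in> {s'..t'} \<Longrightarrow> \<alpha>' \<tau> \<in> fst c \<Longrightarrow>
      tangent c s' t' \<alpha>' \<tau> = m *\<^sub>R tangent c s t \<alpha> (m * \<tau> + b)"
proof -
  obtain e \<beta> where b: "e > 0" "s < t" "smooth_curve_on A {s-e<..<t+e} \<beta>" "\<forall>\<tau>\<in>{s..t}. \<beta> \<tau> = \<alpha> \<tau>"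
    using assms(1) unfolding smooth_seg_def by blast
  let ?f = "\<lambda>\<tau>. m * \<tau> + b"
  let ?J = "{s-e<..<t+e}" let ?JJ = "?f -` ?J"
  define \<beta>' where "\<beta>' = (\<lambda>\<tau>. \<beta> (?f \<tau>))"
  have "open ?JJ" by (intro open_vimage continuous_intros)
  moreover have "{s'..t'} \<subseteq> ?JJ" using eq b(1) by fastforce
  ultimately obtain e' where e': "e' > 0" "{s'-e'<..<t'+e'} \<subseteq> ?JJ"
    using open_superset_Icc assms(2) by (metis less_imp_le)
  let ?J' = "{s'-e'<..<t'+e'}"
  have cont: "continuous_on ?J' \<beta>'"
    unfolding \<beta>'_def
  proof (rule continuous_on_compose2[of ?J \<beta>])
    show "continuous_on ?J \<beta>" using b(3) unfolding smooth_curve_on_def by blast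
    show "continuous_on ?J' ?f" by (intro continuous_intros)
    show "?f ` ?J' \<subseteq> ?J" using e'(2) by blast
  qed
  have sm: "smooth_on (?J' \<inter> \<beta>' -` fst c) (snd c \<circ> \<beta>')" if "c \<in> A" for c
  proof (rule smooth_on_subset)
    have "smooth_on (?J \<inter> \<beta> -` fst c) (snd c \<circ> \<beta>)" using b(3) that by (auto simp: smooth_curve_on_def)
    from smooth_on_compose_affine[OF this, of m b]
    show "smooth_on (?f -` (?J \<inter> \<beta> -` fst c)) (snd c \<circ> \<beta>')" by (simp add: \<beta>'_def comp_def)
    show "open (?J' \<inter> \<beta>' -` fst c)"
      by (rule continuous_open_preimage[OF cont _ chart_open(1)[OF that]]) simp
    show "?J' \<inter> \<beta>' -` fst c \<subseteq> ?f -` (?J \<inter> \<beta> -` fst c)" using e'(2) by (auto simp: \<beta>'_def)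
  qed
  have sc: "smooth_curve_on A ?J' \<beta>'" using cont sm by (auto simp: smooth_curve_on_def)
  have be: "\<forall>\<tau>\<in>{s'..t'}. \<beta>' \<tau> = \<alpha>' \<tau>" using eq b(4) by (simp add: \<beta>'_def)
  show "smooth_seg A s' t' \<alpha>'" unfolding smooth_seg_def using assms(2) e' sc be by blast
  fix c \<tau> assume c: "c \<in> A" "\<tau> \<in> {s'..t'}" "\<alpha>' \<tau> \<in> fst c"
  have t1: "tangent c s' t' \<alpha>' \<tau> = vector_derivative (snd c \<circ> \<beta>') (at \<tau>)"
    by (rule seg_tangent[OF sc e'(1) assms(2) be c(2,1,3)])
  have t2: "tangent c s t \<alpha> (?f \<tau>) = vector_derivative (snd c \<circ> \<beta>) (at (?f \<tau>))"
    using seg_tangent[OF b(3,1,2,4), of "?f \<tau>" c] eq[OF c(2)] c by auto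
  have "((snd c \<circ> \<beta>) has_vector_derivative vector_derivative (snd c \<circ> \<beta>) (at (?f \<tau>))) (at (?f \<tau>))"
    using eq[OF c(2)] c b by (intro smooth_curve_deriv[OF b(3)]) auto
  moreover have "(?f has_vector_derivative m) (at \<tau>)"
    unfolding has_real_derivative_iff_has_vector_derivative[symmetric]
    by (auto intro!: derivative_eq_intros)
  ultimately
  have "((snd c \<circ> \<beta>') has_vector_derivative m *\<^sub>R vector_derivative (snd c \<circ> \<beta>) (at (?f \<tau>))) (at \<tau>)"
    using vector_diff_chain_at[of ?f m \<tau>] by (simp add: \<beta>'_def comp_def)
  then show "tangent c s' t' \<alpha>' \<tau> = m *\<^sub>R tangent c s t \<alpha> (m * \<tau> + b)"
    unfolding t1 t2 by (rule vector_derivative_at)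
qed

lemma fut_causal_seg_reparam:
  assumes "fut_causal_seg A G T s t \<alpha>" "s' < t'" "m > 0"
    and eq: "\<And>\<tau>. \<tau> \<in> {s'..t'} \<Longrightarrow> m * \<tau> + b \<in> {s..t} \<and> \<alpha>' \<tau> = \<alpha> (m * \<tau> + b)"
  shows "fut_causal_seg A G T s' t' \<alpha>'"
    and "\<And>\<tau>. \<tau> \<in> {s'..t'} \<Longrightarrow> lspeed A G s' t' \<alpha>' \<tau> = m * lspeed A G s t \<alpha> (m * \<tau> + b)"
proof -
  have sm: "smooth_seg A s t \<alpha>" using assms(1) by (auto simp: fut_causal_seg_def)
  have m0: "m \<noteq> 0" using assms by auto
  note rp = smooth_seg_reparam[OF sm assms(2) m0 eq, simplified]
  show "fut_causal_seg A G T s' t' \<alpha>'"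
    unfolding fut_causal_seg_def
  proof (intro conjI ballI impI)
    fix \<tau> c assume *: "\<tau> \<in> {s'..t'}" "c \<in> A" "\<alpha>' \<tau> \<in> fst c"
    then have "fut_causal_vec G T c (\<alpha> (m * \<tau> + b)) (tangent c s t \<alpha> (m * \<tau> + b))"
      using assms(1) eq[OF *(1)] unfolding fut_causal_seg_def by auto
    then show "fut_causal_vec G T c (\<alpha>' \<tau>) (tangent c s' t' \<alpha>' \<tau>)"
      using rp(2)[of c \<tau>] * eq[OF *(1)] assms(3)
      by (auto simp: fut_causal_vec_def bform_linear mult_le_0_iff mult_less_0_iff)
  qed (rule rp)
  fix \<tau> assume *: "\<tau> \<in> {s'..t'}"
  obtain c where c: "c \<in> A" "\<alpha>' \<tau> \<in> fst c" using chart_exists by blast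
  show "lspeed A G s' t' \<alpha>' \<tau> = m * lspeed A G s t \<alpha> (m * \<tau> + b)"
    using lspeed_eq[OF rp(1) * c] lspeed_eq[OF sm _ c(1), of "m * \<tau> + b"] rp(2)[of c \<tau>] * c eq[OF *] assms(3)
    by (simp add: bform_linear abs_mult real_sqrt_mult)
qed

lemma fut_causal_seg_reverse:
  assumes "fut_causal_seg A G T s t \<alpha>"
  shows "past_causal_seg A G T (-t) (-s) (\<lambda>\<tau>. \<alpha> (-\<tau>))"
proof -
  have sm: "smooth_seg A s t \<alpha>" and st: "s < t" 
    using assms(1) by (auto simp: fut_causal_seg_def smooth_seg_def)
  note rp = smooth_seg_reparam[OF sm, where s'="-t" and t'="-s" and m="-1" and \<alpha>'="\<lambda>\<tau>. \<alpha> (-\<tau>)" and b=0, simplified, OF st]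
  show ?thesis
    unfolding past_causal_seg_def
  proof (intro conjI ballI impI)
    fix \<tau> c assume *: "\<tau> \<in> {-t..-s}" "c \<in> A" "\<alpha> (-\<tau>) \<in> fst c"
    then have "fut_causal_vec G T c (\<alpha> (- \<tau>)) (tangent c s t \<alpha> (- \<tau>))"
      using assms(1) unfolding fut_causal_seg_def by auto
    moreover have "tangent c (-t) (-s) (\<lambda>\<tau>. \<alpha> (-\<tau>)) \<tau> = - tangent c s t \<alpha> (- \<tau>)"
      using rp(2)[of c \<tau>] * by auto
    ultimately show "past_causal_vec G T c (\<alpha> (-\<tau>)) (tangent c (-t) (-s) (\<lambda>\<tau>. \<alpha> (-\<tau>)) \<tau>)"
      unfolding fut_causal_vec_def past_causal_vec_def by (simp add: bform_minus)
  qed (use rp in auto)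
qed

lemma past_causal_seg_reverse:
  assumes "past_causal_seg A G T s t \<alpha>"
  shows "fut_causal_seg A G T (-t) (-s) (\<lambda>\<tau>. \<alpha> (-\<tau>))"
proof -
  have sm: "smooth_seg A s t \<alpha>" and st: "s < t" 
    using assms(1) by (auto simp: past_causal_seg_def smooth_seg_def)
  note rp = smooth_seg_reparam[OF sm, where s'="-t" and t'="-s" and m="-1" and \<alpha>'="\<lambda>\<tau>. \<alpha> (-\<tau>)" and b=0, simplified, OF st]
  show ?thesis
    unfolding fut_causal_seg_def
  proof (intro conjI ballI impI)
    fix \<tau> c assume *: "\<tau> \<in> {-t..-s}" "c \<in> A" "\<alpha> (-\<tau>) \<in> fst c"
    then have "past_causal_vec G T c (\<alpha> (- \<tau>)) (tangent c s t \<alpha> (- \<tau>))"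
      using assms(1) unfolding past_causal_seg_def by auto
    moreover have "tangent c (-t) (-s) (\<lambda>\<tau>. \<alpha> (-\<tau>)) \<tau> = - tangent c s t \<alpha> (- \<tau>)"
      using rp(2)[of c \<tau>] * by auto
    ultimately show "fut_causal_vec G T c (\<alpha> (-\<tau>)) (tangent c (-t) (-s) (\<lambda>\<tau>. \<alpha> (-\<tau>)) \<tau>)"
      unfolding fut_causal_vec_def past_causal_vec_def by (simp add: bform_minus)
  qed (use rp in auto)
qed

end

section \<open>Speed and length of causal segments\<close>

lemma continuous_on_bform:
  assumes "continuous_on S M" "continuous_on S v" "continuous_on S w"
  shows "continuous_on S (\<lambda>x. bform (M x) (v x) (w x))"
proof -
  have 1: "continuous_on S (\<lambda>x. M x $ i $ j)" for i j
    using assms(1) by (intro continuous_intros)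
  have 2: "continuous_on S (\<lambda>x. v x $ i)" "continuous_on S (\<lambda>x. w x $ i)" for i
    using assms(2,3) by (auto intro: continuous_intros)
  have eq: "bform (M x) (v x) (w x) = (\<Sum>i\<in>UNIV. v x $ i * (\<Sum>j\<in>UNIV. M x $ i $ j * w x $ j))" for x
    by (simp add: bform_def inner_vec_def matrix_vector_mult_def)
  show ?thesis unfolding eq by (intro continuous_on_sum continuous_on_mult 1 2)
qed

lemma smooth_on_vector_derivative:
  assumes "smooth_on I u" "t \<in> I"
  shows "(u has_vector_derivative vector_derivative u (at t)) (at t)"
  using smooth_on_has_derivative[OF assms] differentiableI vector_derivative_works by blast

lemma continuous_on_vector_derivative:
  assumes "smooth_on I (u :: real \<Rightarrow> 'b::real_normed_vector)"
  shows "continuous_on I (\<lambda>t. vector_derivative u (at t))"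
proof -
  have "continuous_on I (\<lambda>t. frechet_derivative u (at t) 1)"
    by (rule smooth_on_continuous_on[OF smooth_on_frechet[OF assms]])
  moreover have "frechet_derivative u (at t) 1 = vector_derivative u (at t)" if "t \<in> I" for t
    using has_derivative_imp_frechet_eq[OF smooth_on_vector_derivative[OF assms that, unfolded has_vector_derivative_def], of 1]
    by simp
  ultimately show ?thesis by (metis (no_types, lifting) continuous_on_cong)
qed

context spacetime_ctx
begin

lemma continuous_G: "c \<in> A \<Longrightarrow> continuous_on (cdom c) (\<lambda>y. G c (cinv c y))"
  using metric smooth_on_continuous_on unfolding lorentz_metric_def cinv_def by blast

text \<open>Although \<open>lspeed\<close> may use a different chart at each parameter, continuity
  is local, and near \<open>\<tau>0\<close> a single chart computes it by
  \<open>lspeed_eq\<close>.\<close>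

lemma lspeed_continuous:
  assumes "smooth_seg A s t \<alpha>"
  shows "continuous_on {s..t} (lspeed A G s t \<alpha>)"
  unfolding continuous_on_eq_continuous_within
proof
  fix \<tau>0 assume t0: "\<tau>0 \<in> {s..t}"
  obtain e \<beta> where b: "e > 0" "s < t" "smooth_curve_on A {s-e<..<t+e} \<beta>" "\<forall>\<tau>\<in>{s..t}. \<beta> \<tau> = \<alpha> \<tau>"
    using assms(1) unfolding smooth_seg_def by blast
  obtain c where c: "c \<in> A" "\<alpha> \<tau>0 \<in> fst c" using chart_exists by blast
  let ?O = "{s-e<..<t+e} \<inter> \<beta> -` fst c"
  let ?v = "\<lambda>\<tau>. vector_derivative (snd c \<circ> \<beta>) (at \<tau>)"
  let ?f = "\<lambda>\<tau>. sqrt \<bar>bform (G c (\<beta> \<tau>)) (?v \<tau>) (?v \<tau>)\<bar>"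
  have sm: "smooth_on ?O (snd c \<circ> \<beta>)" using b(3) c unfolding smooth_curve_on_def by blast
  have "continuous_on ?O (\<lambda>\<tau>. G c (cinv c ((snd c \<circ> \<beta>) \<tau>)))"
    by (rule continuous_on_compose2[OF continuous_G[OF c(1)] smooth_on_continuous_on[OF sm]]) auto
  then have "continuous_on ?O (\<lambda>\<tau>. G c (\<beta> \<tau>))"
    by (rule continuous_on_eq) (simp add: c)
  then have cf: "continuous_on ?O ?f"
    by (intro continuous_on_bform continuous_intros continuous_on_vector_derivative[OF sm])
  have op: "open ?O" using sm by (rule smooth_on_open)
  have in0: "\<tau>0 \<in> ?O" using t0 b c by auto
  have "isCont ?f \<tau>0" using cf op in0 continuous_on_eq_continuous_at by blast
  then have cw: "continuous (at \<tau>0 within {s..t}) ?f" by (rule continuous_at_imp_continuous_at_within)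
  obtain d where d: "d > 0" "\<forall>\<tau>. dist \<tau> \<tau>0 < d \<longrightarrow> \<tau> \<in> ?O" 
    using op in0 unfolding open_dist by blast
  show "continuous (at \<tau>0 within {s..t}) (lspeed A G s t \<alpha>)"
  proof (rule continuous_transform_within[OF cw d(1) t0])
    fix \<tau> assume \<tau>: "\<tau> \<in> {s..t}" "dist \<tau> \<tau>0 < d"
    then have "\<alpha> \<tau> \<in> fst c" using d b by auto
    then show "?f \<tau> = lspeed A G s t \<alpha> \<tau>"
      using lspeed_eq[OF assms \<tau>(1) c(1)] seg_tangent[OF b(3,1,2,4) \<tau>(1) c(1)] b(4) \<tau>(1) by auto
  qed
qed

lemma seglen_nonneg: 
  assumes "smooth_seg A s t \<alpha>" shows "seglen s t \<alpha> \<ge> 0"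
  unfolding seglen_def
proof (rule integral_nonneg)
  show "lspeed A G s t \<alpha> integrable_on {s..t}"
    using lspeed_continuous[OF assms] by (rule integrable_continuous_interval)
  fix \<tau> assume "\<tau> \<in> {s..t}"
  moreover obtain c where "c \<in> A" "\<alpha> \<tau> \<in> fst c" using chart_exists by blast
  ultimately show "0 \<le> lspeed A G s t \<alpha> \<tau>" using lspeed_eq[OF assms] by auto
qed

lemma seglen_reparam:
  assumes "fut_causal_seg A G T s t \<alpha>" "s' < t'" "m > 0" "m * s' + b = s" "m * t' + b = t"
    and eq: "\<And>\<tau>. \<tau> \<in> {s'..t'} \<Longrightarrow> \<alpha>' \<tau> = \<alpha> (m * \<tau> + b)"
  shows "fut_causal_seg A G T s' t' \<alpha>'" "seglen s' t' \<alpha>' = seglen s t \<alpha>"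
proof -
  have *: "m * \<tau> + b \<in> {s..t} \<and> \<alpha>' \<tau> = \<alpha> (m * \<tau> + b)" if "\<tau> \<in> {s'..t'}" for \<tau>
    using that assms eq by auto
  note rp = fut_causal_seg_reparam[OF assms(1-3) *]
  show "fut_causal_seg A G T s' t' \<alpha>'" by (rule rp)
  have sm: "smooth_seg A s t \<alpha>" using assms(1) by (auto simp: fut_causal_seg_def)
  have "(lspeed A G s t \<alpha> has_integral seglen s t \<alpha>) (cbox s t)"
    unfolding seglen_def cbox_interval
    by (intro integrable_integral integrable_continuous_interval lspeed_continuous sm)
  from has_integral_affinity[OF this, of m b]
  have "((\<lambda>x. lspeed A G s t \<alpha> (m * x + b)) has_integral (1/m) * seglen s t \<alpha>) 
      ((\<lambda>x. (1 / m) *\<^sub>R x + -((1 / m) *\<^sub>R b)) ` {s..t})"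
    using assms(3) by (simp add: cbox_interval)
  moreover have "(\<lambda>x. (1 / m) *\<^sub>R x + -((1 / m) *\<^sub>R b)) ` {s..t} = {s'..t'}"
  proof -
    have "s' = (1/m) * s - b / m" "t' = (1/m)*t - b/m" using assms(3-5) by (auto simp: field_simps)
    moreover have "s \<le> t" using sm by (simp add: smooth_seg_def)
    ultimately show ?thesis using assms(3) image_affinity_atLeastAtMost_diff[of "1/m" "b/m" s t]
      by (simp add: field_simps)
  qed
  ultimately have "((\<lambda>x. m * lspeed A G s t \<alpha> (m * x + b)) has_integral m * ((1/m) * seglen s t \<alpha>)) {s'..t'}"
    using has_integral_mult_right by metis
  then have "(lspeed A G s' t' \<alpha>' has_integral seglen s t \<alpha>) {s'..t'}"
    using assms(3) rp(2) by (subst has_integral_cong) auto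
  then show "seglen s' t' \<alpha>' = seglen s t \<alpha>" unfolding seglen_def by (rule integral_unique)
qed

text \<open>\<open>tangent\<close> and \<open>lspeed\<close> refer to the end points of the segment,
  so a restriction has to be compared with the original; it is the reparametrization with factor
  1.\<close>

lemma seg_restrict:
  assumes "fut_causal_seg A G T s t \<alpha>" "s \<le> s'" "s' < t'" "t' \<le> t"
  shows "fut_causal_seg A G T s' t' \<alpha>" "seglen s' t' \<alpha> = integral {s'..t'} (lspeed A G s t \<alpha>)"
proof -
  have *: "1 * \<tau> + 0 \<in> {s..t} \<and> \<alpha> \<tau> = \<alpha> (1 * \<tau> + 0)" if "\<tau> \<in> {s'..t'}" for \<tau>
    using that assms by auto
  note rp = fut_causal_seg_reparam[OF assms(1,3) zero_less_one *]
  show "fut_causal_seg A G T s' t' \<alpha>" by (rule rp)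
  show "seglen s' t' \<alpha> = integral {s'..t'} (lspeed A G s t \<alpha>)"
    unfolding seglen_def by (rule integral_cong) (use rp(2) in auto)
qed

lemma seglen_split:
  assumes "fut_causal_seg A G T s t \<alpha>" "s < r" "r < t"
  shows "seglen s t \<alpha> = seglen s r \<alpha> + seglen r t \<alpha>"
proof -
  have sm: "smooth_seg A s t \<alpha>" using assms(1) by (auto simp: fut_causal_seg_def)
  have "lspeed A G s t \<alpha> integrable_on {s..t}"
    by (intro integrable_continuous_interval lspeed_continuous sm)
  then have "integral {s..r} (lspeed A G s t \<alpha>) + integral {r..t} (lspeed A G s t \<alpha>) = seglen s t \<alpha>"
    unfolding seglen_def using assms by (intro Henstock_Kurzweil_Integration.integral_combine) auto
  moreover have "seglen s r \<alpha> = integral {s..r} (lspeed A G s t \<alpha>)"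
    "seglen r t \<alpha> = integral {r..t} (lspeed A G s t \<alpha>)"
    using assms by (auto intro: seg_restrict(2))
  ultimately show ?thesis by simp
qed

section \<open>Causal segments in coordinates\<close>

definition cseg :: "('a,'n) chart \<Rightarrow> real \<Rightarrow> real \<Rightarrow> (real \<Rightarrow> real^'n) \<Rightarrow> bool" where
  "cseg c s t u \<longleftrightarrow> c \<in> A \<and> s < t \<and> (\<exists>e>0. smooth_on {s-e<..<t+e} u) \<and>
    (\<forall>\<tau>\<in>{s..t}. u \<tau> \<in> cdom c \<and> fcv c (u \<tau>) (vector_derivative u (at \<tau>)))"

lemma cseg_seg:
  assumes "cseg c s t u"
  shows "fut_causal_seg A G T s t (cinv c \<circ> u)"
    "\<And>\<tau>. \<tau> \<in> {s..t} \<Longrightarrow> lspeed A G s t (cinv c \<circ> u) \<tau> = gspeed c (u \<tau>) (vector_derivative u (at \<tau>))"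
proof -
  have c: "c \<in> A" "s < t" and fc: "\<And>\<tau>. \<tau> \<in> {s..t} \<Longrightarrow> u \<tau> \<in> cdom c \<and> fcv c (u \<tau>) (vector_derivative u (at \<tau>))"
    using assms unfolding cseg_def by auto
  obtain e where e: "e > 0" "smooth_on {s-e<..<t+e} u" using assms unfolding cseg_def by blast
  let ?J = "{s-e<..<t+e}"
  have contu: "continuous_on ?J u" by (rule smooth_on_continuous_on[OF e(2)])
  have opu: "open (?J \<inter> u -` cdom c)"
    by (rule continuous_open_preimage[OF contu _ chart_open(2)[OF c(1)]]) simp
  moreover have "{s..t} \<subseteq> ?J \<inter> u -` cdom c" using e(1) fc by auto
  \<comment> \<open>The interval of smoothness is shrunk until \<open>u\<close> stays in the chart
    image, so that composing with \<open>cinv c\<close> gives a smooth curve beyond both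
    ends.\<close>
  ultimately obtain e' where e': "e' > 0" "{s-e'<..<t+e'} \<subseteq> ?J \<inter> u -` cdom c"
    using open_superset_Icc c(2) by (metis less_imp_le)
  let ?K = "{s-e'<..<t+e'}"
  define \<beta> where "\<beta> = cinv c \<circ> u"
  have smu: "smooth_on ?K u" by (rule smooth_on_subset[OF e(2)]) (use e'(2) in auto)
  have contb: "continuous_on ?K \<beta>"
    unfolding \<beta>_def
    by (intro continuous_on_compose smooth_on_continuous_on[OF smu] 
        continuous_on_subset[OF continuous_cinv[OF c(1)]]) (use e'(2) in blast)+
  have "smooth_on (?K \<inter> \<beta> -` fst d) (snd d \<circ> \<beta>)" if "d \<in> A" for d
  proof -
    have op: "open (?K \<inter> \<beta> -` fst d)"
      by (rule continuous_open_preimage[OF contb _ chart_open(1)[OF that]]) simp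
    have "smooth_on (?K \<inter> \<beta> -` fst d) (\<lambda>\<tau>. transition c d (u \<tau>))"
    proof (rule smooth_on_compose[OF smooth_transition[OF c(1) that]])
      show "smooth_on (?K \<inter> \<beta> -` fst d) u" by (rule smooth_on_subset[OF smu op]) auto
      show "u ` (?K \<inter> \<beta> -` fst d) \<subseteq> snd c ` (fst c \<inter> fst d)"
      proof (clarify)
        fix \<tau> assume \<tau>: "\<tau> \<in> ?K" "\<beta> \<tau> \<in> fst d"
        then have "u \<tau> \<in> cdom c" using e'(2) by blast
        then have "u \<tau> = snd c (cinv c (u \<tau>))" "cinv c (u \<tau>) \<in> fst c" using c cinv_in by auto
        then show "u \<tau> \<in> snd c ` (fst c \<inter> fst d)" using \<tau>(2) unfolding \<beta>_def comp_apply by blast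
      qed
    qed
    then show ?thesis by (simp add: transition_eq \<beta>_def comp_def)
  qed
  then have sc: "smooth_curve_on A ?K \<beta>" using contb unfolding smooth_curve_on_def by blast
  have sm: "smooth_seg A s t (cinv c \<circ> u)" 
    unfolding smooth_seg_def \<beta>_def[symmetric] using c(2) e'(1) sc by blast
  have tan: "tangent c s t (cinv c \<circ> u) \<tau> = vector_derivative u (at \<tau>)" "(cinv c \<circ> u) \<tau> \<in> fst c"
    if \<tau>: "\<tau> \<in> {s..t}" for \<tau>
  proof -
    show 1: "(cinv c \<circ> u) \<tau> \<in> fst c" using fc[OF \<tau>] cinv_in c by auto
    have "(u has_vector_derivative vector_derivative u (at \<tau>)) (at \<tau>)"
      using smooth_on_vector_derivative[OF smu] \<tau> e'(1) by auto
    then have "((snd c \<circ> \<beta>) has_vector_derivative vector_derivative u (at \<tau>)) (at \<tau>)"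
      by (rule has_vector_derivative_transform_within_open[of _ _ _ ?K]) 
        (use \<tau> e' c in \<open>auto simp: \<beta>_def\<close>)
    then show "tangent c s t (cinv c \<circ> u) \<tau> = vector_derivative u (at \<tau>)"
      using seg_tangent[OF sc e'(1) c(2) _ \<tau> c(1)] 1 by (auto simp: \<beta>_def vector_derivative_at)
  qed
  show "fut_causal_seg A G T s t (cinv c \<circ> u)"
  proof (rule fut_causal_segI[OF sm])
    fix \<tau> assume \<tau>: "\<tau> \<in> {s..t}"
    have "fut_causal_vec G T c ((cinv c \<circ> u) \<tau>) (tangent c s t (cinv c \<circ> u) \<tau>)"
      using fc[OF \<tau>] unfolding tan(1)[OF \<tau>] fcv_def comp_apply by blast
    then show "\<exists>d\<in>A. (cinv c \<circ> u) \<tau> \<in> fst d \<and> fut_causal_vec G T d ((cinv c \<circ> u) \<tau>) (tangent d s t (cinv c \<circ> u) \<tau>)"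
      using tan(2)[OF \<tau>] c(1) by blast
  qed
  show "lspeed A G s t (cinv c \<circ> u) \<tau> = gspeed c (u \<tau>) (vector_derivative u (at \<tau>))" if "\<tau> \<in> {s..t}" for \<tau>
    using lspeed_eq[OF sm that c(1)] tan[OF that] by (simp add: gspeed_def gform_def)
qed

lemma cseg_has_length:
  assumes "cseg c s t u"
  shows "((\<lambda>\<tau>. gspeed c (u \<tau>) (vector_derivative u (at \<tau>))) has_integral seglen s t (cinv c \<circ> u)) {s..t}"
    "((\<lambda>\<tau>. vector_derivative u (at \<tau>)) has_integral (u t - u s)) {s..t}"
proof -
  have "smooth_seg A s t (cinv c \<circ> u)" using cseg_seg(1)[OF assms] by (auto simp: fut_causal_seg_def)
  then have "(lspeed A G s t (cinv c \<circ> u) has_integral seglen s t (cinv c \<circ> u)) {s..t}"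
    unfolding seglen_def by (intro integrable_integral integrable_continuous_interval lspeed_continuous)
  then show "((\<lambda>\<tau>. gspeed c (u \<tau>) (vector_derivative u (at \<tau>))) has_integral seglen s t (cinv c \<circ> u)) {s..t}"
    by (rule has_integral_eq[rotated]) (use cseg_seg(2)[OF assms] in auto)
  obtain e where e: "e > 0" "smooth_on {s-e<..<t+e} u" "s < t" using assms unfolding cseg_def by blast
  show "((\<lambda>\<tau>. vector_derivative u (at \<tau>)) has_integral (u t - u s)) {s..t}"
  proof (rule fundamental_theorem_of_calculus)
    show "s \<le> t" using e(3) by simp
    fix x assume "x \<in> {s..t}"
    then have "x \<in> {s-e<..<t+e}" using e(1) by auto
    then show "(u has_vector_derivative vector_derivative u (at x)) (at x within {s..t})"
      by (rule has_vector_derivative_at_within[OF smooth_on_vector_derivative[OF e(2)]])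
  qed
qed

text \<open>\<open>u\<close> is the coordinate form of the smooth extension, so it agrees with
  \<alpha> only on the segment; that suffices for equal length.\<close>

lemma seg_cseg:
  assumes "fut_causal_seg A G T s t \<alpha>" "\<alpha> ` {s..t} \<subseteq> fst c" "c \<in> A"
  obtains u where "cseg c s t u" "\<And>\<tau>. \<tau> \<in> {s..t} \<Longrightarrow> u \<tau> = snd c (\<alpha> \<tau>)"
    "seglen s t \<alpha> = seglen s t (cinv c \<circ> u)"
proof -
  have sm: "smooth_seg A s t \<alpha>" using assms(1) by (auto simp: fut_causal_seg_def)
  obtain e \<beta> where b: "e > 0" "s < t" "smooth_curve_on A {s-e<..<t+e} \<beta>" "\<forall>\<tau>\<in>{s..t}. \<beta> \<tau> = \<alpha> \<tau>"
    using sm unfolding smooth_seg_def by blast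
  let ?O = "{s-e<..<t+e} \<inter> \<beta> -` fst c"
  let ?u = "snd c \<circ> \<beta>"
  have smo: "smooth_on ?O ?u" using b(3) assms(3) unfolding smooth_curve_on_def by blast
  have "{s..t} \<subseteq> ?O" using b assms(2) by auto
  then obtain e' where e': "e' > 0" "{s-e'<..<t+e'} \<subseteq> ?O"
    using open_superset_Icc[OF smooth_on_open[OF smo]] b(2) by (metis less_imp_le)
  have "smooth_on {s-e'<..<t+e'} ?u" by (rule smooth_on_subset[OF smo _ e'(2)]) simp
  moreover have "?u \<tau> \<in> cdom c \<and> fcv c (?u \<tau>) (vector_derivative ?u (at \<tau>))" if \<tau>: "\<tau> \<in> {s..t}" for \<tau>
  proof -
    have a: "\<alpha> \<tau> \<in> fst c" "\<beta> \<tau> = \<alpha> \<tau>" using assms(2) b(4) \<tau> by auto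
    then have "fut_causal_vec G T c (\<alpha> \<tau>) (tangent c s t \<alpha> \<tau>)"
      using assms \<tau> unfolding fut_causal_seg_def by blast
    then show ?thesis
      using a seg_tangent[OF b(3,1,2,4) \<tau> assms(3) a(1)] assms(3) by (auto simp: fcv_def)
  qed
  ultimately have cs: "cseg c s t ?u" unfolding cseg_def using assms(3) b(2) e'(1) by blast
  have eq: "(cinv c \<circ> ?u) \<tau> = \<alpha> (1 * \<tau> + 0)" if "\<tau> \<in> {s..t}" for \<tau>
    using that assms(2,3) b(4) by (auto simp: image_subset_iff)
  have "seglen s t (cinv c \<circ> ?u) = seglen s t \<alpha>"
    by (rule seglen_reparam(2)[OF assms(1) b(2) zero_less_one _ _ eq]) auto
  then show ?thesis using that[of ?u] cs b(4) by auto
qed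

section \<open>Chains of causal segments\<close>

text \<open>Reachability inside \<open>S\<close> by finitely many future causal segments, together
  with the total length. Forgetting the parametrization makes cutting, joining and deforming free of
  partitions; the index \<open>L\<close> keeps all the information that \<tau> needs.\<close>

inductive carc :: "'a set \<Rightarrow> 'a \<Rightarrow> 'a \<Rightarrow> real \<Rightarrow> bool" for S where
  carc_refl: "x \<in> S \<Longrightarrow> carc S x x 0"
| carc_step: "carc S x y L \<Longrightarrow> fut_causal_seg A G T s t \<alpha> \<Longrightarrow> \<alpha> s = y \<Longrightarrow> \<alpha> ` {s..t} \<subseteq> S \<Longrightarrow>
    carc S x (\<alpha> t) (L + seglen s t \<alpha>)"

lemma seg_facts:
  assumes "fut_causal_seg A G T s t \<alpha>"
  shows "s < t" "smooth_seg A s t \<alpha>" "continuous_on {s..t} \<alpha>" "seglen s t \<alpha> \<ge> 0"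
proof -
  show sm: "smooth_seg A s t \<alpha>" and "s < t" using assms by (auto simp: fut_causal_seg_def smooth_seg_def)
  then show "seglen s t \<alpha> \<ge> 0" by (simp add: seglen_nonneg)
  obtain e \<beta> where b: "e > 0" "smooth_curve_on A {s-e<..<t+e} \<beta>" "\<forall>\<tau>\<in>{s..t}. \<beta> \<tau> = \<alpha> \<tau>"
    using sm unfolding smooth_seg_def by blast
  have "continuous_on {s..t} \<beta>"
    using b(1,2) unfolding smooth_curve_on_def by (auto intro: continuous_on_subset)
  then show "continuous_on {s..t} \<alpha>" by (rule continuous_on_eq) (use b(3) in auto)
qed

lemma carc_props: "carc S x y L \<Longrightarrow> x \<in> S \<and> y \<in> S \<and> L \<ge> 0"
proof (induction rule: carc.induct)
  case (carc_step x y L s t \<alpha>)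
  then show ?case using seg_facts[OF carc_step.hyps(2)] by auto
qed auto

lemma carc_mono: 
  assumes "carc S x y L" "S \<subseteq> S'" shows "carc S' x y L"
  using assms
proof (induction rule: carc.induct)
  case (carc_refl x) then show ?case by (auto intro: carc.carc_refl)
next
  case (carc_step x y L s t \<alpha>) then show ?case by (intro carc.carc_step) auto
qed

lemma carc_trans: 
  assumes "carc S y z M" "carc S x y L" shows "carc S x z (L + M)"
  using assms
proof (induction rule: carc.induct)
  case (carc_refl x) then show ?case by simp
next
  case (carc_step y y' M s t \<alpha>)
  then have "carc S x (\<alpha> t) ((L + M) + seglen s t \<alpha>)" by (intro carc.carc_step) auto
  then show ?case by (simp add: add.assoc)
qed

lemma carc_seg: 
  assumes "fut_causal_seg A G T s t \<alpha>" "\<alpha> ` {s..t} \<subseteq> S" shows "carc S (\<alpha> s) (\<alpha> t) (seglen s t \<alpha>)"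
proof -
  have "\<alpha> s \<in> S" using seg_facts(1)[OF assms(1)] assms(2) by auto
  from carc_step[OF carc_refl[OF this] assms(1) refl assms(2)] show ?thesis by simp
qed

text \<open>Segments have nondegenerate parameter intervals, so a cut at an end point must produce
  the trivial chain on one side.\<close>

lemma seg_carc_split:
  assumes "fut_causal_seg A G T s t \<alpha>" "r \<in> {s..t}" "\<alpha> ` {s..r} \<subseteq> S1" "\<alpha> ` {r..t} \<subseteq> S2"
  obtains L1 L2 where "carc S1 (\<alpha> s) (\<alpha> r) L1" "carc S2 (\<alpha> r) (\<alpha> t) L2" "L1 + L2 = seglen s t \<alpha>"
proof -
  have st: "s < t" using seg_facts[OF assms(1)] by simp
  consider "r = s" | "r = t" | "s < r" "r < t" using assms(2) by force
  then show ?thesis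
  proof cases
    case 1 
    then have "carc S1 (\<alpha> s) (\<alpha> r) 0" "\<alpha> ` {s..t} \<subseteq> S2" using assms(3,4) by (auto intro: carc_refl)
    moreover from carc_seg[OF assms(1) this(2)] have "carc S2 (\<alpha> r) (\<alpha> t) (seglen s t \<alpha>)" using 1 by simp
    ultimately show ?thesis by (intro that[of 0 "seglen s t \<alpha>"]) auto
  next
    case 2 
    then have "carc S2 (\<alpha> r) (\<alpha> t) 0" "\<alpha> ` {s..t} \<subseteq> S1" using assms(3,4) by (auto intro: carc_refl)
    moreover from carc_seg[OF assms(1) this(2)] have "carc S1 (\<alpha> s) (\<alpha> r) (seglen s t \<alpha>)" using 2 by simp
    ultimately show ?thesis by (intro that[of "seglen s t \<alpha>" 0]) auto
  next
    case 3
    have "fut_causal_seg A G T s r \<alpha>" "fut_causal_seg A G T r t \<alpha>"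
      using seg_restrict(1)[OF assms(1)] 3 by auto
    then show ?thesis using that carc_seg assms(3,4) seglen_split[OF assms(1) 3] by metis
  qed
qed

lemma carc_split_level:
  assumes "carc S x y L" "continuous_on S (f :: 'a \<Rightarrow> real)" "f x \<le> v" "v \<le> f y"
  shows "\<exists>w L1 L2. f w = v \<and> carc S x w L1 \<and> carc S w y L2 \<and> L = L1 + L2"
  using assms
proof (induction arbitrary: v rule: carc.induct)
  case (carc_refl x) 
  then have "f x = v" by simp
  then show ?case using carc.carc_refl[OF carc_refl.hyps] by (metis add_0)
next
  case (carc_step x y L s t \<alpha>)
  show ?case
  proof (cases "v \<le> f y")
    case True
    then obtain w L1 L2 where w: "f w = v" "carc S x w L1" "carc S w y L2" "L = L1 + L2" 
      using carc_step by blast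
    have "carc S w (\<alpha> t) (L2 + seglen s t \<alpha>)" by (rule carc.carc_step[OF w(3) carc_step.hyps(2-4)])
    then show ?thesis using w by (metis add.assoc)
  next
    case False
    have sf: "s < t" "continuous_on {s..t} \<alpha>" using seg_facts[OF carc_step.hyps(2)] by auto
    have "continuous_on {s..t} (\<lambda>r. f (\<alpha> r))"
      using continuous_on_compose2[OF carc_step.prems(1) sf(2) carc_step.hyps(4)] .
    then obtain r where r: "s \<le> r" "r \<le> t" "f (\<alpha> r) = v"
      using IVT'[of "\<lambda>r. f (\<alpha> r)" s v t] False carc_step.prems carc_step.hyps(3) sf(1) by auto
    have i1: "r \<in> {s..t}" and i2: "\<alpha> ` {s..r} \<subseteq> S" and i3: "\<alpha> ` {r..t} \<subseteq> S" 
      using r carc_step.hyps(4) by auto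
    obtain L1 L2 where l: "carc S (\<alpha> s) (\<alpha> r) L1" "carc S (\<alpha> r) (\<alpha> t) L2" "L1 + L2 = seglen s t \<alpha>"
      by (rule seg_carc_split[OF carc_step.hyps(2) i1 i2 i3])
    have "carc S x (\<alpha> r) (L + L1)" using carc_trans[OF l(1)] carc_step.hyps(1,3) by simp
    then show ?thesis using r(3) l by (metis add.assoc)
  qed
qed

lemma seg_last_exit:
  fixes s t :: real
  assumes "continuous_on {s..t} \<alpha>" "open W" "\<alpha> t \<in> W" "\<not> \<alpha> ` {s..t} \<subseteq> W"
  obtains r where "s \<le> r" "r < t" "\<alpha> r \<notin> W" "\<alpha> ` {r..t} \<subseteq> closure W" 
proof -
  let ?Z = "{s..t} \<inter> \<alpha> -` (- W)"
  have "closed ?Z" using continuous_closed_preimage[OF assms(1) _ closed_Compl[OF assms(2)]] by simp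
  then have "compact ?Z" using compact_Int_closed[OF compact_Icc] by (metis Int_assoc inf.idem)
  moreover have "?Z \<noteq> {}" using assms(4) by auto
  ultimately have "\<exists>r\<in>?Z. \<forall>q\<in>?Z. q \<le> r" by (rule compact_attains_sup)
  \<comment> \<open>\<open>r\<close> is the last parameter at which the curve is outside
    \<open>W\<close>; by continuity \<open>\<alpha> r\<close> still lies in the closure of the part
    that follows.\<close>
  then obtain r where r: "r \<in> ?Z" "\<And>q. q \<in> ?Z \<Longrightarrow> q \<le> r" by blast
  have rt: "r < t" using r assms(3) by (cases "r = t") auto
  have W: "\<alpha> q \<in> W" if "q \<in> {r<..t}" for q
  proof (rule ccontr)
    assume "\<alpha> q \<notin> W"
    then have "q \<in> ?Z" using that r(1) by auto
    then show False using r(2) that by fastforce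
  qed
  have "\<alpha> ` closure {r<..t} \<subseteq> closure W"
  proof (rule image_closure_subset)
    show "continuous_on (closure {r<..t}) \<alpha>" using rt r(1) by (auto intro: continuous_on_subset[OF assms(1)])
    show "\<alpha> ` {r<..t} \<subseteq> closure W" using W closure_subset by fast
  qed simp
  moreover have "closure {r<..t} = {r..t}" using rt by simp
  ultimately show ?thesis using that[of r] r rt by auto
qed

lemma seg_first_exit:
  fixes s t :: real
  assumes "continuous_on {s..t} \<alpha>" "open W" "\<alpha> s \<in> W" "\<not> \<alpha> ` {s..t} \<subseteq> W"
  obtains r where "s < r" "r \<le> t" "\<alpha> r \<notin> W" "\<alpha> ` {s..r} \<subseteq> closure W" 
proof -
  have im: "uminus ` {-t..-s} = {s..t}" by simp
  have c: "continuous_on {-t..-s} (\<lambda>\<tau>. \<alpha> (-\<tau>))"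
    by (rule continuous_on_compose2[OF assms(1)]) (auto intro: continuous_intros)
  have n: "\<not> (\<lambda>\<tau>. \<alpha> (-\<tau>)) ` {-t..-s} \<subseteq> W" using assms(4) im by (metis image_image)
  have s: "(\<lambda>\<tau>. \<alpha> (-\<tau>)) (-s) \<in> W" using assms(3) by simp
  obtain r where r: "-t \<le> r" "r < -s" "\<alpha> (-r) \<notin> W" "(\<lambda>\<tau>. \<alpha> (-\<tau>)) ` {r..-s} \<subseteq> closure W"
    by (rule seg_last_exit[OF c assms(2) s n])
  have "uminus ` {r..-s} = {s..-r}" by simp
  then have "\<alpha> ` {s..-r} \<subseteq> closure W" using r(4) by (metis image_image)
  then show ?thesis using that[of "-r"] r by auto
qed

text \<open>Isolates the final arc of a chain that ends in \<open>W\<close>: chart computations are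
  possible on this arc, and its starting point lies on the frontier of \<open>W\<close>.\<close>

lemma carc_last_exit:
  assumes "carc S x y L" "open W" "y \<in> W"
  shows "carc (S \<inter> W) x y L \<or> (\<exists>z L1 L2. carc S x z L1 \<and> carc (S \<inter> closure W) z y L2 \<and> 
    z \<in> closure W - W \<and> L = L1 + L2)"
  using assms
proof (induction rule: carc.induct)
  case (carc_refl x) then show ?case by (auto intro: carc.carc_refl)
next
  case (carc_step x y L s t \<alpha>)
  note sf = seg_facts[OF carc_step.hyps(2)]
  show ?case
  proof (cases "\<alpha> ` {s..t} \<subseteq> W")
    case True
    then have "y \<in> W" using sf(1) carc_step.hyps(3) by auto
    then consider "carc (S \<inter> W) x y L" | z L1 L2 where "carc S x z L1" "carc (S \<inter> closure W) z y L2" 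
      "z \<in> closure W - W" "L = L1 + L2" using carc_step.IH carc_step.prems by blast
    then show ?thesis
    proof cases
      case 1
      then have "carc (S \<inter> W) x (\<alpha> t) (L + seglen s t \<alpha>)"
        using True carc_step.hyps by (intro carc.carc_step) auto
      then show ?thesis by blast
    next
      case 2
      have "\<alpha> ` {s..t} \<subseteq> S \<inter> closure W" using True carc_step.hyps(4) closure_subset by fast
      then have "carc (S \<inter> closure W) z (\<alpha> t) (L2 + seglen s t \<alpha>)"
        using 2 carc_step.hyps by (intro carc.carc_step) auto
      then show ?thesis using 2 by (metis add.assoc)
    qed
  next
    case False
    obtain r where r: "s \<le> r" "r < t" "\<alpha> r \<notin> W" "\<alpha> ` {r..t} \<subseteq> closure W" 
      by (rule seg_last_exit[OF sf(3) carc_step.prems False])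
    have i1: "r \<in> {s..t}" and i2: "\<alpha> ` {s..r} \<subseteq> S" and i3: "\<alpha> ` {r..t} \<subseteq> S \<inter> closure W" 
      using r carc_step.hyps(4) by auto
    obtain L1 L2 where l: "carc S (\<alpha> s) (\<alpha> r) L1" "carc (S \<inter> closure W) (\<alpha> r) (\<alpha> t) L2" "L1 + L2 = seglen s t \<alpha>"
      by (rule seg_carc_split[OF carc_step.hyps(2) i1 i2 i3])
    have "carc S x (\<alpha> r) (L + L1)" using carc_trans[OF l(1)] carc_step.hyps(1,3) by simp
    moreover have "\<alpha> r \<in> closure W - W" using r by auto
    ultimately show ?thesis using l by (metis add.assoc)
  qed
qed

lemma carc_first_exit:
  assumes "carc S x y L" "open W" "x \<in> W"
  shows "carc (S \<inter> W) x y L \<or> (\<exists>z L1 L2. carc (S \<inter> closure W) x z L1 \<and> carc S z y L2 \<and> 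
    z \<in> closure W - W \<and> L = L1 + L2)"
  using assms
proof (induction rule: carc.induct)
  case (carc_refl x) then show ?case by (auto intro: carc.carc_refl)
next
  case (carc_step x y L s t \<alpha>)
  note sf = seg_facts[OF carc_step.hyps(2)]
  consider "carc (S \<inter> W) x y L" | z L1 L2 where "carc (S \<inter> closure W) x z L1" "carc S z y L2" 
      "z \<in> closure W - W" "L = L1 + L2" using carc_step.IH carc_step.prems by blast
  then show ?case
  proof cases
    case 1
    then have ys: "\<alpha> s \<in> W" using carc_props carc_step.hyps(3) by blast
    show ?thesis
    proof (cases "\<alpha> ` {s..t} \<subseteq> W")
      case True
      then have "carc (S \<inter> W) x (\<alpha> t) (L + seglen s t \<alpha>)"
        using 1 carc_step.hyps by (intro carc.carc_step) auto
      then show ?thesis by blast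
    next
      case False
      obtain r where r: "s < r" "r \<le> t" "\<alpha> r \<notin> W" "\<alpha> ` {s..r} \<subseteq> closure W" 
        by (rule seg_first_exit[OF sf(3) carc_step.prems(1) ys False])
      have i1: "r \<in> {s..t}" and i2: "\<alpha> ` {s..r} \<subseteq> S \<inter> closure W" and i3: "\<alpha> ` {r..t} \<subseteq> S" 
        using r carc_step.hyps(4) by auto
      obtain L1 L2 where l: "carc (S \<inter> closure W) (\<alpha> s) (\<alpha> r) L1" "carc S (\<alpha> r) (\<alpha> t) L2" "L1 + L2 = seglen s t \<alpha>"
        by (rule seg_carc_split[OF carc_step.hyps(2) i1 i2 i3])
      have "S \<inter> W \<subseteq> S \<inter> closure W" using closure_subset by fast
      then have "carc (S \<inter> closure W) x (\<alpha> s) L" using 1 carc_mono carc_step.hyps(3) by blast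
      then have "carc (S \<inter> closure W) x (\<alpha> r) (L + L1)" by (rule carc_trans[OF l(1)])
      moreover have "\<alpha> r \<in> closure W - W" using r(3) i2 r(1) by auto
      ultimately show ?thesis using l by (metis add.assoc)
    qed
  next
    case 2
    then have "carc S z (\<alpha> t) (L2 + seglen s t \<alpha>)"
      using carc_step.hyps by (intro carc.carc_step) auto
    then show ?thesis using 2 by (metis add.assoc)
  qed
qed

text \<open>Confines a chain to the points lying between its ends. Estimates valid for every such
  point then hold along the whole curve without mentioning parameters.\<close>

lemma carc_trace:
  assumes "carc S x y L"
  shows "carc {q. \<exists>L1 L2. carc S x q L1 \<and> carc S q y L2} x y L"
  using assms
proof (induction rule: carc.induct)
  case (carc_refl x) then show ?case by (auto intro!: carc.carc_refl)
next
  case (carc_step x y L s t \<alpha>)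
  let ?X = "{q. \<exists>L1 L2. carc S x q L1 \<and> carc S q (\<alpha> t) L2}"
  have st: "carc S y (\<alpha> t) (seglen s t \<alpha>)" using carc_seg[OF carc_step.hyps(2,4)] carc_step.hyps(3) by simp
  have "{q. \<exists>L1 L2. carc S x q L1 \<and> carc S q y L2} \<subseteq> ?X"
    using carc_trans[OF st] by blast
  then have 1: "carc ?X x y L" by (rule carc_mono[OF carc_step.IH])
  have "\<alpha> r \<in> ?X" if r: "r \<in> {s..t}" for r
  proof -
    have i2: "\<alpha> ` {s..r} \<subseteq> S" and i3: "\<alpha> ` {r..t} \<subseteq> S" using r carc_step.hyps(4) by auto
    obtain L1 L2 where l: "carc S (\<alpha> s) (\<alpha> r) L1" "carc S (\<alpha> r) (\<alpha> t) L2"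
      by (rule seg_carc_split[OF carc_step.hyps(2) r i2 i3])
    then show ?thesis using carc_trans[OF l(1)] carc_step.hyps(1,3) by blast
  qed
  then have "\<alpha> ` {s..t} \<subseteq> ?X" by blast
  then show ?case by (rule carc.carc_step[OF 1 carc_step.hyps(2,3)])
qed

text \<open>All deformations of causal curves below are affine in a chart, so the deformed curves are smooth
  without further ado and only a pointwise condition on tangent vectors has to be checked.\<close>

lemma carc_affine:
  assumes c: "c \<in> A" "S \<subseteq> fst c" and lin: "bounded_linear \<Lambda>"
    and pt: "\<And>q. q \<in> snd c ` S \<Longrightarrow> b + \<Lambda> q \<in> cdom c \<and> cinv c (b + \<Lambda> q) \<in> S'"
    and vec: "\<And>q v. q \<in> snd c ` S \<Longrightarrow> fcv c q v \<Longrightarrow> fcv c (b + \<Lambda> q) (\<Lambda> v) \<and> 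
       gspeed c (b + \<Lambda> q) (\<Lambda> v) \<ge> \<kappa> * gspeed c q v + a \<bullet> v"
    and "carc S x y L"
  shows "\<exists>L'\<ge>\<kappa> * L + a \<bullet> (snd c y - snd c x). carc S' (cinv c (b + \<Lambda> (snd c x))) (cinv c (b + \<Lambda> (snd c y))) L'"
  using \<open>carc S x y L\<close>
proof (induction rule: carc.induct)
  case (carc_refl x)
  then have "carc S' (cinv c (b + \<Lambda> (snd c x))) (cinv c (b + \<Lambda> (snd c x))) 0"
    using pt by (intro carc.carc_refl) auto
  then show ?case by (intro exI[of _ 0]) auto
next
  case (carc_step x y L s t \<alpha>)
  let ?F = "\<lambda>q. b + \<Lambda> q"
  have "\<alpha> ` {s..t} \<subseteq> fst c" using carc_step.hyps(4) c by auto
  then obtain u where u: "cseg c s t u" "\<And>\<tau>. \<tau> \<in> {s..t} \<Longrightarrow> u \<tau> = snd c (\<alpha> \<tau>)"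
    "seglen s t \<alpha> = seglen s t (cinv c \<circ> u)"
    using seg_cseg[OF carc_step.hyps(2) _ c(1)] by blast
  have st: "s < t" using u(1) by (simp add: cseg_def)
  have inS: "u \<tau> \<in> snd c ` S" if "\<tau> \<in> {s..t}" for \<tau>
    using u(2)[OF that] carc_step.hyps(4) that by (metis imageI subsetD)
  have fu: "fcv c (u \<tau>) (vector_derivative u (at \<tau>))" if "\<tau> \<in> {s..t}" for \<tau>
    using u(1) that by (auto simp: cseg_def)
  obtain e where e: "e > 0" "smooth_on {s-e<..<t+e} u" using u(1) unfolding cseg_def by blast
  let ?w = "\<lambda>\<tau>. ?F (u \<tau>)"
  have vd: "vector_derivative ?w (at \<tau>) = \<Lambda> (vector_derivative u (at \<tau>))" if "\<tau> \<in> {s..t}" for \<tau>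
  proof (rule vector_derivative_at)
    have "(u has_vector_derivative vector_derivative u (at \<tau>)) (at \<tau>)"
      using smooth_on_vector_derivative[OF e(2)] that e(1) by auto
    from has_vector_derivative_add[OF has_vector_derivative_const bounded_linear.has_vector_derivative[OF lin this]]
    show "(?w has_vector_derivative \<Lambda> (vector_derivative u (at \<tau>))) (at \<tau>)"
      by simp
  qed
  have cw: "cseg c s t ?w"
    unfolding cseg_def
  proof (intro conjI ballI)
    show "\<exists>e>0. smooth_on {s-e<..<t+e} ?w" using smooth_on_affine_image[OF e(2) lin] e(1) by blast
    fix \<tau> assume \<tau>: "\<tau> \<in> {s..t}"
    show "?w \<tau> \<in> cdom c" using pt inS[OF \<tau>] by blast
    show "fcv c (?w \<tau>) (vector_derivative ?w (at \<tau>))" unfolding vd[OF \<tau>] using vec[OF inS[OF \<tau>] fu[OF \<tau>]] by blast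
  qed (use c st in auto)
  \<comment> \<open>The pointwise comparison of speeds integrates, and the linear term contributes
    only through the end points of \<open>u\<close>.\<close>
  have ineq: "\<kappa> * seglen s t \<alpha> + a \<bullet> (u t - u s) \<le> seglen s t (cinv c \<circ> ?w)"
  proof (rule has_integral_le)
    show "((\<lambda>\<tau>. \<kappa> * gspeed c (u \<tau>) (vector_derivative u (at \<tau>)) + a \<bullet> vector_derivative u (at \<tau>)) 
        has_integral (\<kappa> * seglen s t \<alpha> + a \<bullet> (u t - u s))) {s..t}"
      unfolding u(3)
      using cseg_has_length[OF u(1)] has_integral_linear[OF _ bounded_linear_inner_right, of _ _ _ a]
      by (intro has_integral_add has_integral_mult_right) (auto simp: comp_def)
    show "((\<lambda>\<tau>. gspeed c (?w \<tau>) (vector_derivative ?w (at \<tau>))) has_integral seglen s t (cinv c \<circ> ?w)) {s..t}"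
      by (rule cseg_has_length(1)[OF cw])
    fix \<tau> assume \<tau>: "\<tau> \<in> {s..t}"
    show "\<kappa> * gspeed c (u \<tau>) (vector_derivative u (at \<tau>)) + a \<bullet> vector_derivative u (at \<tau>) \<le> 
        gspeed c (?w \<tau>) (vector_derivative ?w (at \<tau>))"
      unfolding vd[OF \<tau>] using vec[OF inS[OF \<tau>] fu[OF \<tau>]] by blast
  qed
  obtain L' where L': "L' \<ge> \<kappa> * L + a \<bullet> (snd c y - snd c x)" 
    "carc S' (cinv c (?F (snd c x))) (cinv c (?F (snd c y))) L'" using carc_step.IH by blast
  have "(cinv c \<circ> ?w) ` {s..t} \<subseteq> S'" using pt inS by auto
  from carc.carc_step[OF L'(2) cseg_seg(1)[OF cw] _ this]
  have "carc S' (cinv c (?F (snd c x))) ((cinv c \<circ> ?w) t) (L' + seglen s t (cinv c \<circ> ?w))"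
    using u(2)[of s] st carc_step.hyps(3) by simp
  moreover have "L' + seglen s t (cinv c \<circ> ?w) \<ge> \<kappa> * (L + seglen s t \<alpha>) + a \<bullet> (snd c (\<alpha> t) - snd c x)"
    using L'(1) ineq u(2)[of s] u(2)[of t] st carc_step.hyps(3) by (simp add: algebra_simps inner_diff_right)
  ultimately show ?case using u(2)[of t] st by auto
qed

text \<open>A pointwise inequality that is linear in the velocity and affine in the speed integrates
  to one about the end points and the length alone. All integral estimates in a chart are brought to
  this form by choosing \<open>a\<close> and \<kappa>.\<close>

lemma carc_linear:
  assumes c: "c \<in> A" "S \<subseteq> fst c"
    and vec: "\<And>q v. q \<in> snd c ` S \<Longrightarrow> fcv c q v \<Longrightarrow> a \<bullet> v + \<kappa> * gspeed c q v \<ge> 0"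
    and "carc S x y L"
  shows "a \<bullet> (snd c y - snd c x) + \<kappa> * L \<ge> 0"
  using \<open>carc S x y L\<close>
proof (induction rule: carc.induct)
  case (carc_step x y L s t \<alpha>)
  have "\<alpha> ` {s..t} \<subseteq> fst c" using carc_step.hyps(4) c by auto
  then obtain u where u: "cseg c s t u" "\<And>\<tau>. \<tau> \<in> {s..t} \<Longrightarrow> u \<tau> = snd c (\<alpha> \<tau>)"
    "seglen s t \<alpha> = seglen s t (cinv c \<circ> u)"
    using seg_cseg[OF carc_step.hyps(2) _ c(1)] by blast
  have st: "s < t" using u(1) by (simp add: cseg_def)
  have "0 \<le> a \<bullet> (u t - u s) + \<kappa> * seglen s t \<alpha>"
  proof (rule has_integral_nonneg)
    show "((\<lambda>\<tau>. a \<bullet> vector_derivative u (at \<tau>) + \<kappa> * gspeed c (u \<tau>) (vector_derivative u (at \<tau>))) 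
        has_integral (a \<bullet> (u t - u s) + \<kappa> * seglen s t \<alpha>)) {s..t}"
      unfolding u(3)
      using cseg_has_length[OF u(1)] has_integral_linear[OF _ bounded_linear_inner_right, of _ _ _ a]
      by (intro has_integral_add has_integral_mult_right) (auto simp: comp_def)
    fix \<tau> assume \<tau>: "\<tau> \<in> {s..t}"
    then have "u \<tau> \<in> snd c ` S" using u(2)[OF \<tau>] carc_step.hyps(4) by (metis imageI subsetD)
    then show "0 \<le> a \<bullet> vector_derivative u (at \<tau>) + \<kappa> * gspeed c (u \<tau>) (vector_derivative u (at \<tau>))"
      using u(1) \<tau> by (intro vec) (auto simp: cseg_def)
  qed
  then show ?case using carc_step.IH u(2)[of s] u(2)[of t] st carc_step.hyps(3) by (simp add: algebra_simps inner_diff_right)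
qed simp

lemma carc_straight:
  assumes c: "c \<in> A"
    and pt: "\<And>r. r \<in> {0..1} \<Longrightarrow> x + r *\<^sub>R v \<in> cdom c \<and> cinv c (x + r *\<^sub>R v) \<in> S \<and> 
      fcv c (x + r *\<^sub>R v) v \<and> gspeed c (x + r *\<^sub>R v) v \<ge> l"
  shows "\<exists>L\<ge>l. carc S (cinv c x) (cinv c (x + v)) L"
proof -
  let ?u = "\<lambda>r::real. x + r *\<^sub>R v"
  have vd: "(?u has_vector_derivative v) (at r)" for r
    by (auto intro!: derivative_eq_intros)
  \<comment> \<open>Affine curves form a family closed under differentiation, the derivative being a
    constant member.\<close>
  have sm: "smooth_on UNIV ?u"
  proof (rule smooth_on_coinduct[of _ _ "{w. \<exists>a b. w = (\<lambda>r::real. a + r *\<^sub>R b)}"])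
    fix w :: "real \<Rightarrow> real^'n" and z assume "w \<in> {w. \<exists>a b. w = (\<lambda>r::real. a + r *\<^sub>R b)}"
    then obtain a b where w: "w = (\<lambda>r. a + r *\<^sub>R b)" by blast
    have d: "(w has_derivative (\<lambda>h. h *\<^sub>R b)) (at r)" for r 
      unfolding w by (auto intro!: derivative_eq_intros)
    show "w differentiable_on UNIV" unfolding differentiable_on_def differentiable_def using d by blast
    have "z *\<^sub>R b + r *\<^sub>R 0 = frechet_derivative w (at r) z" for r
      using has_derivative_imp_frechet_eq[OF d[of r], of z] by simp
    then show "\<exists>w'\<in>{w. \<exists>a b. w = (\<lambda>r::real. a + r *\<^sub>R b)}. \<forall>r\<in>UNIV. w' r = frechet_derivative w (at r) z"
      by (intro bexI[of _ "\<lambda>r. z *\<^sub>R b + r *\<^sub>R 0"]) blast+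
  qed auto
  have cs: "cseg c 0 1 ?u"
    unfolding cseg_def
  proof (intro conjI ballI)
    show "\<exists>e>0. smooth_on {0-e<..<1+e} ?u" using smooth_on_subset[OF sm] by (intro exI[of _ 1]) auto
    fix r :: real assume "r \<in> {0..1}"
    then show "?u r \<in> cdom c" "fcv c (?u r) (vector_derivative ?u (at r))"
      using pt vector_derivative_at[OF vd] by auto
  qed (use c in auto)
  have "l * (1 - 0) \<le> seglen 0 1 (cinv c \<circ> ?u)"
  proof (rule has_integral_le)
    show "((\<lambda>r. l) has_integral l * (1 - 0)) {0..1::real}" using has_integral_const_real[of l 0 1] by simp
    show "((\<lambda>r. gspeed c (?u r) (vector_derivative ?u (at r))) has_integral seglen 0 1 (cinv c \<circ> ?u)) {0..1}"
      by (rule cseg_has_length(1)[OF cs])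
    fix r :: real assume "r \<in> {0..1}"
    then show "l \<le> gspeed c (?u r) (vector_derivative ?u (at r))"
      unfolding vector_derivative_at[OF vd] using pt by blast
  qed
  moreover have "carc S ((cinv c \<circ> ?u) 0) ((cinv c \<circ> ?u) 1) (seglen 0 1 (cinv c \<circ> ?u))"
    by (rule carc_seg[OF cseg_seg(1)[OF cs]]) (use pt in auto)
  ultimately show ?thesis by auto
qed

end

section \<open>Pointwise estimates for a nearly constant Lorentzian metric\<close>

text \<open>\<open>e\<close> is a unit vector timelike on all of \<open>B\<close>. The constant
  \<open>m\<close> says that causal vectors are uniformly far from being orthogonal to
  \<open>e\<close>; \<open>C\<close> bounds the form and its variation. By \<open>small\<close>, the
  product with \<open>e\<close> may be computed at the centre \<open>o\<^sub>c\<close> at the cost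
  of half of \<open>m\<close>.\<close>

locale metric_patch =
  fixes g :: "'v::euclidean_space \<Rightarrow> 'v \<Rightarrow> 'v \<Rightarrow> real" and B :: "'v set" and e o\<^sub>c :: 'v and m C :: real
  assumes addL: "g y (u + v) w = g y u w + g y v w"
    and addR: "g y u (v + w) = g y u v + g y u w"
    and scaleL: "g y (a *\<^sub>R v) w = a * g y v w"
    and scaleR: "g y v (a *\<^sub>R w) = a * g y v w"
    and sym: "y \<in> B \<Longrightarrow> g y v w = g y w v"
    and lip: "y \<in> B \<Longrightarrow> y' \<in> B \<Longrightarrow> \<bar>g y v w - g y' v w\<bar> \<le> C * norm (y - y') * norm v * norm w"
    and bd: "y \<in> B \<Longrightarrow> \<bar>g y v w\<bar> \<le> C * norm v * norm w"
    and norm_e: "norm e = 1"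
    and m_pos: "m > 0" and m_le: "m \<le> 1" and C_ge: "C \<ge> 1"
    and low: "y \<in> B \<Longrightarrow> g y v v \<le> 0 \<Longrightarrow> \<bar>g y v e\<bar> \<ge> m * norm v"
    and e_time: "y \<in> B \<Longrightarrow> g y e e < 0"
    and o_in: "o\<^sub>c \<in> B"
    and small: "y \<in> B \<Longrightarrow> C * norm (y - o\<^sub>c) \<le> m / 2"
begin

definition fc :: "'v \<Rightarrow> 'v \<Rightarrow> bool" where
  "fc y v \<longleftrightarrow> v \<noteq> 0 \<and> g y v v \<le> 0 \<and> g y v e < 0"

text \<open>Adding zero turns the future causal vectors into a closed convex cone, which allows sums
  and duality without case distinctions.\<close>

definition cone :: "'v \<Rightarrow> 'v \<Rightarrow> bool" where "cone y v \<longleftrightarrow> v = 0 \<or> fc y v"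

definition F :: "'v \<Rightarrow> 'v \<Rightarrow> real" where "F y v = sqrt \<bar>g y v v\<bar>"

text \<open>A linear time coordinate: minus the product with \<open>e\<close>, frozen at the centre.
  On future causal vectors it is comparable to the norm, and unlike arc length it depends only on
  the end points of a curve.\<close>

definition lam :: "'v \<Rightarrow> real" where "lam v = - g o\<^sub>c v e"

lemma g_zero [simp]: "g y 0 v = 0" "g y v 0 = 0"
  using scaleL[of y 0 v v] scaleR[of y v 0 v] by simp_all

lemma g_uminus [simp]: "g y (- v) w = - g y v w" "g y w (- v) = - g y w v"
  using scaleL[of y "-1" v w] scaleR[of y w "-1" v] by simp_all

lemma g_diff: "g y (u - v) w = g y u w - g y v w" "g y w (u - v) = g y w u - g y w v"
  using addL[of y u "-v" w] addR[of y w u "-v"] by simp_all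

lemmas g_lin = addL addR scaleL scaleR g_diff

lemma lam_lin: "lam (u + v) = lam u + lam v" "lam (u - v) = lam u - lam v" "lam (a *\<^sub>R v) = a * lam v"
  by (simp_all add: lam_def g_lin)

lemma lam_abs: "\<bar>lam v\<bar> \<le> C * norm v"
  using bd[OF o_in, of v e] norm_e by (simp add: lam_def)

lemma e_ne: "e \<noteq> 0" using norm_e by auto

lemma gee: assumes "y \<in> B" shows "g y e e \<le> - m" "- g y e e \<le> C"
  using low[OF assms, of e] e_time[OF assms] norm_e bd[OF assms, of e e] by auto

lemma m_le_C: "m \<le> C" using m_le C_ge by simp

lemma fc_low: "y \<in> B \<Longrightarrow> fc y v \<Longrightarrow> - g y v e \<ge> m * norm v"
  using low[of y v] by (simp add: fc_def)

lemma fc_e: "y \<in> B \<Longrightarrow> fc y e"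
  using e_time[of y] e_ne by (simp add: fc_def)

lemma fc_lam: assumes "y \<in> B" "fc y v" shows "lam v \<ge> (m/2) * norm v" "lam v > 0"
proof -
  have "\<bar>g y v e - g o\<^sub>c v e\<bar> \<le> C * norm (y - o\<^sub>c) * norm v * norm e" by (rule lip[OF assms(1) o_in])
  also have "\<dots> \<le> (m/2) * norm v"
    unfolding norm_e mult_1_right by (rule mult_right_mono[OF small[OF assms(1)]]) simp
  finally have "\<bar>g y v e - g o\<^sub>c v e\<bar> \<le> (m/2) * norm v" .
  moreover have "- g y v e \<ge> m * norm v" by (rule fc_low[OF assms])
  ultimately show 1: "lam v \<ge> (m/2) * norm v" unfolding lam_def by linarith
  have "(m/2) * norm v > 0" using assms m_pos by (simp add: fc_def)
  with 1 show "lam v > 0" by linarith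
qed

lemma fc_prod:
  assumes y: "y \<in> B" and v: "fc y v" and w: "fc y w" shows "g y v w \<le> 0"
proof -
  \<comment> \<open>Chosen to make \<open>v - s *\<^sub>R w\<close> orthogonal to \<open>e\<close>;
    such a vector has nonnegative square, and expanding the square bounds
    \<open>g y v w\<close>.\<close>
  define s where "s = g y v e / g y w e"
  have we: "g y w e < 0" and ve: "g y v e < 0" using v w by (auto simp: fc_def)
  then have s: "s > 0" "g y (v - s *\<^sub>R w) e = 0" by (auto simp: s_def g_lin divide_neg_neg)
  have "0 \<le> g y (v - s *\<^sub>R w) (v - s *\<^sub>R w)"
  proof (rule ccontr)
    assume "\<not> 0 \<le> g y (v - s *\<^sub>R w) (v - s *\<^sub>R w)"
    then have n: "g y (v - s *\<^sub>R w) (v - s *\<^sub>R w) < 0" by simp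
    from low[OF y less_imp_le[OF n]] s(2) m_pos have "v - s *\<^sub>R w = 0"
      by (simp add: mult_le_0_iff)
    with n show False by simp
  qed
  also have "\<dots> = g y v v + s^2 * g y w w - 2 * s * g y v w"
    using sym[OF y, of w v] by (simp add: g_lin power2_eq_square algebra_simps)
  finally have "2 * s * g y v w \<le> g y v v + s^2 * g y w w" by simp
  also have "\<dots> \<le> 0" using v w by (simp add: fc_def add_nonpos_nonpos mult_le_0_iff)
  finally show ?thesis using s(1) by (simp add: mult_le_0_iff)
qed

lemma cone_prod: "y \<in> B \<Longrightarrow> cone y v \<Longrightarrow> cone y w \<Longrightarrow> g y v w \<le> 0"
  using fc_prod by (auto simp: cone_def)

lemma coneI: "g y v v \<le> 0 \<Longrightarrow> g y v e \<le> 0 \<Longrightarrow> y \<in> B \<Longrightarrow> cone y v"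
proof -
  assume *: "g y v v \<le> 0" "g y v e \<le> 0" "y \<in> B"
  have "g y v e < 0" if "v \<noteq> 0"
  proof -
    have "m * norm v > 0" using that m_pos by simp
    then show ?thesis using low[OF *(3,1)] *(2) by linarith
  qed
  then show "cone y v" using * by (auto simp: cone_def fc_def)
qed

lemma cone_self: "cone y v \<Longrightarrow> g y v v \<le> 0" "cone y v \<Longrightarrow> g y v e \<le> 0"
  by (auto simp: cone_def fc_def)

lemma cone_e: "y \<in> B \<Longrightarrow> cone y e" by (simp add: cone_def fc_e)

lemma cone_add:
  assumes y: "y \<in> B" and v: "cone y v" and w: "cone y w" shows "cone y (v + w)"
proof (rule coneI[OF _ _ y])
  show "g y (v + w) (v + w) \<le> 0"
    using cone_prod[OF y v w] cone_self[OF v] cone_self[OF w] sym[OF y, of w v] by (simp add: g_lin)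
  show "g y (v + w) e \<le> 0" using cone_self[OF v] cone_self[OF w] by (simp add: g_lin)
qed

lemma cone_scale: "y \<in> B \<Longrightarrow> cone y v \<Longrightarrow> a \<ge> 0 \<Longrightarrow> cone y (a *\<^sub>R v)"
  by (rule coneI) (auto simp: g_lin mult_nonneg_nonpos cone_self)

text \<open>Self-duality of the causal cone. Membership in the cone becomes a family of linear
  inequalities, each of which can be integrated along a curve.\<close>

lemma cone_dual:
  assumes y: "y \<in> B" and d: "\<And>w. cone y w \<Longrightarrow> g y v w \<le> 0" shows "cone y v"
proof -
  define N where "N = - g y e e"
  have N: "N > 0" using e_time[OF y] by (simp add: N_def)
  define \<alpha> where "\<alpha> = - g y v e / N"
  define z where "z = v - \<alpha> *\<^sub>R e"
  have ze: "g y z e = 0" "g y e z = 0"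
    using N sym[OF y, of e z] by (auto simp: z_def \<alpha>_def g_lin N_def field_simps)
  have veN: "g y v e \<le> 0" by (rule d[OF cone_e[OF y]])
  then have a: "\<alpha> \<ge> 0" using N by (simp add: \<alpha>_def divide_nonpos_pos)
  have v: "v = \<alpha> *\<^sub>R e + z" by (simp add: z_def)
  have zz: "g y z z \<ge> 0"
  proof (rule ccontr)
    assume "\<not> ?thesis"
    then have n: "g y z z < 0" by simp
    then have "m * norm z \<le> 0" using low[OF y, of z] ze by simp
    then have "z = 0" using m_pos by (simp add: mult_le_0_iff)
    then show False using n by simp
  qed
  define n where "n = sqrt (g y z z)"
  have n: "n \<ge> 0" "n^2 = g y z z" using zz by (auto simp: n_def)
  \<comment> \<open>The null vector with the same component orthogonal to \<open>e\<close> as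
    \<open>v\<close>: among the test vectors it gives the sharp bound for that component.\<close>
  define w where "w = (n / sqrt N) *\<^sub>R e + z"
  have sN: "sqrt N > 0" "sqrt N * sqrt N = N" using N by auto
  have ww: "g y w w = - ((n / sqrt N)^2 * N) + n^2"
    unfolding w_def using ze n(2) by (simp add: g_lin N_def power2_eq_square)
  also have "\<dots> = 0" using N by (simp add: power_divide)
  finally have ww: "g y w w = 0" .
  have we: "g y w e = - ((n / sqrt N) * N)" unfolding w_def using ze by (simp add: g_lin N_def)
  have "g y w e \<le> 0" unfolding we using n(1) N by simp
  then have cw: "cone y w" using ww by (intro coneI) (use y in auto)
  have "g y v w = - (\<alpha> * ((n / sqrt N) * N)) + n^2"
    unfolding v w_def using ze n(2) by (simp add: g_lin N_def)
  also have "\<dots> = n * (n - \<alpha> * sqrt N)" 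
  proof -
    have "(n / sqrt N) * N = n * sqrt N" using sN by (simp add: field_simps)
    then show ?thesis by (simp add: power2_eq_square algebra_simps)
  qed
  finally have "n * (n - \<alpha> * sqrt N) \<le> 0" using d[OF cw] by simp
  then have "n \<le> \<alpha> * sqrt N" using n(1) a sN by (cases "n = 0") (auto simp: mult_le_0_iff)
  then have "n^2 \<le> (\<alpha> * sqrt N)^2" using n(1) by (intro power_mono) auto
  then have "n^2 \<le> \<alpha>^2 * N" using N by (simp add: power_mult_distrib)
  moreover have "g y v v = - (\<alpha>^2 * N) + n^2"
    unfolding v using ze n(2) by (simp add: g_lin N_def power2_eq_square)
  ultimately show ?thesis using veN y by (intro coneI) auto
qed

lemma F_sq: "cone y v \<Longrightarrow> (F y v)^2 = - g y v v" "F y v \<ge> 0"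
  using cone_self[of y v] by (auto simp: F_def)

lemma F_le: assumes "y \<in> B" shows "F y v \<le> C * norm v"
proof -
  have "F y v \<le> sqrt ((C * norm v)^2)"
    unfolding F_def
  proof (rule real_sqrt_le_mono)
    have "\<bar>g y v v\<bar> \<le> C * norm v * norm v" by (rule bd[OF assms])
    also have "\<dots> \<le> C * (C * norm v * norm v)"
      using C_ge mult_right_mono[of 1 C "C * norm v * norm v"] by simp
    finally show "\<bar>g y v v\<bar> \<le> (C * norm v)^2" by (simp add: power2_eq_square algebra_simps)
  qed
  then show ?thesis using C_ge by simp
qed

lemma F_ge: "a^2 \<le> - g y v v \<Longrightarrow> a \<le> F y v"
  unfolding F_def by (rule real_le_rsqrt) linarith

text \<open>The cross term with \<open>a *\<^sub>R e\<close> contributes at least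
  \<open>2 * a * m * norm u\<close>, while moving the base point costs at most half of this by the
  last hypothesis. The other half remains as a surplus.\<close>

lemma push:
  assumes y: "y \<in> B" "y' \<in> B" and u: "fc y u" and a: "0 \<le> a" "a \<le> norm u"
    and d: "4 * C * norm (y - y') * norm u \<le> m * a"
  shows "fc y' (u + a *\<^sub>R e)" "- g y' (u + a *\<^sub>R e) (u + a *\<^sub>R e) \<ge> - g y u u + a * m * norm u"
proof -
  let ?u = "u + a *\<^sub>R e" and ?D = "C * norm (y - y')"
  have un: "norm u > 0" using u by (simp add: fc_def)
  have D0: "?D \<ge> 0" using C_ge by simp
  have n2: "norm ?u \<le> 2 * norm u"
    using norm_triangle_ineq[of u "a *\<^sub>R e"] a norm_e by simp
  have l1: "\<bar>g y ?u ?u - g y' ?u ?u\<bar> \<le> ?D * norm ?u * norm ?u" by (rule lip[OF y])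
  also have "\<dots> \<le> ?D * (2 * norm u) * (2 * norm u)"
    using mult_left_mono[OF mult_mono[OF n2 n2] D0] by (simp add: mult.assoc)
  also have "\<dots> = (4 * C * norm (y - y') * norm u) * norm u" by simp
  also have "\<dots> \<le> m * a * norm u" by (intro mult_right_mono d) simp
  finally have A: "\<bar>g y ?u ?u - g y' ?u ?u\<bar> \<le> m * a * norm u" .
  have ue: "- g y u e \<ge> m * norm u" by (rule fc_low[OF y(1) u])
  have "g y ?u ?u = g y u u + 2 * a * g y u e + a^2 * g y e e"
    using sym[OF y(1), of e u] by (simp add: g_lin power2_eq_square algebra_simps)
  moreover have "a^2 * g y e e \<le> 0" using e_time[OF y(1)] by (simp add: mult_nonneg_nonpos)
  moreover have "2 * a * g y u e \<le> 2 * a * (- (m * norm u))" using ue a by (intro mult_left_mono) auto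
  ultimately have "- g y ?u ?u \<ge> - g y u u + 2 * a * m * norm u" by (simp add: algebra_simps)
  with A show Q: "- g y' ?u ?u \<ge> - g y u u + a * m * norm u" by (simp add: algebra_simps abs_le_iff)
  have "\<bar>g y ?u e - g y' ?u e\<bar> \<le> ?D * norm ?u * norm e" by (rule lip[OF y])
  also have "\<dots> \<le> ?D * (2 * norm u)" using n2 D0 norm_e by (simp add: mult_left_mono)
  also have "\<dots> \<le> m * a / 2" using d by simp
  also have "\<dots> \<le> m * norm u / 2" using a m_pos by simp
  finally have E: "\<bar>g y ?u e - g y' ?u e\<bar> \<le> m * norm u / 2" .
  have "g y ?u e \<le> - (m * norm u)" 
    using ue a mult_nonneg_nonpos[of a "g y e e"] e_time[OF y(1)] by (simp add: g_lin)
  moreover have "m * norm u > 0" using m_pos un by simp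
  ultimately have neg: "g y' ?u e < 0" using E by linarith
  have "0 \<le> a * m * norm u" using a m_pos by simp
  moreover have "g y u u \<le> 0" using u by (simp add: fc_def)
  ultimately have "g y' ?u ?u \<le> 0" using Q by linarith
  moreover have "?u \<noteq> 0" using neg by auto
  ultimately show "fc y' ?u" using neg by (simp add: fc_def)
qed

text \<open>The tilt \<open>k * lam v\<close> gains a multiple of \<open>k * norm v ^ 2\<close>, which beats the loss \<open>C * D * norm v ^ 2\<close> caused by
  moving the base point.\<close>

lemma transport:
  assumes q: "q \<in> B" "q' \<in> B" and d: "norm (q - q') \<le> D" and k: "0 \<le> k" "k * C \<le> 1" "8 * C * D \<le> m^2 * k"
    and v: "fc q v"
  shows "fc q' (v + (k * lam v) *\<^sub>R e)" "F q' (v + (k * lam v) *\<^sub>R e) \<ge> F q v"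
    "F q' (v + (k * lam v) *\<^sub>R e) \<ge> sqrt (k / 2) * m * norm v"
proof -
  let ?a = "k * lam v" and ?v = "v + (k * lam v) *\<^sub>R e"
  have l: "lam v \<ge> (m/2) * norm v" "lam v > 0" using fc_lam[OF q(1) v] by auto
  have a0: "0 \<le> ?a" using k l by simp
  have "?a \<le> k * (C * norm v)" using lam_abs[of v] k(1) by (intro mult_left_mono) auto
  also have "\<dots> \<le> 1 * norm v" using mult_right_mono[OF k(2), of "norm v"] by (simp add: algebra_simps)
  finally have a1: "?a \<le> norm v" by simp
  have a2: "?a \<ge> k * ((m/2) * norm v)" using k(1) l(1) by (intro mult_left_mono)
  have "4 * C * norm (q - q') * norm v \<le> 4 * C * D * norm v"
    using d C_ge by (intro mult_right_mono mult_left_mono) auto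
  also have "\<dots> = (8 * C * D) * (norm v / 2)" by simp
  also have "\<dots> \<le> (m^2 * k) * (norm v / 2)" by (intro mult_right_mono k(3)) simp
  also have "\<dots> = m * (k * ((m/2) * norm v))" by (simp add: power2_eq_square)
  also have "\<dots> \<le> m * ?a" by (rule mult_left_mono[OF a2]) (use m_pos in simp)
  finally have d': "4 * C * norm (q - q') * norm v \<le> m * ?a" .
  note p = push[OF q v a0 a1 d']
  show "fc q' ?v" by (rule p)
  have Q0: "- g q v v \<ge> 0" using v by (simp add: fc_def)
  have am: "?a * m * norm v \<ge> k / 2 * m^2 * (norm v)^2"
  proof -
    have "k * ((m/2) * norm v) * (m * norm v) \<le> ?a * (m * norm v)"
      by (rule mult_right_mono[OF a2]) (use m_pos in simp)
    then show ?thesis by (simp add: power2_eq_square algebra_simps)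
  qed
  have am0: "?a * m * norm v \<ge> 0" using a0 m_pos by simp
  have "(F q v)^2 \<le> - g q' ?v ?v"
    using F_sq(1)[of q v] v p(2) am0 by (simp add: cone_def)
  then show "F q' ?v \<ge> F q v" by (rule F_ge)
  have "(sqrt (k / 2) * m * norm v)^2 = k / 2 * m^2 * (norm v)^2"
    using k(1) by (simp add: power_mult_distrib)
  also have "\<dots> \<le> - g q' ?v ?v" using p(2) am Q0 by linarith
  finally show "F q' ?v \<ge> sqrt (k / 2) * m * norm v" by (rule F_ge)
qed

text \<open>The square of \<open>h *\<^sub>R e\<close> is at most \<open>- m * h^2\<close>. The
  factor \<open>m / (4 * C)\<close> keeps the cross term below half of this and the square of
  \<open>w\<close> below a sixteenth, so a quarter is left.\<close>

lemma straight:
  assumes y: "y \<in> B" and h: "h > 0" and w: "norm w \<le> m / (4 * C) * h"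
  shows "fc y (h *\<^sub>R e + w)" "F y (h *\<^sub>R e + w) \<ge> h * m / 2"
proof -
  let ?v = "h *\<^sub>R e + w"
  have Cw: "C * norm w \<le> m * h / 4" 
    using mult_left_mono[OF w, of C] C_ge by simp
  have w1: "norm w \<le> h / 4"
  proof -
    have "m / (4 * C) \<le> 1 / 4" using m_le C_ge by (simp add: field_simps)
    then have "m / (4 * C) * h \<le> 1 / 4 * h" using h by (intro mult_right_mono) auto
    then show ?thesis using w by linarith
  qed
  have ew: "\<bar>g y e w\<bar> \<le> m * h / 4" using bd[OF y, of e w] norm_e Cw by simp
  have "\<bar>g y w w\<bar> \<le> (C * norm w) * norm w" by (rule bd[OF y])
  also have "\<dots> \<le> (m * h / 4) * (h / 4)" using Cw w1 m_pos h by (intro mult_mono) auto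
  finally have ww: "\<bar>g y w w\<bar> \<le> m * h^2 / 16" by (simp add: power2_eq_square)
  have "h^2 * g y e e \<le> h^2 * (-m)" by (intro mult_left_mono gee(1)[OF y]) simp
  then have ee: "h^2 * g y e e \<le> - (m * h^2)" by (simp add: mult.commute)
  have "2 * h * \<bar>g y e w\<bar> \<le> 2 * h * (m * h / 4)" using h ew by (intro mult_left_mono) auto
  then have ew2: "2 * h * \<bar>g y e w\<bar> \<le> m * h^2 / 2" by (simp add: power2_eq_square algebra_simps)
  have exp: "g y ?v ?v = h^2 * g y e e + 2 * h * g y e w + g y w w"
    using sym[OF y, of w e] by (simp add: g_lin power2_eq_square algebra_simps)
  have "2 * h * g y e w \<le> 2 * h * \<bar>g y e w\<bar>" using h by (intro mult_left_mono) auto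
  then have *: "- g y ?v ?v \<ge> m * h^2 / 4"
  proof -
    have "0 \<le> m * h^2" using m_pos by simp
    then show ?thesis using \<open>2 * h * g y e w \<le> 2 * h * \<bar>g y e w\<bar>\<close> ee ew2 ww unfolding exp by linarith
  qed
  have "g y ?v e = h * g y e e + g y e w" using sym[OF y, of w e] by (simp add: g_lin)
  also have "\<dots> \<le> h * (- m) + m * h / 4" using ew h gee(1)[OF y] by (intro add_mono mult_left_mono) auto
  also have "\<dots> < 0" using h m_pos by simp
  finally have neg: "g y ?v e < 0" .
  have "m * h^2 / 4 \<ge> 0" using m_pos by simp
  with * neg show "fc y ?v" unfolding fc_def by (metis g_zero(1) less_irrefl neg_0_le_iff_le order_trans)
  have "m^2 * h^2 \<le> m * h^2"
    using m_le m_pos by (intro mult_right_mono) (auto simp: power2_eq_square mult_le_cancel_left1)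
  then have "(h * m / 2)^2 \<le> m * h^2 / 4" by (simp add: power_mult_distrib power_divide mult.commute)
  then show "F y ?v \<ge> h * m / 2" using * by (intro F_ge) linarith
qed

text \<open>Fraction of \<open>F^2 / lam\<close> that may be subtracted from a causal vector in
  direction \<open>e\<close>. Of the bounds that follow, the one with \<open>4 * C\<close> preserves
  the sign of the square and the one with \<open>2 * C^2\<close> the time orientation.\<close>

definition chc :: real where "chc = m^2 / (4 * C^2)"

lemma chc_pos: "chc > 0" and chc_le: "chc \<le> 1" "4 * C * chc \<le> m" "2 * C\<^sup>2 * chc \<le> m^2"
proof -
  show "chc > 0" using m_pos C_ge by (simp add: chc_def)
  have C2: "C^2 \<ge> 1" "C^2 \<ge> C" 
    using C_ge mult_mono[of 1 C 1 C] mult_right_mono[of 1 C C] by (auto simp: power2_eq_square)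
  have m2: "m^2 \<le> m" "m^2 \<le> 1" using m_le m_pos by (auto simp: power2_eq_square mult_le_one)
  have "m^2 \<le> 4 * C^2" using m2 C2 by linarith
  then show "chc \<le> 1" using C2 by (simp add: chc_def divide_le_eq)
  have "4 * C * chc = m^2 / C" using C_ge by (simp add: chc_def power2_eq_square)
  also have "\<dots> \<le> m^2 / 1" using C_ge by (intro divide_left_mono) auto
  finally show "4 * C * chc \<le> m" using m2 by simp
  have "2 * C\<^sup>2 * chc = m^2 / 2" using C_ge by (simp add: chc_def)
  then show "2 * C\<^sup>2 * chc \<le> m^2" using zero_le_power2[of m] by linarith
qed

text \<open>Being homogeneous of degree one and affine in \<open>F\<close>, the estimate \<open>2 * \<delta> * F - \<delta>^2 * lam \<le> F^2 / lam\<close> used here can be integrated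
  along curves, and shows that the chord of a curve of length at least \<open>\<delta> * lam\<close> is uniformly timelike.\<close>

lemma chord_pointwise:
  assumes q: "q \<in> B" "q' \<in> B" and d: "norm (q' - q) \<le> d" and xi: "16 * C * d \<le> m^2 * \<xi>" "2 * C * \<xi> \<le> 1" "\<xi> \<ge> 0"
    and u: "fc q' u" 
  shows "cone q (u - (chc * (2 * \<delta> * F q' u - \<delta>^2 * lam u)) *\<^sub>R e + (\<xi> * lam u) *\<^sub>R e)"
proof -
  let ?l = "lam u" and ?f = "F q' u"
  have l: "?l \<ge> (m/2) * norm u" "?l > 0" using fc_lam[OF q(2) u] by auto
  have un: "norm u > 0" using u by (simp add: fc_def)
  \<comment> \<open>To first order \<open>?f^2 / ?l\<close> measures how deep \<open>u\<close> lies
    inside the cone at \<open>q'\<close>, so this much of \<open>e\<close> can be removed while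
    staying causal.\<close>
  define h where "h = chc * ?f^2 / ?l"
  have h0: "h \<ge> 0" using chc_pos l by (simp add: h_def)
  have fsq: "?f^2 = - g q' u u" using F_sq(1)[of q' u] u by (simp add: cone_def)
  have f2: "?f^2 \<le> C * norm u * norm u" using bd[OF q(2), of u u] fsq by simp
  have hl: "h * ?l = chc * ?f^2" using l by (simp add: h_def)
  have hm: "h * (m / 2) * norm u \<le> chc * ?f^2"
    using mult_left_mono[OF l(1) h0] hl by (simp add: algebra_simps)
  have hu1: "2 * C * h * norm u \<le> ?f^2"
  proof -
    have "(m * norm u) * (2 * C * h) = 4 * C * (h * (m / 2) * norm u)" by (simp add: algebra_simps)
    also have "\<dots> \<le> 4 * C * (chc * ?f^2)" using hm C_ge by (intro mult_left_mono) auto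
    also have "\<dots> \<le> m * ?f^2" using mult_right_mono[OF chc_le(2), of "?f^2"] by (simp add: algebra_simps)
    finally show ?thesis using m_pos by (simp add: algebra_simps)
  qed
  have hu2: "C * h \<le> m * norm u"
  proof -
    have "(h * (m / 2) * norm u) \<le> chc * (C * norm u * norm u)"
      using hm mult_left_mono[OF f2, of chc] chc_pos by linarith
    then have "h * (m / 2) \<le> chc * C * norm u" using un by (simp add: algebra_simps)
    then have "2 * C * (h * (m / 2)) \<le> 2 * C * (chc * C * norm u)" using C_ge by (intro mult_left_mono) auto
    then have "m * (C * h) \<le> (2 * C^2 * chc) * norm u" by (simp add: power2_eq_square algebra_simps)
    also have "\<dots> \<le> m^2 * norm u" by (intro mult_right_mono chc_le) simp
    finally show ?thesis using m_pos by (simp add: power2_eq_square)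
  qed
  have hu3: "2 * h \<le> norm u"
  proof -
    have "(h * (m / 2) * norm u) \<le> chc * (C * norm u * norm u)"
      using hm mult_left_mono[OF f2, of chc] chc_pos by linarith
    then have "h * (m / 2) \<le> chc * C * norm u" using un by (simp add: algebra_simps)
    also have "\<dots> \<le> m / 4 * norm u" using chc_le(2) by (intro mult_right_mono) (auto simp: mult.commute mult.left_commute)
    finally have "m * (2 * h) \<le> m * norm u" by (simp add: algebra_simps)
    then show ?thesis using m_pos by simp
  qed
  define u' where "u' = u - h *\<^sub>R e"
  have cu': "cone q' u'"
  proof (rule coneI[OF _ _ q(2)])
    have "g q' u' u' = g q' u u - 2 * h * g q' u e + h^2 * g q' e e"
      using sym[OF q(2), of e u] by (simp add: u'_def g_lin power2_eq_square algebra_simps)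
    moreover have "- 2 * h * g q' u e \<le> 2 * C * h * norm u"
    proof -
      have "- g q' u e \<le> C * norm u" using bd[OF q(2), of u e] norm_e by simp
      then have "2 * h * (- g q' u e) \<le> 2 * h * (C * norm u)" using h0 by (intro mult_left_mono) auto
      moreover have "2 * h * (- g q' u e) = - 2 * h * g q' u e" by simp
      moreover have "2 * h * (C * norm u) = 2 * C * h * norm u" by simp
      ultimately show ?thesis by linarith
    qed
    moreover have "h^2 * g q' e e \<le> 0" using e_time[OF q(2)] by (simp add: mult_nonneg_nonpos)
    ultimately show "g q' u' u' \<le> 0" using hu1 fsq by linarith
    have "g q' u' e = g q' u e - h * g q' e e" by (simp add: u'_def g_lin)
    also have "\<dots> \<le> - (m * norm u) + h * C"
      using fc_low[OF q(2) u] mult_left_mono[OF gee(2)[OF q(2)] h0] by simp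
    finally show "g q' u' e \<le> 0" using hu2 by (simp add: algebra_simps)
  qed
  have nu': "norm u' \<ge> norm u / 2" "norm u' \<le> 2 * norm u"
    using norm_triangle_ineq2[of u "h *\<^sub>R e"] norm_triangle_ineq4[of u "h *\<^sub>R e"] norm_e h0 hu3
    by (auto simp: u'_def)
  then have "u' \<noteq> 0" using un by auto
  then have fu': "fc q' u'" using cu' by (simp add: cone_def)
  have a0: "0 \<le> \<xi> * ?l" using xi l by simp
  have "\<xi> * ?l \<le> \<xi> * (C * norm u)" using lam_abs[of u] xi(3) by (intro mult_left_mono) auto
  also have "\<dots> \<le> norm u / 2" using mult_right_mono[OF xi(2), of "norm u"] by (simp add: algebra_simps)
  finally have a1: "\<xi> * ?l \<le> norm u'" using nu' by linarith
  have "4 * C * norm (q' - q) * norm u' \<le> 4 * C * d * (2 * norm u)"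
    using d C_ge nu' order_trans[OF norm_ge_zero d] by (intro mult_mono) auto
  also have "\<dots> = (16 * C * d) * (norm u / 2)" by simp
  also have "\<dots> \<le> (m^2 * \<xi>) * (norm u / 2)" by (intro mult_right_mono xi) simp
  also have "\<dots> = m * \<xi> * (m / 2 * norm u)" by (simp add: power2_eq_square)
  also have "\<dots> \<le> m * \<xi> * ?l" using l(1) m_pos xi by (intro mult_left_mono) auto
  finally have d': "4 * C * norm (q' - q) * norm u' \<le> m * (\<xi> * ?l)" by simp
  \<comment> \<open>The tilt \<open>\<xi> * ?l\<close> pays for replacing the base point
    \<open>q'\<close> by the common point \<open>q\<close>; having all vectors in one cone is what
    permits summation along the curve.\<close>
  have c1: "cone q (u' + (\<xi> * ?l) *\<^sub>R e)" using push(1)[OF q(2,1) fu' a0 a1 d'] by (simp add: cone_def)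
  have "2 * \<delta> * ?f - \<delta>^2 * ?l \<le> ?f^2 / ?l"
  proof -
    have "0 \<le> (?f - \<delta> * ?l)^2" by simp
    then have "(2 * \<delta> * ?f - \<delta>^2 * ?l) * ?l \<le> ?f^2" by (simp add: power2_eq_square algebra_simps)
    then show ?thesis using l(2) by (simp add: le_divide_eq)
  qed
  then have "chc * (2 * \<delta> * ?f - \<delta>^2 * ?l) \<le> chc * (?f^2 / ?l)" using chc_pos by (intro mult_left_mono) auto
  then have "0 \<le> h - chc * (2 * \<delta> * ?f - \<delta>^2 * ?l)" by (simp add: h_def)
  then have "cone q ((h - chc * (2 * \<delta> * ?f - \<delta>^2 * ?l)) *\<^sub>R e)" by (intro cone_scale cone_e q)
  from cone_add[OF q(1) c1 this] show ?thesis by (simp add: u'_def algebra_simps)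
qed

text \<open>Tangent vector of a curve after dilating it by \<open>1 - \<theta>\<close> towards its initial point and moving the endpoint
  from the dilated position to \<open>y - h * e\<close>; the room comes from the uniformly timelike chord \<open>D\<close>.\<close>

lemma chord_dilate:
  assumes q: "q \<in> B" "q' \<in> B" and u: "fc q u" and L: "0 < \<Lambda>" and eta: "0 < \<eta>" "\<eta> \<le> 1" and h: "0 \<le> h" "4 * h \<le> \<eta> * \<Lambda>" 
    and \<omega>: "cone q (D - (\<eta> * \<Lambda>) *\<^sub>R e)" and D: "norm D \<le> (2/m) * \<Lambda>"
    and h2: "2 * C^2 * h \<le> m * \<Lambda>" and d: "norm (q - q') \<le> 9 * h / (m * \<eta>)" and L2: "216 * C^2 * \<Lambda> \<le> m^4 * \<eta>"
  defines "\<theta> \<equiv> 2 * h / (\<eta> * \<Lambda>)"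
  shows "fc q' ((1 - \<theta>) *\<^sub>R u + (lam u / \<Lambda>) *\<^sub>R (\<theta> *\<^sub>R D - h *\<^sub>R e))"
    "F q' ((1 - \<theta>) *\<^sub>R u + (lam u / \<Lambda>) *\<^sub>R (\<theta> *\<^sub>R D - h *\<^sub>R e)) \<ge> (1 - \<theta>) * F q u"
proof -
  let ?l = "lam u"
  have l: "?l \<ge> (m/2) * norm u" "?l > 0" using fc_lam[OF q(1) u] by auto
  have lC: "?l \<le> C * norm u" using lam_abs[of u] by simp
  have un: "norm u > 0" using u by (simp add: fc_def)
  have th: "0 \<le> \<theta>" "\<theta> \<le> 1/2" using h eta L by (auto simp: \<theta>_def divide_le_eq)
  \<comment> \<open>Dilation by \<open>1 - \<theta>\<close> frees room \<open>2 * h\<close> along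
    \<open>e\<close>: one \<open>h\<close> is spent on lowering the end point, the other becomes the
    margin \<open>a\<close> against the change of base point.\<close>
  have thh: "\<theta> * \<eta> * \<Lambda> = 2 * h" using eta L by (simp add: \<theta>_def)
  define w where "w = (\<theta> * ?l / \<Lambda>) *\<^sub>R (D - (\<eta> * \<Lambda>) *\<^sub>R e)"
  define u1 where "u1 = (1 - \<theta>) *\<^sub>R u + w"
  define a where "a = ?l * h / \<Lambda>"
  have cw: "cone q w" unfolding w_def by (intro cone_scale q \<omega>) (use th l L in auto)
  have eq: "(1 - \<theta>) *\<^sub>R u + (?l / \<Lambda>) *\<^sub>R (\<theta> *\<^sub>R D - h *\<^sub>R e) = u1 + a *\<^sub>R e"
  proof -
    have "(\<theta> * ?l / \<Lambda>) * (\<eta> * \<Lambda>) = 2 * a" 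
    proof -
      have "(\<theta> * ?l / \<Lambda>) * (\<eta> * \<Lambda>) = (?l / \<Lambda>) * (\<theta> * \<eta> * \<Lambda>)" by simp
      then show ?thesis unfolding thh a_def by simp
    qed
    then have "w = (\<theta> * ?l / \<Lambda>) *\<^sub>R D - (2 * a) *\<^sub>R e" by (simp add: w_def scaleR_diff_right)
    then show ?thesis unfolding u1_def a_def by (simp add: scaleR_diff_right algebra_simps scaleR_2[symmetric])
  qed
  have cu: "cone q u" using u by (simp add: cone_def)
  have guu: "- g q u1 u1 \<ge> (1 - \<theta>)^2 * (- g q u u)"
  proof -
    have "g q u1 u1 = (1 - \<theta>)^2 * g q u u + 2 * ((1 - \<theta>) * g q u w) + g q w w"
      using sym[OF q(1), of w u] by (simp add: u1_def g_lin power2_eq_square algebra_simps)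
    moreover have "(1 - \<theta>) * g q u w \<le> 0" using th cone_prod[OF q(1) cu cw] by (intro mult_nonneg_nonpos) auto
    ultimately show ?thesis using cone_self(1)[OF cw] by simp
  qed
  have ge: "- g q u1 e \<ge> m * norm u / 2"
  proof -
    have "(1/2) * (m * norm u) \<le> (1 - \<theta>) * (- g q u e)"
      using th fc_low[OF q(1) u] m_pos by (intro mult_mono) auto
    then show ?thesis using cone_self(2)[OF cw] by (simp add: u1_def g_lin)
  qed
  have pos: "m * norm u > 0" using m_pos un by simp
  have fu1: "fc q u1"
  proof -
    have "(1 - \<theta>)^2 * (- g q u u) \<ge> 0" using cone_self(1)[OF cu] by (intro mult_nonneg_nonneg) auto
    moreover have "g q u1 e < 0" using ge pos by linarith
    ultimately show ?thesis using guu by (auto simp: fc_def)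
  qed
  have low1: "m * norm u \<le> 2 * C * norm u1"
    using ge bd[OF q(1), of u1 e] norm_e by simp
  have up1: "norm u1 \<le> (3 * C / m) * norm u"
  proof -
    have D': "norm (D - (\<eta> * \<Lambda>) *\<^sub>R e) \<le> (2/m + 1) * \<Lambda>"
    proof -
      have "norm (D - (\<eta> * \<Lambda>) *\<^sub>R e) \<le> norm D + \<eta> * \<Lambda>"
        using norm_triangle_ineq4[of D "(\<eta> * \<Lambda>) *\<^sub>R e"] norm_e eta L by simp
      moreover have "\<eta> * \<Lambda> \<le> \<Lambda>" using eta L by simp
      ultimately show ?thesis using D by (simp add: algebra_simps)
    qed
    have "norm w = (\<theta> * ?l / \<Lambda>) * norm (D - (\<eta> * \<Lambda>) *\<^sub>R e)"
      using th l L by (simp add: w_def abs_mult)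
    also have "\<dots> \<le> (\<theta> * ?l / \<Lambda>) * ((2/m + 1) * \<Lambda>)" using D' th l L by (intro mult_left_mono) auto
    also have "\<dots> = \<theta> * ?l * (2/m + 1)" using L by simp
    also have "\<dots> \<le> (1/2) * (C * norm u) * (2/m + 1)" 
      using th lC l m_pos by (intro mult_mono) auto
    also have "\<dots> = (C/m + C/2) * norm u" by (simp add: algebra_simps)
    finally have nw: "norm w \<le> (C/m + C/2) * norm u" .
    have "norm u1 \<le> norm ((1 - \<theta>) *\<^sub>R u) + norm w" unfolding u1_def by (rule norm_triangle_ineq)
    also have "\<dots> \<le> norm u + (C/m + C/2) * norm u"
      using nw th mult_right_mono[of "\<bar>1 - \<theta>\<bar>" 1 "norm u"] by simp
    also have "\<dots> = (1 + (C/m + C/2)) * norm u" by (simp add: algebra_simps)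
    also have "\<dots> \<le> (3 * C / m) * norm u"
    proof (rule mult_right_mono)
      have "1 \<le> C/m" using m_le_C m_pos by simp
      moreover have "C/2 \<le> C/m" using m_le m_pos C_ge by (intro divide_left_mono) auto
      ultimately show "1 + (C/m + C/2) \<le> 3 * C / m" by simp
    qed simp
    finally show ?thesis .
  qed
  have a0: "0 \<le> a" using l h L by (simp add: a_def)
  have a1: "a \<le> norm u1"
  proof -
    have "2 * C * a * \<Lambda> = 2 * C * h * ?l" using L by (simp add: a_def)
    also have "\<dots> \<le> 2 * C * h * (C * norm u)" using lC h C_ge by (intro mult_left_mono) auto
    also have "\<dots> = (2 * C^2 * h) * norm u" by (simp add: power2_eq_square)
    also have "\<dots> \<le> m * \<Lambda> * norm u" by (intro mult_right_mono h2) simp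
    also have "\<dots> = (m * norm u) * \<Lambda>" by simp
    also have "\<dots> \<le> (2 * C * norm u1) * \<Lambda>" using low1 L by (intro mult_right_mono) auto
    finally show ?thesis using L C_ge by simp
  qed
  have d': "4 * C * norm (q - q') * norm u1 \<le> m * a"
  proof -
    have "4 * C * norm (q - q') * norm u1 \<le> 4 * C * (9 * h / (m * \<eta>)) * ((3 * C / m) * norm u)"
      using d up1 C_ge order_trans[OF norm_ge_zero d] h eta m_pos by (intro mult_mono) auto
    also have "\<dots> = (216 * C^2 * \<Lambda>) * (h * norm u / (2 * m^2 * \<eta> * \<Lambda>))"
      using L m_pos eta by (simp add: power2_eq_square field_simps)
    also have "\<dots> \<le> (m^4 * \<eta>) * (h * norm u / (2 * m^2 * \<eta> * \<Lambda>))"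
      using L2 h L eta by (intro mult_right_mono) auto
    also have "\<dots> = m * (h / \<Lambda>) * ((m / 2) * norm u)"
      using L m_pos eta by (simp add: power2_eq_square power4_eq_xxxx field_simps)
    also have "\<dots> \<le> m * (h / \<Lambda>) * ?l" using l h L m_pos by (intro mult_left_mono) auto
    finally show ?thesis by (simp add: a_def algebra_simps)
  qed
  note p = push[OF q fu1 a0 a1 d']
  show "fc q' ((1 - \<theta>) *\<^sub>R u + (lam u / \<Lambda>) *\<^sub>R (\<theta> *\<^sub>R D - h *\<^sub>R e))" unfolding eq by (rule p)
  have "((1 - \<theta>) * F q u)^2 = (1 - \<theta>)^2 * (- g q u u)"
    using F_sq(1)[OF cu] by (simp add: power_mult_distrib)
  also have "\<dots> \<le> - g q' (u1 + a *\<^sub>R e) (u1 + a *\<^sub>R e)"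
  proof -
    have "0 \<le> a * m * norm u1" using a0 m_pos by simp
    then show ?thesis using p(2) guu by linarith
  qed
  finally show "F q' ((1 - \<theta>) *\<^sub>R u + (lam u / \<Lambda>) *\<^sub>R (\<theta> *\<^sub>R D - h *\<^sub>R e)) \<ge> (1 - \<theta>) * F q u"
    unfolding eq by (rule F_ge)
qed

end

section \<open>Good chart balls\<close>

lemma matrix_vector_norm_le:
  fixes M :: "real^'n^'m::finite"
  shows "norm (M *v w) \<le> real CARD('m) * norm M * norm w"
proof -
  have "norm (M *v w) \<le> (\<Sum>i\<in>UNIV. \<bar>(M *v w) $ i\<bar>)" by (rule norm_le_l1_cart)
  also have "\<dots> \<le> (\<Sum>i\<in>(UNIV::'m set). norm M * norm w)"
  proof (rule sum_mono)
    fix i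
    have "(M *v w) $ i = M $ i \<bullet> w" by (simp add: matrix_vector_mult_def inner_vec_def)
    then have "\<bar>(M *v w) $ i\<bar> \<le> norm (M $ i) * norm w" using Cauchy_Schwarz_ineq2 by metis
    also have "\<dots> \<le> norm M * norm w" by (intro mult_right_mono Finite_Cartesian_Product.norm_nth_le) simp
    finally show "\<bar>(M *v w) $ i\<bar> \<le> norm M * norm w" .
  qed
  also have "\<dots> = real CARD('m) * norm M * norm w" by simp
  finally show ?thesis .
qed

lemma bform_bound: 
  fixes M :: "real^'n^'n::finite" 
  shows "\<bar>bform M v w\<bar> \<le> real CARD('n) * norm M * norm v * norm w"
proof -
  have "\<bar>bform M v w\<bar> \<le> norm v * norm (M *v w)" unfolding bform_def by (rule Cauchy_Schwarz_ineq2)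
  also have "\<dots> \<le> norm v * (real CARD('n) * norm M * norm w)"
    by (intro mult_left_mono matrix_vector_norm_le) simp
  finally show ?thesis by (simp add: algebra_simps)
qed

lemma bform_sym:
  assumes "transpose M = M" shows "bform M v w = bform M w v"
  unfolding bform_def by (metis assms dot_lmul_matrix inner_commute vector_transpose_matrix)

lemma bform_matrix_diff: "bform (M - N) v w = bform M v w - bform N v w"
  by (simp add: bform_def matrix_vector_mult_diff_rdistrib inner_diff_right)

lemma lorentzian_timelike_causal:
  assumes M: "lorentzian_form M" and e: "bform M e e < 0" and w: "w \<noteq> 0" "bform M w w \<le> 0"
  shows "bform M w e \<noteq> 0"
proof
  assume we: "bform M w e = 0"
  have sy: "transpose M = M" using M by (simp add: lorentzian_form_def)
  have ew: "bform M e w = 0" using bform_sym[OF sy] we by simp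
  obtain v where v: "bform M v v < 0" "\<And>u. u \<noteq> 0 \<Longrightarrow> bform M v u = 0 \<Longrightarrow> bform M u u > 0"
    using M by (auto simp: lorentzian_form_def)
  \<comment> \<open>A vector of the span of \<open>e\<close> and \<open>w\<close> that is orthogonal
    to \<open>v\<close>. The form is nonpositive on this span, but positive on nonzero vectors
    orthogonal to \<open>v\<close>, so \<open>u\<close> vanishes.\<close>
  define u where "u = bform M v w *\<^sub>R e - bform M v e *\<^sub>R w"
  have u': "u = bform M v w *\<^sub>R e + (- bform M v e) *\<^sub>R w" by (simp add: u_def)
  have "bform M v u = 0" unfolding u' bform_linear by simp
  have "bform M u u = (bform M v w)^2 * bform M e e + (bform M v e)^2 * bform M w w"
    unfolding u' bform_linear bform_minus by (simp add: ew we power2_eq_square)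
  also have "\<dots> \<le> 0" using e w by (intro add_nonpos_nonpos mult_nonneg_nonpos) auto
  finally have "u = 0" using v(2)[OF _ \<open>bform M v u = 0\<close>] by force
  then have eq: "bform M v w *\<^sub>R e = bform M v e *\<^sub>R w" by (simp add: u_def)
  have "bform M (bform M v w *\<^sub>R e) e = bform M (bform M v e *\<^sub>R w) e" using eq by simp
  then have "bform M v w * bform M e e = 0" by (simp only: bform_linear we mult_zero_right)
  then have vw: "bform M v w = 0" using e by simp
  with v(2)[OF w(1) vw] w(2) show False by simp
qed

lemma metric_patch_subset:
  assumes "metric_patch g B e o\<^sub>c m C" "B' \<subseteq> B" "o\<^sub>c \<in> B'"
  shows "metric_patch g B' e o\<^sub>c m C"
  using assms unfolding metric_patch_def by (meson subsetD)

text \<open>Curves live in the ball of radius \<open>R\<close> and their deformations in the one of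
  radius \<open>2 * R\<close>. The vector \<open>e\<close> replaces the time orientation through
  \<open>fcv_fc\<close>, and \<open>R_small\<close> makes the tilt needed for a translation small
  compared with the translation itself.\<close>

locale good_patch = spacetime_ctx A G T + metric_patch "spacetime_ctx.gform G c" "cball o\<^sub>c (2 * R)" e o\<^sub>c m C
  for A :: "('a::{t2_space,second_countable_topology}, 'n::finite) chart set"
    and G :: "('a,'n) chart \<Rightarrow> 'a \<Rightarrow> real^'n^'n"
    and T :: "('a,'n) chart \<Rightarrow> 'a \<Rightarrow> real^'n" and c o\<^sub>c R e m C +
  assumes cA: "c \<in> A" and R_pos: "R > 0" and sub: "cball o\<^sub>c (2 * R) \<subseteq> snd c ` fst c"
    and fcv_fc: "y \<in> cball o\<^sub>c (2 * R) \<Longrightarrow> spacetime_ctx.fcv G T c y v \<longleftrightarrow> metric_patch.fc (spacetime_ctx.gform G c) e y v"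
    and R_small: "64 * C^2 * R \<le> m^2"

lemma good_patch_shrink:
  assumes "good_patch A G T c o\<^sub>c R e m C" "0 < R'" "R' \<le> R"
  shows "good_patch A G T c o\<^sub>c R' e m C"
proof -
  interpret good_patch A G T c o\<^sub>c R e m C by fact
  have s: "cball o\<^sub>c (2 * R') \<subseteq> cball o\<^sub>c (2 * R)" using assms(3) by (intro subset_cball) simp
  have mp: "metric_patch (gform c) (cball o\<^sub>c (2 * R')) e o\<^sub>c m C"
    by (rule metric_patch_subset[OF metric_patch_axioms s]) (use assms(2) in simp)
  show ?thesis
  proof (intro good_patch.intro mp good_patch_axioms.intro)
    show "spacetime_ctx A G T" by unfold_locales
    show "c \<in> A" by (rule cA)
    show "0 < R'" by fact
    show "cball o\<^sub>c (2 * R') \<subseteq> snd c ` fst c" using s sub by blast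
    show "fcv c y v \<longleftrightarrow> fc y v" if "y \<in> cball o\<^sub>c (2 * R')" for y v
      using fcv_fc s that by blast
    have "64 * C^2 * R' \<le> 64 * C^2 * R" using assms(3) by (intro mult_left_mono) auto
    then show "64 * C^2 * R' \<le> m^2" using R_small by linarith
  qed
qed

context spacetime_ctx
begin

lemma good_patch_exists:
  assumes p: "p \<in> fst c" "c \<in> A"
  shows "\<exists>R e m C. good_patch A G T c (snd c p) R e m C"
proof -
  let ?o = "snd c p" and ?M = "\<lambda>y. G c (cinv c y)" and ?T = "\<lambda>y. T c (cinv c y)"
  have lor: "lorentzian_form (?M y)" if "y \<in> cdom c" for y
    using metric p(2) cinv_in[OF p(2) that] unfolding lorentz_metric_def by blast
  have Tt: "bform (?M y) (?T y) (?T y) < 0" if "y \<in> cdom c" for y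
    using orient p(2) cinv_in[OF p(2) that] unfolding time_orientation_def by blast
  have od: "?o \<in> cdom c" using p by blast
  define T0 where "T0 = ?T ?o"
  have T0: "T0 \<noteq> 0" using Tt[OF od] by (auto simp: T0_def bform_linear)
  define e where "e = (1 / norm T0) *\<^sub>R T0"
  have ne: "norm e = 1" using T0 by (simp add: e_def)
  have contM: "continuous_on (cdom c) ?M" by (rule continuous_G[OF p(2)])
  have contT: "continuous_on (cdom c) ?T" 
    using orient p(2) unfolding time_orientation_def cinv_def by blast
  have cdo: "open (cdom c)" by (rule chart_open(2)[OF p(2)])
  have ge: "gform c ?o e e < 0"
    using Tt[OF od] T0 unfolding gform_def e_def by (simp add: bform_linear T0_def divide_neg_pos)
  have conte: "continuous_on (cdom c) (\<lambda>y. gform c y e e)"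
    unfolding gform_def by (intro continuous_on_bform contM continuous_on_const)
  have "open (cdom c \<inter> (\<lambda>y. gform c y e e) -` {..<0})"
    by (rule continuous_open_preimage[OF conte cdo]) simp
  moreover have "?o \<in> cdom c \<inter> (\<lambda>y. gform c y e e) -` {..<0}" using od ge by auto
  ultimately obtain r1 where r1: "r1 > 0" "cball ?o r1 \<subseteq> cdom c \<inter> (\<lambda>y. gform c y e e) -` {..<0}"
    unfolding open_contains_cball by blast
  have r1d: "cball ?o r1 \<subseteq> cdom c" using r1(2) by blast
  \<comment> \<open>The minimum over the compact set of unit causal vectors at points of the ball;
    it is positive since a causal vector is never orthogonal to a timelike one, and the set contains
    \<open>(?o, e)\<close>.\<close>
  obtain m0 where m0: "m0 > 0" "\<And>y v. y \<in> cball ?o r1 \<Longrightarrow> norm v = 1 \<Longrightarrow> gform c y v v \<le> 0 \<Longrightarrow> \<bar>gform c y v e\<bar> \<ge> m0"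
  proof -
    let ?D = "cball ?o r1 \<times> sphere (0::real^'n) 1"
    have cD: "compact ?D" by (intro compact_Times compact_cball compact_sphere)
    have cM: "continuous_on ?D (\<lambda>z. ?M (fst z))"
      by (rule continuous_on_compose2[OF contM]) (use r1d in \<open>auto intro: continuous_intros\<close>)
    have c1: "continuous_on ?D (\<lambda>z. gform c (fst z) (snd z) (snd z))"
      unfolding gform_def by (intro continuous_on_bform cM continuous_intros)
    have c2: "continuous_on ?D (\<lambda>z. \<bar>gform c (fst z) (snd z) e\<bar>)"
      unfolding gform_def by (intro continuous_on_bform cM continuous_intros)
    let ?E = "?D \<inter> (\<lambda>z. gform c (fst z) (snd z) (snd z)) -` {..0}"
    have "closed ?E" by (rule continuous_closed_preimage[OF c1]) (auto intro: compact_imp_closed cD)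
    then have "compact ?E" using compact_Int_closed[OF cD, of ?E] by (simp add: Int_assoc[symmetric])
    moreover have "continuous_on ?E (\<lambda>z. \<bar>gform c (fst z) (snd z) e\<bar>)" by (rule continuous_on_subset[OF c2]) simp
    moreover have "?E \<noteq> {}"
      using ne r1 ge by (intro ex_in_conv[THEN iffD1] exI[of _ "(?o, e)"]) auto
    ultimately have "\<exists>z\<in>?E. \<forall>w\<in>?E. \<bar>gform c (fst z) (snd z) e\<bar> \<le> \<bar>gform c (fst w) (snd w) e\<bar>"
      by (intro continuous_attains_inf)
    then obtain z where z: "z \<in> ?E" "\<And>w. w \<in> ?E \<Longrightarrow> \<bar>gform c (fst z) (snd z) e\<bar> \<le> \<bar>gform c (fst w) (snd w) e\<bar>"
      by blast
    have zz: "fst z \<in> cball ?o r1" "norm (snd z) = 1" "gform c (fst z) (snd z) (snd z) \<le> 0" using z(1) by auto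
    have "gform c (fst z) (snd z) e \<noteq> 0"
      unfolding gform_def
    proof (rule lorentzian_timelike_causal[OF lor])
      show "fst z \<in> cdom c" using zz r1d by blast
      show "bform (G c (cinv c (fst z))) e e < 0" using zz r1(2) by (auto simp: gform_def)
      show "snd z \<noteq> 0" using zz by auto
      show "bform (G c (cinv c (fst z))) (snd z) (snd z) \<le> 0" using zz by (simp add: gform_def)
    qed
    then have "\<bar>gform c (fst z) (snd z) e\<bar> > 0" by simp
    moreover have "\<bar>gform c y v e\<bar> \<ge> \<bar>gform c (fst z) (snd z) e\<bar>" 
      if "y \<in> cball ?o r1" "norm v = 1" "gform c y v v \<le> 0" for y v
    proof -
      have "(y, v) \<in> ?E" using that by auto
      from z(2)[OF this] show ?thesis by simp
    qed
    ultimately show ?thesis using that by blast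
  qed
  have smG: "smooth_on (cdom c) ?M" using metric p(2) unfolding lorentz_metric_def cinv_def by blast
  obtain K where K: "K > 0" "\<And>y z. y \<in> cball ?o r1 \<Longrightarrow> z \<in> cball ?o r1 \<Longrightarrow> norm (?M y - ?M z) \<le> K * norm (y - z)"
    using smooth_on_Lipschitz[OF smG r1d] by blast
  have "compact (?M ` cball ?o r1)"
    by (intro compact_continuous_image compact_cball continuous_on_subset[OF contM r1d])
  then have "bounded (?M ` cball ?o r1)" by (rule compact_imp_bounded)
  then obtain K2 where K2: "\<And>y. y \<in> cball ?o r1 \<Longrightarrow> norm (?M y) \<le> K2"
    unfolding bounded_iff by blast
  define N where "N = real CARD('n)"
  have N: "N \<ge> 1" by (simp add: N_def Suc_leI)
  define C where "C = N * (1 + K + \<bar>K2\<bar>)"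
  have C: "C \<ge> 1" "N * K \<le> C" "N * K2 \<le> C"
  proof -
    have "1 * 1 \<le> N * (1 + K + \<bar>K2\<bar>)" using N K by (intro mult_mono) auto
    then show "C \<ge> 1" by (simp add: C_def)
    show "N * K \<le> C" "N * K2 \<le> C" unfolding C_def using N K by (intro mult_left_mono; simp)+
  qed
  have lipg: "\<bar>gform c y v w - gform c y' v w\<bar> \<le> C * norm (y - y') * norm v * norm w"
    if "y \<in> cball ?o r1" "y' \<in> cball ?o r1" for y y' v w
  proof -
    have "\<bar>gform c y v w - gform c y' v w\<bar> = \<bar>bform (?M y - ?M y') v w\<bar>"
      by (simp add: gform_def bform_matrix_diff)
    also have "\<dots> \<le> N * norm (?M y - ?M y') * norm v * norm w" unfolding N_def by (rule bform_bound)
    also have "\<dots> \<le> N * (K * norm (y - y')) * norm v * norm w"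
      using K(2)[OF that] N by (intro mult_right_mono mult_left_mono) auto
    also have "\<dots> = (N * K) * (norm (y - y') * norm v * norm w)" by simp
    also have "\<dots> \<le> C * (norm (y - y') * norm v * norm w)" using C by (intro mult_right_mono) auto
    finally show ?thesis by (simp add: mult.assoc)
  qed
  have bdg: "\<bar>gform c y v w\<bar> \<le> C * norm v * norm w" if "y \<in> cball ?o r1" for y v w
  proof -
    have "\<bar>gform c y v w\<bar> \<le> N * norm (?M y) * norm v * norm w" unfolding N_def gform_def by (rule bform_bound)
    also have "\<dots> \<le> N * K2 * norm v * norm w"
      using K2[OF that] N by (intro mult_right_mono mult_left_mono) auto
    also have "\<dots> \<le> C * norm v * norm w" using C by (intro mult_right_mono) auto
    finally show ?thesis .
  qed
  define m where "m = min m0 1"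
  have m: "m > 0" "m \<le> 1" "m \<le> m0" using m0 by (auto simp: m_def)
  have lowg: "\<bar>gform c y v e\<bar> \<ge> m * norm v" if "y \<in> cball ?o r1" "gform c y v v \<le> 0" for y v
  proof (cases "v = 0")
    case False
    let ?v = "(1 / norm v) *\<^sub>R v"
    have "gform c y ?v ?v \<le> 0" using that(2) by (simp add: gform_def bform_linear divide_nonpos_nonneg)
    then have "m0 \<le> \<bar>gform c y ?v e\<bar>" using False by (intro m0 that) auto
    also have "\<dots> = \<bar>gform c y v e\<bar> / norm v" by (simp add: gform_def bform_linear abs_mult)
    finally have "m0 * norm v \<le> \<bar>gform c y v e\<bar>" using False by (simp add: field_simps)
    then show ?thesis using m mult_right_mono[of m m0 "norm v"] by simp
  qed (simp add: gform_def bform_linear)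
  \<comment> \<open>The rescaled orientation field equals \<open>e\<close> at the centre. Where it
    is within \<open>m / (2 * C)\<close> of \<open>e\<close>, its product with a causal
    \<open>v\<close> differs from that of \<open>e\<close> by less than half the lower bound
    \<open>m * norm v\<close>, so the signs agree.\<close>
  let ?S = "\<lambda>y. (1 / norm T0) *\<^sub>R ?T y"
  have contS: "continuous_on (cdom c) ?S" by (intro continuous_intros contT)
  have "open (cdom c \<inter> ?S -` ball e (m / (2 * C)))"
    by (rule continuous_open_preimage[OF contS cdo]) simp
  moreover have "?o \<in> cdom c \<inter> ?S -` ball e (m / (2 * C))" using od m C(1) by (simp add: e_def T0_def)
  ultimately obtain r2 where r2: "r2 > 0" "cball ?o r2 \<subseteq> cdom c \<inter> ?S -` ball e (m / (2 * C))"
    unfolding open_contains_cball by blast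
  \<comment> \<open>The first two bounds stay in the balls found above, the third yields the
    smallness condition of \<open>metric_patch\<close>, the fourth \<open>R_small\<close>.\<close>
  define R where "R = Min {r1/2, r2/2, m / (4 * C), m^2 / (64 * C^2)}"
  have R: "R > 0" "2 * R \<le> r1" "2 * R \<le> r2" "R \<le> m / (4 * C)" "R \<le> m^2 / (64 * C^2)"
    using r1 r2 m C(1) by (auto simp: R_def)
  let ?B = "cball ?o (2 * R)"
  have Bs: "?B \<subseteq> cball ?o r1" "?B \<subseteq> cball ?o r2" using R by (auto intro: subset_cball)
  have mp: "metric_patch (gform c) ?B e ?o m C"
  proof
    fix y assume y: "y \<in> ?B"
    have "y \<in> cdom c" using y Bs r1d by blast
    then have "transpose (?M y) = ?M y" using lor unfolding lorentzian_form_def by blast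
    then show "gform c y v w = gform c y w v" for v w unfolding gform_def by (rule bform_sym)
    show "\<bar>gform c y v w - gform c y' v w\<bar> \<le> C * norm (y - y') * norm v * norm w" if "y' \<in> ?B" for y' v w
      using lipg y that Bs by blast
    show "\<bar>gform c y v w\<bar> \<le> C * norm v * norm w" for v w using bdg y Bs by blast
    show "m * norm v \<le> \<bar>gform c y v e\<bar>" if "gform c y v v \<le> 0" for v using lowg y Bs that by blast
    show "gform c y e e < 0" using y Bs r1(2) by blast
    have "C * norm (y - ?o) \<le> C * (2 * R)" using y C(1) by (intro mult_left_mono) (auto simp: dist_norm norm_minus_commute)
    also have "\<dots> \<le> C * (2 * (m / (4 * C)))" using R C(1) by (intro mult_left_mono) auto
    also have "\<dots> = m / 2" using C(1) by simp
    finally show "C * norm (y - ?o) \<le> m / 2" .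
  qed (use ne m C R in \<open>auto simp: gform_def bform_linear\<close>)
  have fce: "fcv c y v \<longleftrightarrow> metric_patch.fc (gform c) e y v" if y: "y \<in> ?B" for y v
  proof -
    have "y \<in> cdom c \<inter> ?S -` ball e (m / (2 * C))" using y Bs(2) r2(2) by blast
    then have dS: "norm (?S y - e) < m / (2 * C)" by (simp add: dist_norm norm_minus_commute)
    have "gform c y v (?T y) < 0 \<longleftrightarrow> gform c y v e < 0" if v: "v \<noteq> 0" "gform c y v v \<le> 0"
    proof -
      have nv: "norm v > 0" using v by simp
      have "\<bar>gform c y v (?S y - e)\<bar> \<le> C * norm v * norm (?S y - e)" using bdg y Bs by blast
      also have "\<dots> < C * norm v * (m / (2 * C))" using dS C(1) nv by (intro mult_strict_left_mono) auto
      also have "\<dots> = m * norm v / 2" using C(1) by simp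
      finally have 1: "\<bar>gform c y v (?S y - e)\<bar> < m * norm v / 2" .
      have 2: "\<bar>gform c y v e\<bar> \<ge> m * norm v" using lowg y Bs v by blast
      have "?S y = (?S y - e) + e" by simp
      then have 3: "gform c y v (?S y) = gform c y v (?S y - e) + gform c y v e"
        unfolding gform_def by (metis bform_linear(2))
      have 4: "gform c y v (?S y) = (1 / norm T0) * gform c y v (?T y)" by (simp add: gform_def bform_linear)
      have "gform c y v (?T y) < 0 \<longleftrightarrow> gform c y v (?S y) < 0" unfolding 4 using T0 by (simp add: divide_less_0_iff)
      then show ?thesis using 1 2 3 by linarith
    qed
    then show ?thesis
      unfolding fcv_def fut_causal_vec_def metric_patch.fc_def[OF mp] gform_def by blast
  qed
  have "good_patch A G T c ?o R e m C"
  proof (intro good_patch.intro mp good_patch_axioms.intro)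
    show "spacetime_ctx A G T" by unfold_locales
    show "c \<in> A" "0 < R" using p R by auto
    show "?B \<subseteq> snd c ` fst c" using Bs r1d by blast
    show "fcv c y v \<longleftrightarrow> metric_patch.fc (gform c) e y v" if "y \<in> ?B" for y v by (rule fce[OF that])
    show "64 * C^2 * R \<le> m^2" using R(5) C(1) by (simp add: field_simps)
  qed
  then show ?thesis by blast
qed

end

section \<open>Deforming chains inside a chart ball\<close>

lemma linear_functional_inner:
  fixes f :: "'v::euclidean_space \<Rightarrow> real"
  assumes "\<And>u v. f (u + v) = f u + f v" "\<And>a v. f (a *\<^sub>R v) = a * f v"
  obtains a where "\<And>v. f v = a \<bullet> v"
proof -
  have "linear f" using assms by (intro linearI) auto
  then have "f v = adjoint f 1 \<bullet> v" for v using adjoint_works[of f v 1] by (simp add: inner_commute)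
  then show ?thesis using that by blast
qed

context good_patch
begin

lemma gspeed_F: "gspeed c y v = F y v"
  by (simp add: gspeed_def F_def)

abbreviation reg :: "real \<Rightarrow> 'a set" where "reg r \<equiv> cinv c ` cball o\<^sub>c r"

lemma reg_fst: "r \<le> 2 * R \<Longrightarrow> reg r \<subseteq> fst c"
proof
  fix x assume "r \<le> 2 * R" "x \<in> reg r"
  then have "x \<in> reg (2 * R)" by auto
  then show "x \<in> fst c" using sub cinv_in[OF cA] by blast
qed

lemma snd_reg: "r \<le> 2 * R \<Longrightarrow> x \<in> reg r \<Longrightarrow> snd c x \<in> cball o\<^sub>c r"
proof -
  assume r: "r \<le> 2 * R" and "x \<in> reg r"
  then obtain q where q: "q \<in> cball o\<^sub>c r" "x = cinv c q" by blast
  then have "q \<in> cdom c" using sub subset_cball[OF r, of o\<^sub>c] by blast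
  then show ?thesis using q snd_cinv[OF cA] by metis
qed

lemma reg_mono: "r \<le> r' \<Longrightarrow> reg r \<subseteq> reg r'"
  by (intro image_mono subset_cball)

lemma carc_lam:
  assumes "carc (reg (2 * R)) x y L"
  shows "(m/2) * norm (snd c y - snd c x) \<le> lam (snd c y - snd c x)"
    "L \<le> (2 * C / m) * lam (snd c y - snd c x)" "0 \<le> lam (snd c y - snd c x)"
proof -
  let ?D = "snd c y - snd c x"
  obtain l where l: "\<And>v. lam v = l \<bullet> v" using linear_functional_inner[of lam] lam_lin by metis
  have f: "q \<in> cball o\<^sub>c (2 * R)" "fc q v" if "q \<in> snd c ` reg (2 * R)" "fcv c q v" for q v
    using that snd_reg[of "2 * R"] fcv_fc by auto
  \<comment> \<open>This functional is nonnegative on future causal vectors, since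
    \<open>lam\<close> dominates half of \<open>m\<close> times the norm. Evaluated at the chord
    \<open>?D\<close> it bounds the norm of the chord, with no integral of norms involved.\<close>
  have "(l - ((m/2) / norm ?D) *\<^sub>R ?D) \<bullet> ?D + 0 * L \<ge> 0"
  proof (rule carc_linear[OF cA reg_fst _ assms])
    fix q v assume "q \<in> snd c ` reg (2 * R)" "fcv c q v"
    note f[OF this]
    then have "lam v \<ge> (m/2) * norm v" using fc_lam by blast
    moreover have "((m/2) / norm ?D) * (?D \<bullet> v) \<le> (m/2) * norm v"
    proof (cases "?D = 0")
      case False
      have "((m/2) / norm ?D) * (?D \<bullet> v) \<le> ((m/2) / norm ?D) * (norm ?D * norm v)"
        using m_pos by (intro mult_left_mono norm_cauchy_schwarz) simp
      then show ?thesis using False by simp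
    qed (use m_pos in simp)
    moreover have "(l - ((m/2) / norm ?D) *\<^sub>R ?D) \<bullet> v = lam v - ((m/2) / norm ?D) * (?D \<bullet> v)"
      by (simp only: inner_diff_left inner_scaleR_left l)
    ultimately show "0 \<le> (l - ((m/2) / norm ?D) *\<^sub>R ?D) \<bullet> v + 0 * gspeed c q v" by linarith
  qed simp
  then show "(m/2) * norm ?D \<le> lam ?D"
    by (cases "?D = 0") (auto simp: l inner_diff_left power2_norm_eq_inner[symmetric] power2_eq_square)
  then show "0 \<le> lam ?D" using m_pos by (meson divide_nonneg_nonneg less_imp_le mult_nonneg_nonneg norm_ge_zero order_trans zero_le_numeral)
  have "((2 * C / m) *\<^sub>R l) \<bullet> ?D + (-1) * L \<ge> 0"
  proof (rule carc_linear[OF cA reg_fst _ assms])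
    fix q v assume "q \<in> snd c ` reg (2 * R)" "fcv c q v"
    note f = f[OF this]
    have "F q v \<le> C * norm v" by (rule F_le[OF f(1)])
    also have "\<dots> = (2 * C / m) * ((m/2) * norm v)" using m_pos by simp
    also have "\<dots> \<le> (2 * C / m) * lam v" using fc_lam(1)[OF f] m_pos C_ge by (intro mult_left_mono) auto
    finally show "0 \<le> ((2 * C / m) *\<^sub>R l) \<bullet> v + (-1) * gspeed c q v" by (simp add: l gspeed_F)
  qed simp
  then show "L \<le> (2 * C / m) * lam ?D" by (simp add: l)
qed

lemma lam_ball:
  assumes "q \<in> cball o\<^sub>c R" "q' \<in> cball o\<^sub>c R" shows "\<bar>lam q - lam q'\<bar> \<le> 2 * C * R"
proof -
  have "norm (q - q') \<le> 2 * R" using assms dist_triangle2[of q q' o\<^sub>c] by (simp add: dist_norm norm_minus_commute)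
  then have "C * norm (q - q') \<le> C * (2 * R)" using C_ge by (intro mult_left_mono) auto
  then show ?thesis using lam_abs[of "q - q'"] by (simp add: lam_lin)
qed

text \<open>The map moves \<open>q\<close> along \<open>e\<close> by
  \<open>\<psi> + k * (lam q - lam y)\<close>: the end point is shifted by \<psi> exactly, and
  velocities receive the tilt \<open>k * lam v\<close> required by \<open>transport\<close>. The two
  cases of \<open>\<kappa>\<close> and \<beta> either keep the old length or produce length from the
  tilt alone.\<close>

lemma carc_transport:
  assumes cu: "carc (reg R) x y L" and k: "0 \<le> k" "k * C \<le> 1" "8 * C * D \<le> m^2 * k"
    and D: "\<bar>\<psi>\<bar> + k * (2 * C * R) \<le> D" "D \<le> R"
    and \<kappa>: "(\<kappa> = 1 \<and> \<beta> = 0) \<or> (\<kappa> = 0 \<and> \<beta> = sqrt (k / 2) * m / C)"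
  shows "\<exists>L'\<ge>\<kappa> * L + \<beta> * lam (snd c y - snd c x). carc (reg (2 * R)) 
    (cinv c (snd c x + (\<psi> - k * lam (snd c y - snd c x)) *\<^sub>R e)) (cinv c (snd c y + \<psi> *\<^sub>R e)) L'"
proof -
  have RR: "R \<le> 2 * R" using R_pos by simp
  obtain l where l: "\<And>v. lam v = l \<bullet> v" using linear_functional_inner[of lam] lam_lin by metis
  let ?y = "snd c y" and ?\<Lambda> = "\<lambda>v. v + (k * lam v) *\<^sub>R e"
  define b where "b = (\<psi> - k * lam ?y) *\<^sub>R e"
  have bl: "bounded_linear ?\<Lambda>" unfolding l by (intro bounded_linear_intros)
  have yb: "?y \<in> cball o\<^sub>c R" using snd_reg[OF RR] carc_props[OF cu] by blast
  have im: "b + ?\<Lambda> q = q + (\<psi> + k * (lam q - lam ?y)) *\<^sub>R e" for q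
    by (simp add: b_def algebra_simps)
  have disp: "norm (q - (b + ?\<Lambda> q)) \<le> D" if q: "q \<in> cball o\<^sub>c R" for q
  proof -
    have "norm (q - (b + ?\<Lambda> q)) = \<bar>\<psi> + k * (lam q - lam ?y)\<bar>" unfolding im using norm_e by simp
    also have "\<dots> \<le> \<bar>\<psi>\<bar> + k * \<bar>lam q - lam ?y\<bar>" using k(1) abs_triangle_ineq[of \<psi> "k * (lam q - lam ?y)"] by (simp add: abs_mult)
    also have "\<dots> \<le> \<bar>\<psi>\<bar> + k * (2 * C * R)" using lam_ball[OF q yb] k(1) by (intro add_left_mono mult_left_mono)
    finally show ?thesis using D by simp
  qed
  have inB: "b + ?\<Lambda> q \<in> cball o\<^sub>c (2 * R)" if q: "q \<in> cball o\<^sub>c R" for q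
  proof -
    have "dist o\<^sub>c (b + ?\<Lambda> q) \<le> dist o\<^sub>c q + dist q (b + ?\<Lambda> q)" by (rule dist_triangle)
    then show ?thesis using disp[OF q] D(2) q by (simp add: dist_norm)
  qed
  have qr: "q \<in> cball o\<^sub>c R" "q \<in> cball o\<^sub>c (2 * R)" if "q \<in> snd c ` reg R" for q
    using that snd_reg[OF RR] RR by force+
  have "\<exists>L'\<ge>\<kappa> * L + (\<beta> *\<^sub>R l) \<bullet> (?y - snd c x). carc (reg (2 * R)) (cinv c (b + ?\<Lambda> (snd c x))) (cinv c (b + ?\<Lambda> ?y)) L'"
  proof (rule carc_affine[OF cA reg_fst[OF RR] bl _ _ cu])
    fix q assume "q \<in> snd c ` reg R"
    note q = qr[OF this]
    show "b + ?\<Lambda> q \<in> cdom c \<and> cinv c (b + ?\<Lambda> q) \<in> reg (2 * R)" using inB[OF q(1)] sub by blast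
    fix v assume "fcv c q v"
    then have v: "fc q v" using fcv_fc q by blast
    note t = transport[OF q(2) inB[OF q(1)] disp[OF q(1)] k v]
    have "sqrt (k / 2) * m / C * lam v \<le> sqrt (k / 2) * m * norm v"
    proof -
      have "sqrt (k / 2) * m / C * lam v \<le> sqrt (k / 2) * m / C * (C * norm v)"
        using lam_abs[of v] k(1) m_pos C_ge by (intro mult_left_mono) auto
      then show ?thesis using C_ge by simp
    qed
    then have "\<kappa> * F q v + \<beta> * lam v \<le> F (b + ?\<Lambda> q) (?\<Lambda> v)" using \<kappa> t(2,3) by auto
    then show "fcv c (b + ?\<Lambda> q) (?\<Lambda> v) \<and> \<kappa> * gspeed c q v + (\<beta> *\<^sub>R l) \<bullet> v \<le> gspeed c (b + ?\<Lambda> q) (?\<Lambda> v)"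
      using t(1) fcv_fc inB[OF q(1)] by (simp add: gspeed_F l)
  qed
  moreover have i: "b + ?\<Lambda> (snd c x) = snd c x + (\<psi> - k * lam (?y - snd c x)) *\<^sub>R e" "b + ?\<Lambda> ?y = ?y + \<psi> *\<^sub>R e"
    unfolding im by (simp_all add: lam_lin algebra_simps)
  ultimately show ?thesis unfolding i by (simp add: l)
qed

text \<open>A translation by \<open>h\<close> corrected by a tilt of total size at most
  \<open>h / 2\<close>, which is why the other end point is shifted by \<open>h\<close> only up to a
  factor 2.\<close>

lemma carc_shift:
  assumes cu: "carc (reg R) x y L" and h: "0 < h" "h \<le> R / 2"
  shows "\<exists>h' L'. h \<le> h' \<and> h' \<le> 2 * h \<and> L \<le> L' \<and> 
      carc (reg (2 * R)) (cinv c (snd c x - h' *\<^sub>R e)) (cinv c (snd c y - h *\<^sub>R e)) L'"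
    "\<exists>h' L'. h / 2 \<le> h' \<and> h' \<le> h \<and>
      carc (reg (2 * R)) (cinv c (snd c x + h' *\<^sub>R e)) (cinv c (snd c y + h *\<^sub>R e)) L'"
proof -
  have RR: "R \<le> 2 * R" using R_pos by simp
  have cu2: "carc (reg (2 * R)) x y L" by (rule carc_mono[OF cu reg_mono[OF RR]])
  let ?l = "lam (snd c y - snd c x)"
  have l0: "0 \<le> ?l" using carc_lam(3)[OF cu2] .
  have l1: "?l \<le> 2 * C * R" using lam_ball[of "snd c y" "snd c x"] snd_reg[OF RR] carc_props[OF cu] by (auto simp: lam_lin)
  \<comment> \<open>The least \<open>k\<close> for which a displacement of \<open>2 * h\<close>
    satisfies the hypothesis \<open>8 * C * D \<le> m^2 * k\<close>; \<open>R_small\<close> then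
    bounds the total tilt by \<open>h / 2\<close>.\<close>
  define k where "k = 16 * C / m^2 * h"
  have k0: "0 \<le> k" using h C_ge by (simp add: k_def)
  have kR: "k * (2 * C * R) \<le> h / 2"
  proof -
    have "k * (2 * C * R) = (64 * C^2 * R) * (h / (2 * m^2))" by (simp add: k_def power2_eq_square)
    also have "\<dots> \<le> m^2 * (h / (2 * m^2))" using R_small h by (intro mult_right_mono) auto
    also have "\<dots> = h / 2" using m_pos by simp
    finally show ?thesis .
  qed
  have kC: "k * C \<le> 1"
  proof -
    have "k * C = 16 * C^2 * h / m^2" by (simp add: k_def power2_eq_square)
    also have "16 * C^2 * h \<le> 64 * C^2 * R" using h C_ge R_pos by (intro mult_mono) auto
    then have "16 * C^2 * h \<le> m^2" using R_small by linarith
    then have "16 * C^2 * h / m^2 \<le> 1" using m_pos by (simp add: divide_le_eq)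
    finally show ?thesis .
  qed
  have kD: "8 * C * (2 * h) \<le> m^2 * k" using m_pos by (simp add: k_def)
  have kl: "0 \<le> k * ?l" "k * ?l \<le> h / 2"
    using k0 l0 kR mult_left_mono[OF l1 k0] by auto
  have D1: "\<bar>- h\<bar> + k * (2 * C * R) \<le> 2 * h" "\<bar>h\<bar> + k * (2 * C * R) \<le> 2 * h" "2 * h \<le> R" using kR h by auto
  have "\<exists>L'\<ge>1 * L + 0 * ?l. carc (reg (2 * R)) 
    (cinv c (snd c x + (- h - k * ?l) *\<^sub>R e)) (cinv c (snd c y + (- h) *\<^sub>R e)) L'"
    by (rule carc_transport[OF cu k0 kC kD D1(1,3)]) simp
  then obtain L' where "L' \<ge> L" "carc (reg (2 * R)) 
    (cinv c (snd c x - (h + k * ?l) *\<^sub>R e)) (cinv c (snd c y - h *\<^sub>R e)) L'"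
    by (auto simp: algebra_simps)
  then show "\<exists>h' L'. h \<le> h' \<and> h' \<le> 2 * h \<and> L \<le> L' \<and> 
      carc (reg (2 * R)) (cinv c (snd c x - h' *\<^sub>R e)) (cinv c (snd c y - h *\<^sub>R e)) L'"
    using kl h by (intro exI[of _ "h + k * ?l"] exI[of _ L']) auto
  have "\<exists>L'\<ge>1 * L + 0 * ?l. carc (reg (2 * R)) 
    (cinv c (snd c x + (h - k * ?l) *\<^sub>R e)) (cinv c (snd c y + h *\<^sub>R e)) L'"
    by (rule carc_transport[OF cu k0 kC kD D1(2,3)]) simp
  then obtain L'' where "carc (reg (2 * R)) 
    (cinv c (snd c x + (h - k * ?l) *\<^sub>R e)) (cinv c (snd c y + h *\<^sub>R e)) L''" by blast
  then show "\<exists>h' L'. h / 2 \<le> h' \<and> h' \<le> h \<and>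
      carc (reg (2 * R)) (cinv c (snd c x + h' *\<^sub>R e)) (cinv c (snd c y + h *\<^sub>R e)) L'"
    using kl h by (intro exI[of _ "h - k * ?l"] exI[of _ L'']) auto
qed

text \<open>Fixes the end point and lowers the start by \<open>k * lam\<close>. The length gained is
  of order \<open>sqrt k\<close>, even if the original curve is null.\<close>

lemma carc_tilt:
  assumes cu: "carc (reg R) x y L" and k: "0 \<le> k" "2 * C * k \<le> 1"
  shows "\<exists>L'\<ge>sqrt (k / 2) * m / C * lam (snd c y - snd c x). carc (reg (2 * R)) 
    (cinv c (snd c x - (k * lam (snd c y - snd c x)) *\<^sub>R e)) y L'"
proof -
  have RR: "R \<le> 2 * R" using R_pos by simp
  have D: "8 * C * (k * (2 * C * R)) \<le> m^2 * k"
  proof -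
    have "8 * C * (k * (2 * C * R)) = (64 * C^2 * R) * (k / 4)" by (simp add: power2_eq_square)
    also have "\<dots> \<le> m^2 * (k / 4)" using R_small k by (intro mult_right_mono) auto
    also have "\<dots> \<le> m^2 * k" using k by (intro mult_left_mono) auto
    finally show ?thesis .
  qed
  have kC: "k * C \<le> 1" using k mult_nonneg_nonneg[of C k] C_ge by (simp add: algebra_simps)
  have DR: "k * (2 * C * R) \<le> R"
    using mult_right_mono[OF k(2), of R] R_pos by (simp add: algebra_simps)
  have "\<exists>L'\<ge>0 * L + sqrt (k / 2) * m / C * lam (snd c y - snd c x). carc (reg (2 * R)) 
    (cinv c (snd c x + (0 - k * lam (snd c y - snd c x)) *\<^sub>R e)) (cinv c (snd c y + 0 *\<^sub>R e)) L'"
    by (rule carc_transport[OF cu k(1) kC D _ DR]) auto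
  moreover have "cinv c (snd c y) = y" using carc_props[OF cu] reg_fst[OF RR] cinv_snd[OF cA] by blast
  ultimately show ?thesis by simp
qed

lemma carc_straight_line:
  assumes "y \<in> cball o\<^sub>c (2 * R)" "y + (h *\<^sub>R e + w) \<in> cball o\<^sub>c (2 * R)" "h > 0" "norm w \<le> m / (4 * C) * h"
  shows "\<exists>L\<ge>h * m / 2. carc (reg (2 * R)) (cinv c y) (cinv c (y + (h *\<^sub>R e + w))) L"
proof (rule carc_straight[OF cA])
  fix r :: real assume r: "r \<in> {0..1}"
  have "y + r *\<^sub>R (h *\<^sub>R e + w) = (1 - r) *\<^sub>R y + r *\<^sub>R (y + (h *\<^sub>R e + w))" by (simp add: algebra_simps)
  then have i: "y + r *\<^sub>R (h *\<^sub>R e + w) \<in> cball o\<^sub>c (2 * R)"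
    using convexD_alt[OF convex_cball assms(1,2), of r] r by auto
  show "y + r *\<^sub>R (h *\<^sub>R e + w) \<in> cdom c \<and> cinv c (y + r *\<^sub>R (h *\<^sub>R e + w)) \<in> reg (2 * R) \<and>
      fcv c (y + r *\<^sub>R (h *\<^sub>R e + w)) (h *\<^sub>R e + w) \<and> h * m / 2 \<le> gspeed c (y + r *\<^sub>R (h *\<^sub>R e + w)) (h *\<^sub>R e + w)"
    using i sub straight[OF i assms(3,4)] fcv_fc[OF i] gspeed_F by auto
qed

text \<open>A short curve whose length is at least \<delta> times its \<open>lam\<close>-extent has
  a chord well inside the cone. Its end point can therefore be lowered by \<open>h\<close> with the
  start kept fixed, at a cost in length linear in \<open>h\<close>. The constants depend on \<delta>
  but not on the curve.\<close>

lemma carc_dilate: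
  assumes \<delta>: "0 < \<delta>" "\<delta> \<le> 1"
  shows "\<exists>l0>0. \<exists>k1>0. \<exists>k2>0. \<forall>x y L h. carc (reg R) x y L \<longrightarrow> 0 < lam (snd c y - snd c x) \<longrightarrow>
    lam (snd c y - snd c x) \<le> l0 \<longrightarrow> \<delta> * lam (snd c y - snd c x) \<le> L \<longrightarrow> 0 < h \<longrightarrow> 
    h \<le> k2 * lam (snd c y - snd c x) \<longrightarrow> (\<exists>L'\<ge>L - k1 * h. carc (reg (2 * R)) x (cinv c (snd c y - h *\<^sub>R e)) L')"
proof -
  \<comment> \<open>The chord has depth at least \<open>chc * \<delta>^2\<close> per unit of
    \<open>lam\<close> before corrections. One half is kept as \<eta>, the other pays for the
    variation of the metric.\<close>
  define \<eta> where "\<eta> = chc * \<delta>^2 / 2"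
  have \<eta>: "0 < \<eta>" "\<eta> \<le> 1"
  proof -
    show "0 < \<eta>" using chc_pos \<delta> by (simp add: \<eta>_def)
    have "chc * \<delta>^2 \<le> 1 * 1" using chc_le(1) chc_pos \<delta> by (intro mult_mono power_le_one) auto
    then show "\<eta> \<le> 1" by (simp add: \<eta>_def)
  qed
  define l0 where "l0 = min (m^4 * \<eta> / (216 * C^2)) (R / 3)"
  define k1 where "k1 = 4 * C / (m * \<eta>)"
  define k2 where "k2 = m * \<eta> / (4 * C^2)"
  have C2: "C^2 \<ge> 1" "C^2 \<ge> C"
    using C_ge mult_mono[of 1 C 1 C] mult_right_mono[of 1 C C] by (auto simp: power2_eq_square)
  have l0: "l0 > 0" "l0 \<le> m^4 * \<eta> / (216 * C^2)" "l0 \<le> R / 3" using m_pos C_ge \<eta> R_pos by (auto simp: l0_def)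
  have k1: "k1 > 0" using m_pos C_ge \<eta> by (simp add: k1_def)
  have k2: "k2 > 0" using m_pos C_ge \<eta> by (simp add: k2_def)
  have RR: "R \<le> 2 * R" using R_pos by simp
  have main: "\<exists>L'\<ge>L - k1 * h. carc (reg (2 * R)) x (cinv c (snd c y - h *\<^sub>R e)) L'"
    if cu: "carc (reg R) x y L" and L0: "0 < lam (snd c y - snd c x)" and Ll0: "lam (snd c y - snd c x) \<le> l0"
      and \<delta>L: "\<delta> * lam (snd c y - snd c x) \<le> L" and h0: "0 < h" and hk2: "h \<le> k2 * lam (snd c y - snd c x)"
    for x y L h
  proof -
    let ?x = "snd c x" and ?y = "snd c y"
    define D where "D = ?y - ?x"
    define \<Lambda> where "\<Lambda> = lam D"
    have \<Lambda>: "0 < \<Lambda>" "\<Lambda> \<le> l0" "\<delta> * \<Lambda> \<le> L" "h \<le> k2 * \<Lambda>" using L0 Ll0 \<delta>L hk2 by (auto simp: \<Lambda>_def D_def)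
    have cu2: "carc (reg (2 * R)) x y L" by (rule carc_mono[OF cu reg_mono[OF RR]])
    have nD: "norm D \<le> (2/m) * \<Lambda>" using carc_lam(1)[OF cu2] m_pos by (simp add: D_def \<Lambda>_def field_simps)
    \<comment> \<open>Points between \<open>x\<close> and \<open>y\<close> lie within
      \<open>(2/m) * \<Lambda>\<close> of \<open>x\<close>, so the metric varies on \<open>S\<close>
      only in proportion to \<open>\<Lambda>\<close>.\<close>
    define S where "S = {q. \<exists>L1 L2. carc (reg R) x q L1 \<and> carc (reg R) q y L2}"
    have cuS: "carc S x y L" unfolding S_def by (rule carc_trace[OF cu])
    have Sf: "S \<subseteq> fst c" using carc_props reg_fst[OF RR] unfolding S_def by blast
    have Sq: "q \<in> cball o\<^sub>c R" "q \<in> cball o\<^sub>c (2 * R)" "norm (q - ?x) \<le> (2/m) * \<Lambda>" "0 \<le> lam (q - ?x)" "lam (q - ?x) \<le> \<Lambda>"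
      if qi: "q \<in> snd c ` S" for q
    proof -
      obtain z L1 L2 where z: "q = snd c z" "carc (reg R) x z L1" "carc (reg R) z y L2" using qi unfolding S_def by blast
      have z2: "carc (reg (2*R)) x z L1" "carc (reg (2*R)) z y L2" using z carc_mono reg_mono[OF RR] by blast+
      show q: "q \<in> cball o\<^sub>c R" using z carc_props snd_reg[OF RR] by blast
      then show "q \<in> cball o\<^sub>c (2 * R)" using RR by simp
      show "0 \<le> lam (q - ?x)" using carc_lam(3)[OF z2(1)] z(1) by simp
      have "lam (?y - q) \<ge> 0" using carc_lam(3)[OF z2(2)] z(1) by simp
      then show "lam (q - ?x) \<le> \<Lambda>" by (simp add: \<Lambda>_def D_def lam_lin)
      then have "(m/2) * norm (q - ?x) \<le> \<Lambda>" using carc_lam(1)[OF z2(1)] z(1) by simp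
      then show "norm (q - ?x) \<le> (2/m) * \<Lambda>" using m_pos by (simp add: field_simps)
    qed
    \<comment> \<open>Makes \<open>16 * C * d \<le> m^2 * \<xi>\<close> an equality for
      \<open>d = (4/m) * \<Lambda>\<close>, which bounds the distance of two points of
      \<open>S\<close>. The bound \<open>l0\<close> then forces
      \<open>\<xi> \<le> \<eta>\<close>.\<close>
    define \<xi> where "\<xi> = 64 * C * \<Lambda> / m^3"
    have \<xi>0: "0 \<le> \<xi>" using C_ge m_pos \<Lambda> by (simp add: \<xi>_def)
    have L216: "216 * C^2 * \<Lambda> \<le> m^4 * \<eta>"
    proof -
      have "\<Lambda> \<le> m^4 * \<eta> / (216 * C^2)" using \<Lambda>(2) l0(2) by linarith
      then show ?thesis using C_ge by (simp add: pos_le_divide_eq algebra_simps)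
    qed
    have \<xi>\<eta>: "2 * C * \<xi> \<le> \<eta>"
    proof -
      have "2 * C * \<xi> = (216 * C^2 * \<Lambda>) * (128 / (216 * m^3))" by (simp add: \<xi>_def power2_eq_square)
      also have "\<dots> \<le> (m^4 * \<eta>) * (128 / (216 * m^3))" using L216 m_pos by (intro mult_right_mono) auto
      also have "\<dots> = (128 / 216) * m * \<eta>" using m_pos by (simp add: power4_eq_xxxx power3_eq_cube)
      also have "\<dots> \<le> 1 * \<eta>" using m_le m_pos \<eta> by (intro mult_right_mono) auto
      finally show ?thesis by simp
    qed
    have \<xi>1: "2 * C * \<xi> \<le> 1" using \<xi>\<eta> \<eta> by linarith
    have \<xi>2: "\<xi> \<le> \<eta>"
    proof -
      have "1 * \<xi> \<le> 2 * C * \<xi>" using C_ge \<xi>0 by (intro mult_right_mono) auto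
      then show ?thesis using \<xi>\<eta> by linarith
    qed
    have \<xi>d: "16 * C * ((4/m) * \<Lambda>) \<le> m^2 * \<xi>"
      using m_pos by (simp add: \<xi>_def power2_eq_square power3_eq_cube)
    obtain l where l: "\<And>v. lam v = l \<bullet> v" using linear_functional_inner[of lam] lam_lin by metis
    have chord: "cone q (D - (\<eta> * \<Lambda>) *\<^sub>R e)" if q: "q \<in> snd c ` S" for q
    proof -
      note qS = Sq[OF q]
      let ?V = "D - (chc * (2 * \<delta> * L - \<delta>^2 * \<Lambda>)) *\<^sub>R e + (\<xi> * \<Lambda>) *\<^sub>R e"
      have "cone q ?V"
      \<comment> \<open>With \<open>q\<close> fixed, pairing with each \<open>w\<close> in its cone
        turns the vector estimate of \<open>chord_pointwise\<close> into a scalar one, which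
        \<open>carc_linear\<close> sums up along the chain.\<close>
      proof (rule cone_dual[OF qS(2)])
        fix w assume w: "cone q w"
        obtain a1 where a1: "\<And>v. gform c q v w = a1 \<bullet> v"
          using linear_functional_inner[of "\<lambda>v. gform c q v w", OF addL scaleL] by blast
        define ew where "ew = gform c q e w"
        have "(- a1 - (chc * \<delta>^2 * ew) *\<^sub>R l - (\<xi> * ew) *\<^sub>R l) \<bullet> (snd c y - snd c x) + (2 * chc * \<delta> * ew) * L \<ge> 0"
        proof (rule carc_linear[OF cA Sf _ cuS])
          fix q' v assume q': "q' \<in> snd c ` S" and "fcv c q' v"
          note q'S = Sq[OF q']
          have v: "fc q' v" using fcv_fc[OF q'S(2)] \<open>fcv c q' v\<close> by blast
          have "norm (q' - q) \<le> norm (q' - ?x) + norm (?x - q)" by (rule norm_diff_triangle_ineq[of q' ?x ?x q, simplified])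
          then have "norm (q' - q) \<le> (4/m) * \<Lambda>" using qS(3) q'S(3) by (simp add: norm_minus_commute)
          from chord_pointwise[OF qS(2) q'S(2) this \<xi>d \<xi>1 \<xi>0 v, of \<delta>]
          have "gform c q (v - (chc * (2 * \<delta> * F q' v - \<delta>^2 * lam v)) *\<^sub>R e + (\<xi> * lam v) *\<^sub>R e) w \<le> 0"
            using w cone_prod[OF qS(2)] by blast
          then have "gform c q v w - (chc * (2 * \<delta> * F q' v - \<delta>^2 * lam v)) * ew + (\<xi> * lam v) * ew \<le> 0"
            by (simp add: g_lin ew_def)
          then show "0 \<le> (- a1 - (chc * \<delta>^2 * ew) *\<^sub>R l - (\<xi> * ew) *\<^sub>R l) \<bullet> v + (2 * chc * \<delta> * ew) * gspeed c q' v"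
            using a1[of v] by (simp add: gspeed_F inner_diff_left l algebra_simps)
        qed
        then show "gform c q ?V w \<le> 0"
          using a1[of D] by (simp add: g_lin ew_def[symmetric] inner_diff_left l \<Lambda>_def D_def[symmetric] algebra_simps)
      qed
      moreover have "cone q ((chc * (2 * \<delta> * L - \<delta>^2 * \<Lambda>) - \<xi> * \<Lambda> - \<eta> * \<Lambda>) *\<^sub>R e)"
      proof (intro cone_scale cone_e qS)
        have "2 * \<delta> * L - \<delta>^2 * \<Lambda> \<ge> \<delta>^2 * \<Lambda>"
        proof -
          have "2 * \<delta> * (\<delta> * \<Lambda>) \<le> 2 * \<delta> * L" using \<Lambda>(3) \<delta> by (intro mult_left_mono) auto
          moreover have "2 * \<delta> * (\<delta> * \<Lambda>) = \<delta>^2 * \<Lambda> + \<delta>^2 * \<Lambda>" by (simp add: power2_eq_square)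
          ultimately show ?thesis by linarith
        qed
        then have "chc * (2 * \<delta> * L - \<delta>^2 * \<Lambda>) \<ge> chc * (\<delta>^2 * \<Lambda>)" using chc_pos by (intro mult_left_mono) auto
        also have "chc * (\<delta>^2 * \<Lambda>) = \<eta> * \<Lambda> + \<eta> * \<Lambda>" by (simp add: \<eta>_def)
        finally show "0 \<le> chc * (2 * \<delta> * L - \<delta>^2 * \<Lambda>) - \<xi> * \<Lambda> - \<eta> * \<Lambda>"
          using mult_right_mono[OF \<xi>2, of \<Lambda>] \<Lambda> by linarith
      qed
      ultimately have "cone q (?V + (chc * (2 * \<delta> * L - \<delta>^2 * \<Lambda>) - \<xi> * \<Lambda> - \<eta> * \<Lambda>) *\<^sub>R e)"
        by (rule cone_add[OF qS(2)])
      then show ?thesis by (simp add: algebra_simps)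
    qed
    define \<theta> where "\<theta> = 2 * h / (\<eta> * \<Lambda>)"
    have hk: "4 * C^2 * h \<le> m * \<eta> * \<Lambda>"
      using \<Lambda>(4) C_ge by (simp add: k2_def field_simps)
    have h4: "4 * h \<le> \<eta> * \<Lambda>"
    proof -
      have "4 * h * 1 \<le> 4 * h * C^2" using C2 h0 by (intro mult_left_mono) auto
      also have "\<dots> \<le> m * (\<eta> * \<Lambda>)" using hk by (simp add: algebra_simps)
      also have "\<dots> \<le> 1 * (\<eta> * \<Lambda>)" using m_le \<eta> \<Lambda> by (intro mult_right_mono) auto
      finally show ?thesis by simp
    qed
    have h2: "2 * C^2 * h \<le> m * \<Lambda>"
    proof -
      have "m * \<eta> * \<Lambda> \<le> m * 1 * \<Lambda>" using m_pos \<eta> \<Lambda> by (intro mult_right_mono mult_left_mono) auto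
      moreover have "0 \<le> C^2 * h" using h0 by simp
      ultimately show ?thesis using hk by linarith
    qed
    have h9: "9 * h / (m * \<eta>) \<le> R"
    proof -
      have "4 * h * 1 \<le> 4 * h * C^2" using C2 h0 by (intro mult_left_mono) auto
      also have "\<dots> \<le> m * \<eta> * \<Lambda>" using hk by (simp add: algebra_simps)
      also have "\<dots> \<le> m * \<eta> * (R / 3)" using \<Lambda>(2) l0(3) m_pos \<eta> by (intro mult_left_mono) auto
      finally have "12 * h \<le> (m * \<eta>) * R" by simp
      then have "9 * h \<le> (m * \<eta>) * R" using h0 by linarith
      then show ?thesis using m_pos \<eta> by (simp add: divide_le_eq algebra_simps)
    qed
    have \<theta>: "0 \<le> \<theta>" "\<theta> * \<Lambda> = 2 * h / \<eta>" using h0 \<eta> \<Lambda> by (auto simp: \<theta>_def)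
    let ?w = "\<theta> *\<^sub>R D - h *\<^sub>R e"
    let ?f = "\<lambda>v. (1 - \<theta>) *\<^sub>R v + (lam v / \<Lambda>) *\<^sub>R ?w"
    \<comment> \<open>With this offset the affine map fixes \<open>?x\<close> and sends
      \<open>?y\<close> to \<open>?y - h *\<^sub>R e\<close>: the dilation pulls \<open>?y\<close>
      back by \<open>\<theta> *\<^sub>R D\<close>, and the term with \<open>?w\<close> restores this
      less \<open>h *\<^sub>R e\<close>.\<close>
    define b where "b = \<theta> *\<^sub>R ?x - (lam ?x / \<Lambda>) *\<^sub>R ?w"
    have bl: "bounded_linear ?f" unfolding l divide_inverse by (intro bounded_linear_intros)
    have im: "b + ?f q = q - \<theta> *\<^sub>R (q - ?x) + (lam (q - ?x) / \<Lambda>) *\<^sub>R ?w" for q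
    proof -
      have "\<theta> *\<^sub>R x0 - (a / \<Lambda>) *\<^sub>R z + ((1 - \<theta>) *\<^sub>R q + (a' / \<Lambda>) *\<^sub>R z) = q - \<theta> *\<^sub>R (q - x0) + ((a' - a) / \<Lambda>) *\<^sub>R z"
        for x0 z :: "real^'n" and a a' :: real
        by (simp add: diff_divide_distrib algebra_simps)
      then show ?thesis unfolding b_def lam_lin .
    qed
    have disp: "norm (q - (b + ?f q)) \<le> 9 * h / (m * \<eta>)" if q: "q \<in> snd c ` S" for q
    proof -
      note qS = Sq[OF q]
      have r: "\<bar>lam (q - ?x) / \<Lambda>\<bar> \<le> 1" using qS(4,5) \<Lambda> by simp
      have "norm (q - (b + ?f q)) = norm (\<theta> *\<^sub>R (q - ?x) - (lam (q - ?x) / \<Lambda>) *\<^sub>R ?w)"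
        unfolding im by simp
      also have "\<dots> \<le> norm (\<theta> *\<^sub>R (q - ?x)) + norm ((lam (q - ?x) / \<Lambda>) *\<^sub>R ?w)" by (rule norm_triangle_ineq4)
      also have "\<dots> \<le> \<theta> * norm (q - ?x) + 1 * norm ?w"
        using \<theta> r by (simp add: mult_left_le_one_le mult_right_mono del: abs_divide)
      also have "norm ?w \<le> \<theta> * norm D + h" using norm_triangle_ineq4[of "\<theta> *\<^sub>R D" "h *\<^sub>R e"] \<theta> h0 norm_e by simp
      also have "\<theta> * norm (q - ?x) + 1 * (\<theta> * norm D + h) \<le> \<theta> * ((2/m) * \<Lambda>) + 1 * (\<theta> * ((2/m) * \<Lambda>) + h)"
        using \<theta> qS(3) nD by (intro add_mono mult_left_mono order_refl) auto
      also have "\<dots> = (4/m) * (\<theta> * \<Lambda>) + h" by (simp add: algebra_simps)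
      also have "\<dots> = 8 * h / (m * \<eta>) + h" unfolding \<theta>(2) by simp
      finally have "norm (q - (b + ?f q)) \<le> 8 * (h / (m * \<eta>)) + h" by simp
      moreover have "h \<le> h / (m * \<eta>)"
      proof -
        have "m * \<eta> \<le> 1 * 1" using m_le m_pos \<eta> by (intro mult_mono) auto
        then have "h * (m * \<eta>) \<le> h * 1" using h0 by (intro mult_left_mono) auto
        then show ?thesis using m_pos \<eta> by (simp add: pos_le_divide_eq)
      qed
      moreover have "a \<le> 9 * z" if "a \<le> 8 * z + h" "h \<le> z" for a z :: real using that by linarith
      ultimately have "norm (q - (b + ?f q)) \<le> 9 * (h / (m * \<eta>))" by blast
      then show ?thesis by simp
    qed
    have inB: "b + ?f q \<in> cball o\<^sub>c (2 * R)" if q: "q \<in> snd c ` S" for q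
    proof -
      have "dist o\<^sub>c (b + ?f q) \<le> dist o\<^sub>c q + dist q (b + ?f q)" by (rule dist_triangle)
      then show ?thesis using disp[OF q] h9 Sq(1)[OF q] by (simp add: dist_norm)
    qed
    have "\<exists>L'\<ge>(1 - \<theta>) * L + 0 \<bullet> (?y - ?x). carc (reg (2 * R)) (cinv c (b + ?f ?x)) (cinv c (b + ?f ?y)) L'"
    proof (rule carc_affine[OF cA Sf bl _ _ cuS])
      fix q assume q: "q \<in> snd c ` S"
      note qS = Sq[OF q]
      show "b + ?f q \<in> cdom c \<and> cinv c (b + ?f q) \<in> reg (2 * R)" using inB[OF q] sub by blast
      fix v assume "fcv c q v"
      then have v: "fc q v" using fcv_fc qS by blast
      note t = chord_dilate[OF qS(2) inB[OF q] v \<Lambda>(1) \<eta> less_imp_le[OF h0] h4 chord[OF q] nD h2 disp[OF q] L216, folded \<theta>_def]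
      show "fcv c (b + ?f q) (?f v) \<and> (1 - \<theta>) * gspeed c q v + 0 \<bullet> v \<le> gspeed c (b + ?f q) (?f v)"
        using t fcv_fc[OF inB[OF q]] by (simp add: gspeed_F)
    qed
    moreover have "b + ?f ?x = ?x" unfolding im by (simp add: lam_def)
    moreover have "b + ?f ?y = ?y - h *\<^sub>R e" unfolding im D_def[symmetric] using \<Lambda> by (simp add: \<Lambda>_def[symmetric])
    moreover have "cinv c ?x = x" using carc_props[OF cu] reg_fst[OF RR] cinv_snd[OF cA] by blast
    ultimately obtain L' where L': "L' \<ge> (1 - \<theta>) * L" "carc (reg (2 * R)) x (cinv c (?y - h *\<^sub>R e)) L'" by auto
    \<comment> \<open>The loss of length is \<open>\<theta> * L\<close>. Since \<open>L\<close> is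
      at most a multiple of \<open>\<Lambda>\<close>, and \<theta> is inversely proportional to it,
      the loss is a multiple of \<open>h\<close> alone.\<close>
    have "\<theta> * L \<le> \<theta> * ((2 * C / m) * \<Lambda>)"
      using carc_lam(2)[OF cu2] \<theta> by (intro mult_left_mono) (auto simp: \<Lambda>_def D_def)
    also have "\<dots> = (2 * C / m) * (\<theta> * \<Lambda>)" by simp
    also have "\<dots> = k1 * h" unfolding \<theta>(2) k1_def by simp
    finally show ?thesis using L' by (intro exI[of _ L']) (auto simp: algebra_simps)
  qed
  show ?thesis
    by (rule exI[of _ l0], intro conjI l0(1), rule exI[of _ k1], intro conjI k1, rule exI[of _ k2], intro conjI k2 allI impI)
      (rule main; assumption)
qed

text \<open>Pieces of extent \<open>d\<close> are cut off at the end, at levels of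
  \<open>lam\<close>; one of the at most \<open>Suc n\<close> pieces has at least the average
  length.\<close>

lemma carc_pigeonhole:
  assumes "carc (reg R) x y L" "lam (snd c y - snd c x) \<le> real (Suc n) * d" "0 < d"
  shows "\<exists>x' y' L1 L' L2. carc (reg R) x x' L1 \<and> carc (reg R) x' y' L' \<and> carc (reg R) y' y L2 \<and> 
    L = L1 + L' + L2 \<and> lam (snd c y' - snd c x') \<le> d \<and> L / real (Suc n) \<le> L'"
  using assms(1,2)
proof (induction n arbitrary: y L)
  case 0
  then show ?case using carc_props[OF 0(1)] carc_refl
    by (intro exI[of _ x] exI[of _ y] exI[of _ 0] exI[of _ L]) auto
next
  case (Suc n)
  have RR: "R \<le> 2 * R" using R_pos by simp
  have cont: "continuous_on (reg R) (\<lambda>z. lam (snd c z))"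
  proof -
    obtain l where l: "\<And>v. lam v = l \<bullet> v" using linear_functional_inner[of lam] lam_lin by metis
    show ?thesis unfolding l
      by (intro continuous_on_inner continuous_on_const continuous_on_subset[OF continuous_snd[OF cA] reg_fst[OF RR]])
  qed
  show ?case
  proof (cases "lam (snd c y - snd c x) \<le> d")
    case True
    moreover have "L / real (Suc (Suc n)) \<le> L"
      using carc_props[OF Suc(2)] by (simp add: divide_le_eq mult_le_cancel_left1)
    ultimately show ?thesis using Suc(2) carc_props[OF Suc(2)] carc_refl
      by (intro exI[of _ x] exI[of _ y] exI[of _ 0] exI[of _ L]) auto
  next
    case False
    then obtain w L1 L2 where w: "lam (snd c w) = lam (snd c y) - d" "carc (reg R) x w L1" "carc (reg R) w y L2" "L = L1 + L2"
      using carc_split_level[OF Suc(2) cont, of "lam (snd c y) - d"] assms(3) by (auto simp: lam_lin)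
    show ?thesis
    proof (cases "L / real (Suc (Suc n)) \<le> L2")
      case True
      have "carc (reg R) y y 0" using carc_props[OF Suc(2)] by (auto intro: carc_refl)
      then show ?thesis using w True by (intro exI[of _ w] exI[of _ y] exI[of _ L1] exI[of _ L2] exI[of _ 0]) (auto simp: lam_lin)
    next
      case False
      have "lam (snd c w - snd c x) \<le> real (Suc n) * d" using Suc(3) w(1) by (simp add: lam_lin algebra_simps)
      from Suc.IH[OF w(2) this] obtain x' y' M1 M' M2 where M: "carc (reg R) x x' M1" "carc (reg R) x' y' M'" 
        "carc (reg R) y' w M2" "L1 = M1 + M' + M2" "lam (snd c y' - snd c x') \<le> d" "L1 / real (Suc n) \<le> M'" by blast
      have "L / real (Suc (Suc n)) \<le> L1 / real (Suc n)"
      proof -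
        have "L2 < L / real (Suc (Suc n))" using False by simp
        then have "L - L / real (Suc (Suc n)) \<le> L1" using w(4) by simp
        moreover have "L - L / real (Suc (Suc n)) = (L / real (Suc (Suc n))) * real (Suc n)" by (simp add: field_simps)
        ultimately show ?thesis by (simp add: pos_le_divide_eq)
      qed
      then have "L / real (Suc (Suc n)) \<le> M'" using M(6) by linarith
      moreover have "carc (reg R) y' y (M2 + L2)" by (rule carc_trans[OF w(3) M(3)])
      ultimately show ?thesis using M w(4) 
        by (intro exI[of _ x'] exI[of _ y'] exI[of _ M1] exI[of _ M'] exI[of _ "M2 + L2"]) auto
    qed
  qed
qed

end

section \<open>Chains and piecewise smooth curves\<close>

lemma partition_mono:
  assumes "is_partition a b k s" "i \<le> j" "j \<le> k" shows "s i \<le> s j"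
  using assms(2,3)
proof (induction j)
  case (Suc j)
  have "s j < s (Suc j)" using assms(1) Suc.prems(2) by (simp add: is_partition_def)
  then show ?case using Suc by (cases "i = Suc j") auto
qed simp

context spacetime_ctx
begin

lemma curve_carc:
  assumes "fut_causal_curve A G T \<alpha> a b k s"
  shows "carc UNIV (\<alpha> a) (\<alpha> b) (lor_length A G \<alpha> k s)"
proof -
  have p: "is_partition a b k s" and sg: "\<And>i. i < k \<Longrightarrow> fut_causal_seg A G T (s i) (s (Suc i)) \<alpha>"
    using assms by (auto simp: fut_causal_curve_def)
  have "carc UNIV (\<alpha> a) (\<alpha> (s i)) (\<Sum>j<i. seglen (s j) (s (Suc j)) \<alpha>)" if "i \<le> k" for i
    using that
  proof (induction i)
    case 0
    then show ?case using p by (auto simp: is_partition_def intro: carc_refl)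
  next
    case (Suc i)
    then have "carc UNIV (\<alpha> a) (\<alpha> (s (Suc i))) ((\<Sum>j<i. seglen (s j) (s (Suc j)) \<alpha>) + seglen (s i) (s (Suc i)) \<alpha>)"
      by (intro carc_step[OF _ sg]) auto
    then show ?case by (simp add: add.commute)
  qed
  from this[of k] show ?thesis using p by (simp add: is_partition_def lor_length_def seglen_def)
qed

text \<open>Segments are shifted in parameter and appended one after another. The starting parameter
  is free, and distinct end points give a nondegenerate interval, as needed for later
  gluing.\<close>

lemma carc_curve:
  assumes "carc S x y L"
  shows "\<exists>\<alpha> b k s. fut_causal_curve A G T \<alpha> a b k s \<and> \<alpha> a = x \<and> \<alpha> b = y \<and> lor_length A G \<alpha> k s = L \<and> (x \<noteq> y \<longrightarrow> a < b)"
  using assms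
proof (induction rule: carc.induct)
  case (carc_refl x)
  then show ?case
    by (intro exI[of _ "\<lambda>_. x"] exI[of _ a] exI[of _ 0] exI[of _ "\<lambda>_. a"])
      (auto simp: fut_causal_curve_def is_partition_def lor_length_def)
next
  case (carc_step x y L s' t' \<beta>)
  then obtain \<alpha> b k s where c: "fut_causal_curve A G T \<alpha> a b k s" "\<alpha> a = x" "\<alpha> b = y" "lor_length A G \<alpha> k s = L" by blast
  have p: "is_partition a b k s" and sg: "\<And>i. i < k \<Longrightarrow> fut_causal_seg A G T (s i) (s (Suc i)) \<alpha>"
    using c(1) by (auto simp: fut_causal_curve_def)
  have ab: "a \<le> b" using partition_mono[OF p, of 0 k] p by (simp add: is_partition_def)
  have st: "s' < t'" using seg_facts[OF carc_step.hyps(2)] by simp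
  define \<gamma> where "\<gamma> = (\<lambda>\<tau>. if \<tau> \<le> b then \<alpha> \<tau> else \<beta> (1 * \<tau> + (s' - b)))"
  define r where "r = (\<lambda>i. if i \<le> k then s i else b + (t' - s'))"
  have sk: "s k = b" using p by (simp add: is_partition_def)
  have g2: "\<gamma> \<tau> = \<beta> (1 * \<tau> + (s' - b))" if "\<tau> \<in> {b..b + (t' - s')}" for \<tau>
    using that c(3) carc_step.hyps(3) by (cases "\<tau> = b") (auto simp: \<gamma>_def)
  note seg2 = seglen_reparam[OF carc_step.hyps(2), where s'=b and t'="b + (t' - s')" and m=1 and b="s' - b" and \<alpha>'=\<gamma>]
  have e2: "fut_causal_seg A G T b (b + (t' - s')) \<gamma>" "seglen b (b + (t' - s')) \<gamma> = seglen s' t' \<beta>"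
    using seg2 g2 st by auto
  have e1: "fut_causal_seg A G T (s i) (s (Suc i)) \<gamma>" "seglen (s i) (s (Suc i)) \<gamma> = seglen (s i) (s (Suc i)) \<alpha>" if i: "i < k" for i
  proof -
    have "\<gamma> \<tau> = \<alpha> (1 * \<tau> + 0)" if "\<tau> \<in> {s i..s (Suc i)}" for \<tau>
      using that partition_mono[OF p, of "Suc i" k] i sk by (auto simp: \<gamma>_def)
    moreover have "s i < s (Suc i)" using p i by (simp add: is_partition_def)
    ultimately show "fut_causal_seg A G T (s i) (s (Suc i)) \<gamma>" "seglen (s i) (s (Suc i)) \<gamma> = seglen (s i) (s (Suc i)) \<alpha>"
      using seglen_reparam[OF sg[OF i] _ zero_less_one, of "s i" "s (Suc i)" 0 \<gamma>] by simp_all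
  qed
  have "is_partition a (b + (t' - s')) (Suc k) r"
    using p st sk by (auto simp: is_partition_def r_def less_Suc_eq)
  moreover have "fut_causal_seg A G T (r i) (r (Suc i)) \<gamma>" if "i < Suc k" for i
    using that e1 e2 sk by (cases "i = k") (auto simp: r_def)
  ultimately have 1: "fut_causal_curve A G T \<gamma> a (b + (t' - s')) (Suc k) r" by (auto simp: fut_causal_curve_def)
  have "lor_length A G \<gamma> (Suc k) r = (\<Sum>i<k. seglen (r i) (r (Suc i)) \<gamma>) + seglen (r k) (r (Suc k)) \<gamma>"
    by (simp add: lor_length_def seglen_def)
  also have "(\<Sum>i<k. seglen (r i) (r (Suc i)) \<gamma>) = (\<Sum>i<k. seglen (s i) (s (Suc i)) \<alpha>)"
    by (rule sum.cong) (use e1 in \<open>auto simp: r_def\<close>)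
  also have "\<dots> = L" using c(4) by (simp add: lor_length_def seglen_def)
  also have "seglen (r k) (r (Suc k)) \<gamma> = seglen s' t' \<beta>" using e2 sk by (simp add: r_def)
  finally have 2: "lor_length A G \<gamma> (Suc k) r = L + seglen s' t' \<beta>" .
  have 3: "\<gamma> a = x" using ab c by (simp add: \<gamma>_def)
  have 4: "\<gamma> (b + (t' - s')) = \<beta> t'" using st by (simp add: \<gamma>_def)
  have "a < b + (t' - s')" using ab st by simp
  then show ?case using 1 2 3 4 by blast
qed

lemma causal_le_carc: "causal_le A G T x y \<longleftrightarrow> (\<exists>L. carc UNIV x y L)"
proof
  assume "causal_le A G T x y"
  then consider "x = y" | \<alpha> a b where "causal_curve_on A G T \<alpha> a b" "\<alpha> a = x" "\<alpha> b = y"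
    unfolding causal_le_def by blast
  then show "\<exists>L. carc UNIV x y L"
  proof cases
    case 1 then show ?thesis using carc_refl by blast
  next
    case 2
    then consider "x = y" | k s where "fut_causal_curve A G T \<alpha> a b k s"
      unfolding causal_curve_on_def by (metis atLeastAtMost_iff order_refl)
    then show ?thesis
    proof cases
      case 1 then show ?thesis using carc_refl by blast
    next
      case (2 k s) then show ?thesis using curve_carc[OF 2] \<open>\<alpha> a = x\<close> \<open>\<alpha> b = y\<close> by blast
    qed
  qed
next
  assume "\<exists>L. carc UNIV x y L"
  then obtain L where "carc UNIV x y L" by blast
  from carc_curve[OF this, of 0] obtain \<alpha> b k s where c: "fut_causal_curve A G T \<alpha> 0 b k s" "\<alpha> 0 = x" "\<alpha> b = y" by blast
  have "is_partition 0 b k s" using c(1) by (simp add: fut_causal_curve_def)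
  then have "0 \<le> b" using partition_mono[of 0 b k s 0 k] by (simp add: is_partition_def)
  then have "causal_curve_on A G T \<alpha> 0 b" using c(1) unfolding causal_curve_on_def by blast
  then show "causal_le A G T x y" using c unfolding causal_le_def by blast
qed

text \<open>Merges the suprema over past points and over curves into one. The value 0 included in
  \<open>lor_dist\<close> is realized by the trivial chain.\<close>

lemma cosmo_time_carc: "cosmo_time A G T q = (SUP L\<in>{L. \<exists>p. carc UNIV p q L}. ereal L)"
proof (rule antisym)
  let ?S = "SUP L\<in>{L. \<exists>p. carc UNIV p q L}. ereal L"
  have z: "0 \<le> ?S"
    using SUP_upper[of 0 "{L. \<exists>p. carc UNIV p q L}" ereal] carc_refl[of q UNIV] by (auto simp: zero_ereal_def[symmetric])
  show "cosmo_time A G T q \<le> ?S"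
    unfolding cosmo_time_def
  proof (rule SUP_least)
    fix p
    show "lor_dist A G T p q \<le> ?S"
      unfolding lor_dist_def
    proof (rule Sup_least)
      fix r assume "r \<in> {0} \<union> {ereal (lor_length A G \<alpha> k s) |\<alpha> a b k s. fut_causal_curve A G T \<alpha> a b k s \<and> \<alpha> a = p \<and> \<alpha> b = q}"
      then consider "r = 0" | \<alpha> a b k s where "r = ereal (lor_length A G \<alpha> k s)" "fut_causal_curve A G T \<alpha> a b k s" "\<alpha> a = p" "\<alpha> b = q"
        by blast
      then show "r \<le> ?S"
      proof cases
        case (2 \<alpha> a b k s)
        have "carc UNIV p q (lor_length A G \<alpha> k s)" using curve_carc[OF 2(2)] 2(3,4) by simp
        then show ?thesis unfolding 2(1) by (intro SUP_upper) blast
      qed (use z in simp)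
    qed
  qed
next
  show "(SUP L\<in>{L. \<exists>p. carc UNIV p q L}. ereal L) \<le> cosmo_time A G T q"
  proof (rule SUP_least)
    fix L assume "L \<in> {L. \<exists>p. carc UNIV p q L}"
    then obtain p where c: "carc UNIV p q L" by blast
    then have le: "p \<in> {p. causal_le A G T p q}" using causal_le_carc by blast
    from carc_curve[OF c, of 0] obtain \<alpha> b k s where 
      "fut_causal_curve A G T \<alpha> 0 b k s" "\<alpha> 0 = p" "\<alpha> b = q" "lor_length A G \<alpha> k s = L" by blast
    then have "ereal L \<le> lor_dist A G T p q"
      unfolding lor_dist_def by (intro Sup_upper UnI2) blast
    also have "\<dots> \<le> cosmo_time A G T q" unfolding cosmo_time_def by (rule SUP_upper[OF le])
    finally show "ereal L \<le> cosmo_time A G T q" .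
  qed
qed

end

section \<open>Failure of the Lipschitz property\<close>

locale regular_ctx = spacetime_ctx A G T
  for A :: "('a::{t2_space,second_countable_topology}, 'n::finite) chart set"
    and G :: "('a,'n) chart \<Rightarrow> 'a \<Rightarrow> real^'n^'n"
    and T :: "('a,'n) chart \<Rightarrow> 'a \<Rightarrow> real^'n" +
  assumes regular: "regular_cosmo_time A G T"
begin

definition tau :: "'a \<Rightarrow> real" where "tau q = real_of_ereal (cosmo_time A G T q)"

lemma ereal_tau: "ereal (tau q) = cosmo_time A G T q"
proof -
  have "cosmo_time A G T q \<noteq> \<infinity>" using regular by (simp add: regular_cosmo_time_def)
  moreover have "ereal 0 \<le> cosmo_time A G T q"
    unfolding cosmo_time_carc by (rule SUP_upper) (use carc_refl[of q UNIV] in auto)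
  ultimately show ?thesis unfolding tau_def by (intro ereal_real') auto
qed

lemma tau_ge: "carc UNIV p q L \<Longrightarrow> L \<le> tau q"
  using SUP_upper[of L "{L. \<exists>p. carc UNIV p q L}" ereal] ereal_tau[of q] cosmo_time_carc[of q]
  by (metis (mono_tags, lifting) ereal_less_eq(3) mem_Collect_eq)

lemma tau_near:
  assumes "\<epsilon> > 0" obtains p L where "carc UNIV p q L" "tau q < L + \<epsilon>"
proof -
  have "ereal (tau q - \<epsilon>) < (SUP L\<in>{L. \<exists>p. carc UNIV p q L}. ereal L)"
    unfolding cosmo_time_carc[symmetric] ereal_tau[symmetric] using assms by simp
  then obtain L where "L \<in> {L. \<exists>p. carc UNIV p q L}" "ereal (tau q - \<epsilon>) < ereal L"
    unfolding less_SUP_iff by blast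
  then obtain p where "carc UNIV p q L" "tau q - \<epsilon> < L" by auto
  then show ?thesis by (intro that[of p L]) auto
qed

text \<open>The reverse triangle inequality: a nearly maximal chain ending in \<open>p\<close> is
  prolonged to \<open>q\<close>.\<close>

lemma tau_add: 
  assumes "carc S p q L" shows "tau p + L \<le> tau q"
proof (rule field_le_epsilon)
  fix \<epsilon> :: real assume "\<epsilon> > 0"
  then obtain z M where z: "carc UNIV z p M" "tau p < M + \<epsilon>" by (rule tau_near)
  have "carc UNIV z q (M + L)" using carc_trans[OF carc_mono[OF assms] z(1)] by simp
  then show "tau p + L \<le> tau q + \<epsilon>" using tau_ge z(2) by fastforce
qed

lemma tau_mono: assumes "carc S p q L" shows "tau p \<le> tau q"
  using tau_add[OF assms] carc_props[OF assms] by linarith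

lemma tau_nonneg: "0 \<le> tau q"
  using tau_ge[OF carc_refl[OF UNIV_I]] .

text \<open>A substitute for the chronological relation. It is open in the lower point, hence usable
  when that point is only known as a limit.\<close>

definition beyond :: "'a \<Rightarrow> 'a \<Rightarrow> bool" where
  "beyond q p \<longleftrightarrow> (\<exists>U. open U \<and> p \<in> U \<and> (\<forall>x\<in>U. causal_le A G T x q))"

text \<open>Difference quotients of \<open>tau\<close> in the chart are unbounded near
  \<open>p\<close>, through pairs whose upper value is almost \<open>c0\<close> or more. The bound
  is placed on nearby values since \<open>tau\<close> may be discontinuous at
  \<open>p\<close>.\<close>

definition nonlip :: "('a,'n) chart \<Rightarrow> real \<Rightarrow> 'a \<Rightarrow> bool" where
  "nonlip d c0 p \<longleftrightarrow> d \<in> A \<and> p \<in> fst d \<and> (\<forall>\<epsilon>>0. \<exists>x\<in>fst d. \<exists>y\<in>fst d. norm (snd d x - snd d p) < \<epsilon> \<and>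
     norm (snd d y - snd d p) < \<epsilon> \<and> norm (snd d y - snd d x) < \<epsilon> * (tau y - tau x) \<and> tau y > c0 - \<epsilon>)"

lemma nonlip_chart_change:
  assumes b: "nonlip c c0 p" and d: "d \<in> A" "p \<in> fst d"
  shows "nonlip d c0 p"
proof -
  have c: "c \<in> A" "p \<in> fst c" using b by (auto simp: nonlip_def)
  let ?S = "snd c ` (fst c \<inter> fst d)"
  have "open ?S" "snd c p \<in> ?S" using open_overlap[OF c(1) d(1)] c d by auto
  then obtain r where r: "r > 0" "cball (snd c p) r \<subseteq> ?S" unfolding open_contains_cball by blast
  obtain K where K: "K > 0" "\<And>y z. y \<in> cball (snd c p) r \<Longrightarrow> z \<in> cball (snd c p) r \<Longrightarrow> 
      norm (transition c d y - transition c d z) \<le> K * norm (y - z)"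
    using smooth_on_Lipschitz[OF smooth_transition[OF c(1) d(1)] r(2)] by blast
  have loc: "x \<in> fst d" "snd c x \<in> cball (snd c p) r" if x: "x \<in> fst c" "norm (snd c x - snd c p) < r" for x
  proof -
    show xb: "snd c x \<in> cball (snd c p) r" using x by (simp add: dist_norm norm_minus_commute)
    then obtain z where "z \<in> fst c \<inter> fst d" "snd c x = snd c z" using r(2) by blast
    then show "x \<in> fst d" using cinv_snd[OF c(1)] x(1) by (metis IntE)
  qed
  have lip: "norm (snd d x - snd d y) \<le> K * norm (snd c x - snd c y)"
    if "x \<in> fst c" "norm (snd c x - snd c p) < r" "y \<in> fst c" "norm (snd c y - snd c p) < r" for x y
    using K(2)[OF loc(2)[OF that(1,2)] loc(2)[OF that(3,4)]] transition_snd[OF c(1)] that by simp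
  show ?thesis unfolding nonlip_def
  proof (intro conjI d allI impI)
    fix \<epsilon> :: real assume e: "\<epsilon> > 0"
    define \<epsilon>' where "\<epsilon>' = min r (min \<epsilon> (\<epsilon> / K))"
    have e': "\<epsilon>' > 0" "\<epsilon>' \<le> r" "\<epsilon>' \<le> \<epsilon>" "K * \<epsilon>' \<le> \<epsilon>" 
    proof -
      show "\<epsilon>' > 0" "\<epsilon>' \<le> r" "\<epsilon>' \<le> \<epsilon>" using e r(1) K(1) by (auto simp: \<epsilon>'_def)
      have "\<epsilon>' \<le> \<epsilon> / K" by (simp add: \<epsilon>'_def)
      then show "K * \<epsilon>' \<le> \<epsilon>" using K(1) by (simp add: field_simps)
    qed
    obtain x y where xy: "x \<in> fst c" "y \<in> fst c" "norm (snd c x - snd c p) < \<epsilon>'" "norm (snd c y - snd c p) < \<epsilon>'"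
      "norm (snd c y - snd c x) < \<epsilon>' * (tau y - tau x)" "tau y > c0 - \<epsilon>'"
      using b e'(1) unfolding nonlip_def by blast
    have xr: "norm (snd c x - snd c p) < r" "norm (snd c y - snd c p) < r" using xy e' by auto
    have pr: "norm (snd c p - snd c p) < r" using r by simp
    have near: "norm (snd d z - snd d p) < \<epsilon>" if z: "z \<in> fst c" "norm (snd c z - snd c p) < \<epsilon>'" for z
    proof -
      have "norm (snd d z - snd d p) \<le> K * norm (snd c z - snd c p)" using z e' by (intro lip c(2) pr) auto
      also have "\<dots> < K * \<epsilon>'" using z(2) K(1) by simp
      finally show ?thesis using e' by simp
    qed
    have pos: "0 < tau y - tau x"
    proof -
      have "0 < \<epsilon>' * (tau y - tau x)" using xy(5) norm_ge_zero[of "snd c y - snd c x"] by linarith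
      then show ?thesis using e'(1) by (simp add: zero_less_mult_iff)
    qed
    have "norm (snd d y - snd d x) \<le> K * norm (snd c y - snd c x)" by (intro lip xy xr)
    also have "\<dots> < K * (\<epsilon>' * (tau y - tau x))" using xy(5) K(1) by simp
    also have "\<dots> \<le> \<epsilon> * (tau y - tau x)" using mult_right_mono[OF e'(4), of "tau y - tau x"] pos by (simp add: mult.assoc)
    finally have "norm (snd d y - snd d x) < \<epsilon> * (tau y - tau x)" .
    then show "\<exists>x\<in>fst d. \<exists>y\<in>fst d. norm (snd d x - snd d p) < \<epsilon> \<and> norm (snd d y - snd d p) < \<epsilon> \<and> 
        norm (snd d y - snd d x) < \<epsilon> * (tau y - tau x) \<and> tau y > c0 - \<epsilon>"
      using near xy loc xr e' by (intro bexI[of _ x] bexI[of _ y]) auto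
  qed
qed

end

text \<open>By the last assumption, curves inside the ball are too short to be almost maximal.\<close>

locale regular_patch = good_patch A G T c o\<^sub>c R e m C + regular_ctx A G T
  for A :: "('a::{t2_space,second_countable_topology}, 'n::finite) chart set"
    and G :: "('a,'n) chart \<Rightarrow> 'a \<Rightarrow> real^'n^'n"
    and T :: "('a,'n) chart \<Rightarrow> 'a \<Rightarrow> real^'n" and c o\<^sub>c R e m C +
  fixes t0 :: real
  assumes t0_pos: "t0 > 0" and tau_t0: "y \<in> cinv c ` cball o\<^sub>c R \<Longrightarrow> t0 \<le> tau y"
    and cap: "(2 * C / m) * (2 * C * R) \<le> t0 / 2"

context regular_ctx
begin

lemma regular_patch_exists:
  assumes p: "p \<in> fst c" "c \<in> A" and \<rho>: "\<rho> > 0"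
  shows "\<exists>R e m C t0. regular_patch A G T c (snd c p) R e m C t0 \<and> R \<le> \<rho>"
proof -
  obtain R0 e m C where g: "good_patch A G T c (snd c p) R0 e m C" using good_patch_exists[OF p] by blast
  interpret g: good_patch A G T c "snd c p" R0 e m C by fact
  \<comment> \<open>The length guaranteed for the straight segment of height \<open>R0 / 2\<close>
    below any point of the ball. It is fixed before the radius is shrunk, so the lengths available
    inside the smaller ball can be made small relative to it.\<close>
  define t0 where "t0 = R0 * m / 4"
  have t0: "t0 > 0" using g.R_pos g.m_pos by (simp add: t0_def)
  have low: "t0 \<le> tau (cinv c y)" if y: "y \<in> cball (snd c p) R0" for y
  proof -
    let ?z = "y - (R0/2) *\<^sub>R e"
    have "dist (snd c p) ?z \<le> dist (snd c p) y + dist y ?z" by (rule dist_triangle)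
    then have z: "?z \<in> cball (snd c p) (2 * R0)" using y g.norm_e g.R_pos by (simp add: dist_norm)
    have y2: "?z + ((R0/2) *\<^sub>R e + 0) \<in> cball (snd c p) (2 * R0)" using y g.R_pos by simp
    have "\<exists>L\<ge>(R0/2) * m / 2. carc (g.reg (2 * R0)) (cinv c ?z) (cinv c (?z + ((R0/2) *\<^sub>R e + 0))) L"
      by (rule g.carc_straight_line[OF z y2]) (use g.R_pos g.m_pos g.C_ge in auto)
    then obtain L where L: "L \<ge> (R0/2) * m / 2" "carc (g.reg (2 * R0)) (cinv c ?z) (cinv c y) L" by auto
    have "tau (cinv c ?z) + L \<le> tau (cinv c y)" by (rule tau_add[OF L(2)])
    then show ?thesis using L(1) tau_nonneg[of "cinv c ?z"] by (simp add: t0_def)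
  qed
  define R where "R = min (min R0 \<rho>) (t0 * m / (8 * C^2))"
  have R: "R > 0" "R \<le> R0" "R \<le> \<rho>" "R \<le> t0 * m / (8 * C^2)"
    using g.R_pos \<rho> t0 g.m_pos g.C_ge by (auto simp: R_def)
  have "regular_patch A G T c (snd c p) R e m C t0"
  proof (intro regular_patch.intro regular_patch_axioms.intro good_patch_shrink[OF g R(1,2)] t0)
    show "regular_ctx A G T" by unfold_locales
    show "t0 \<le> tau y" if "y \<in> cinv c ` cball (snd c p) R" for y
      using that low R(2) by auto
    have "8 * C^2 * R \<le> t0 * m" using R(4) g.C_ge by (simp add: field_simps)
    then show "2 * C / m * (2 * C * R) \<le> t0 / 2"
      using g.m_pos by (simp add: field_simps power2_eq_square)
  qed
  then show ?thesis using R(3) by blast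
qed

end

section \<open>Propagation of steepness to the frontier of a ball\<close>

context regular_patch
begin

lemma reg_ball_open: "s \<le> 2 * R \<Longrightarrow> open (cinv c ` ball o\<^sub>c s)"
  using sub by (intro open_cinv_image[OF cA]) (auto simp: subset_iff)

text \<open>A nearly maximal chain ending at \<open>y\<close> must have entered from outside.
  Cutting it at its last exit leaves an arc in the ball, where deformations are available, starting
  on the sphere.\<close>

lemma near_max:
  assumes y: "snd c y \<in> ball o\<^sub>c R" "y \<in> fst c" and h: "0 < h" "2 * h \<le> t0"
  obtains z w L1 L2 where "carc UNIV z w L1" "carc (reg R) w y L2" "norm (snd c w - o\<^sub>c) = R" "tau y < L1 + L2 + h"
proof -
  have RR: "R \<le> 2 * R" using R_pos by simp
  let ?W = "cinv c ` ball o\<^sub>c R"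
  have Ws: "?W \<subseteq> reg R" by auto
  have comp: "compact (reg R)"
  proof (intro compact_continuous_image compact_cball continuous_on_subset[OF continuous_cinv[OF cA]])
    have "cball o\<^sub>c R \<subseteq> cball o\<^sub>c (2 * R)" using RR by (rule subset_cball)
    then show "cball o\<^sub>c R \<subseteq> cdom c" using sub by blast
  qed
  then have cl: "closure ?W \<subseteq> reg R" using Ws by (simp add: closure_minimal compact_imp_closed)
  have yW: "y \<in> ?W" using y cinv_snd[OF cA] by (metis imageI)
  obtain z L0 where z: "carc UNIV z y L0" "tau y < L0 + h" using h(1) by (rule tau_near)
  have "\<not> carc (UNIV \<inter> ?W) z y L0"
  proof
    assume "carc (UNIV \<inter> ?W) z y L0"
    then have cu: "carc (reg R) z y L0" using Ws by (auto intro: carc_mono)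
    then have "L0 \<le> (2 * C / m) * lam (snd c y - snd c z)" using carc_lam(2) carc_mono reg_mono[OF RR] by blast
    also have "\<dots> \<le> (2 * C / m) * (2 * C * R)"
    proof (rule mult_left_mono)
      have "snd c z \<in> cball o\<^sub>c R" "snd c y \<in> cball o\<^sub>c R" using snd_reg[OF RR] carc_props[OF cu] by auto
      from lam_ball[OF this(2,1)] show "lam (snd c y - snd c z) \<le> 2 * C * R" by (simp add: lam_lin)
      show "0 \<le> 2 * C / m" using m_pos C_ge by simp
    qed
    also have "\<dots> \<le> t0 / 2" by (rule cap)
    finally have "L0 \<le> t0 / 2" .
    moreover have "t0 \<le> tau y" using yW Ws tau_t0 by blast
    ultimately show False using z(2) h(2) by linarith
  qed
  then obtain w L1 L2 where w: "carc UNIV z w L1" "carc (UNIV \<inter> closure ?W) w y L2" "w \<in> closure ?W - ?W" "L0 = L1 + L2"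
    using carc_last_exit[OF z(1) reg_ball_open[OF RR] yW] by blast
  have "carc (reg R) w y L2" using carc_mono[OF w(2)] cl by simp
  moreover have "norm (snd c w - o\<^sub>c) = R"
  proof -
    have wr: "w \<in> reg R" using w(3) cl by blast
    then have "snd c w \<in> cball o\<^sub>c R" by (rule snd_reg[OF RR])
    moreover have "snd c w \<notin> ball o\<^sub>c R"
      using w(3) wr reg_fst[OF RR] cinv_snd[OF cA] by (metis DiffD2 imageI subsetD)
    ultimately show ?thesis by (simp add: dist_norm norm_minus_commute)
  qed
  ultimately show ?thesis using that w(1,4) z(2) by simp
qed

lemma shift_tau:
  assumes "carc (reg R) v y L" "0 < h" "h \<le> R / 2"
  obtains h' where "h \<le> h'" "h' \<le> 2 * h" "tau (cinv c (snd c v - h' *\<^sub>R e)) + L \<le> tau (cinv c (snd c y - h *\<^sub>R e))"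
proof -
  obtain h' L' where h: "h \<le> h'" "h' \<le> 2 * h" "L \<le> L'"
    "carc (reg (2 * R)) (cinv c (snd c v - h' *\<^sub>R e)) (cinv c (snd c y - h *\<^sub>R e)) L'"
    using carc_shift(1)[OF assms] by blast
  show ?thesis using that[OF h(1,2)] tau_add[OF h(4)] h(3) by linarith
qed

lemma carc_near:
  assumes "a \<in> cball o\<^sub>c (2 * R)" "b \<in> cball o\<^sub>c (2 * R)" "0 < h" "norm (b - a - h *\<^sub>R e) \<le> m / (4 * C) * h"
  shows "\<exists>L. carc (reg (2 * R)) (cinv c a) (cinv c b) L"
proof -
  have eq: "a + (h *\<^sub>R e + (b - a - h *\<^sub>R e)) = b" by simp
  show ?thesis using carc_straight_line[of a h "b - a - h *\<^sub>R e"] assms unfolding eq by blast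
qed

text \<open>A vertical step by \<open>h\<close> tolerates a horizontal error of
  \<open>m / (4 * C) * h\<close>, so all points of a small ball around \<open>p\<close> reach the
  same upper point.\<close>

lemma beyond_shift:
  assumes p: "p \<in> cball o\<^sub>c R" and h: "0 < h" "h \<le> R / 2"
  shows "beyond (cinv c (p + h *\<^sub>R e)) (cinv c p)"
  unfolding beyond_def
proof (intro exI conjI ballI)
  define \<sigma> where "\<sigma> = m / (4 * C) * h"
  have \<sigma>: "\<sigma> > 0" "\<sigma> \<le> h"
  proof -
    show "\<sigma> > 0" using m_pos C_ge h by (simp add: \<sigma>_def)
    have "m / (4 * C) \<le> 1" using m_le C_ge by (simp add: divide_le_eq)
    then have "m / (4 * C) * h \<le> 1 * h" using h by (intro mult_right_mono) auto
    then show "\<sigma> \<le> h" by (simp add: \<sigma>_def)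
  qed
  let ?V = "ball p \<sigma>"
  have Vs: "?V \<subseteq> cball o\<^sub>c (2 * R)"
  proof
    fix v assume "v \<in> ?V"
    then show "v \<in> cball o\<^sub>c (2 * R)" using dist_triangle[of o\<^sub>c v p] p \<sigma> h R_pos by simp
  qed
  have qb: "p + h *\<^sub>R e \<in> cball o\<^sub>c (2 * R)"
    using dist_triangle[of o\<^sub>c "p + h *\<^sub>R e" p] p h R_pos norm_e by (simp add: dist_norm)
  show "open (cinv c ` ?V)" using Vs sub by (intro open_cinv_image[OF cA]) auto
  show "cinv c p \<in> cinv c ` ?V" using \<sigma> by simp
  fix x assume "x \<in> cinv c ` ?V"
  then obtain v where v: "v \<in> ?V" "x = cinv c v" by blast
  have "\<exists>L. carc (reg (2 * R)) (cinv c v) (cinv c (p + h *\<^sub>R e)) L"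
  proof (rule carc_near[OF _ qb h(1)])
    show "v \<in> cball o\<^sub>c (2 * R)" using v Vs by blast
    show "norm (p + h *\<^sub>R e - v - h *\<^sub>R e) \<le> m / (4 * C) * h" using v by (simp add: dist_norm \<sigma>_def)
  qed
  then show "causal_le A G T x (cinv c (p + h *\<^sub>R e))" unfolding causal_le_carc v(2) using carc_mono by blast
qed

text \<open>Steepness of \<open>tau\<close> forces almost maximal arcs to be nearly null.\<close>

lemma short_arc:
  assumes \<epsilon>: "0 < \<epsilon>"
  shows "\<exists>\<kappa>>0. \<exists>K>0. \<forall>z w y L1 L2 h. carc UNIV z w L1 \<longrightarrow> carc (reg R) w y L2 \<longrightarrow> 0 < h \<longrightarrow> h \<le> \<kappa> \<longrightarrow>
    tau y < L1 + L2 + h \<longrightarrow> tau y - tau (cinv c (snd c y - h *\<^sub>R e)) \<ge> K * h \<longrightarrow> L2 < \<epsilon>"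
proof -
  have RR: "R \<le> 2 * R" using R_pos by simp
  define M where "M = 2 * C * R"
  have M: "M > 0" using C_ge R_pos by (simp add: M_def)
  \<comment> \<open>An arc of length at least \<epsilon> and extent at most \<open>M\<close> has,
    after the pigeonhole cut, a short piece whose length is at least \<delta> times its extent; to
    this piece \<open>carc_dilate\<close> applies.\<close>
  define \<delta> where "\<delta> = min 1 (\<epsilon> / M)"
  have \<delta>: "0 < \<delta>" "\<delta> \<le> 1" "\<delta> * M \<le> \<epsilon>" using \<epsilon> M by (auto simp: \<delta>_def min_def field_simps)
  obtain l0 k1 k2 where l: "l0 > 0" "k1 > 0" "k2 > 0" and dil: "\<And>x y L h. carc (reg R) x y L \<Longrightarrow> 0 < lam (snd c y - snd c x) \<Longrightarrow>
    lam (snd c y - snd c x) \<le> l0 \<Longrightarrow> \<delta> * lam (snd c y - snd c x) \<le> L \<Longrightarrow> 0 < h \<Longrightarrow> 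
    h \<le> k2 * lam (snd c y - snd c x) \<Longrightarrow> (\<exists>L'\<ge>L - k1 * h. carc (reg (2 * R)) x (cinv c (snd c y - h *\<^sub>R e)) L')"
    using carc_dilate[OF \<delta>(1,2)] by metis
  obtain n where n: "real (Suc n) * l0 \<ge> M"
  proof -
    obtain n where "M / l0 < real n" using reals_Archimedean2 by blast
    then have "M < real n * l0" using l(1) by (simp add: field_simps)
    also have "\<dots> \<le> real (Suc n) * l0" using l(1) by (intro mult_right_mono) auto
    finally show ?thesis by (intro that[of n] less_imp_le)
  qed
  define d where "d = M / real (Suc n)"
  have d: "0 < d" "d \<le> l0" "real (Suc n) * d = M" using M n by (auto simp: d_def field_simps)
  define e1 where "e1 = \<epsilon> / real (Suc n)"
  have e1: "e1 > 0" using \<epsilon> by (simp add: e1_def)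
  \<comment> \<open>The piece has length at least \<open>e1\<close>, so extent at least
    \<open>e1 * m / (2 * C)\<close>. A lowering by up to \<open>2 * \<kappa>\<close> is then within
    the range of \<open>carc_dilate\<close>.\<close>
  define \<kappa> where "\<kappa> = min (R / 2) (k2 * (e1 * m / (2 * C)) / 2)"
  have \<kappa>: "\<kappa> > 0" "\<kappa> \<le> R / 2" "2 * \<kappa> \<le> k2 * (e1 * m / (2 * C))"
    using R_pos l e1 m_pos C_ge by (auto simp: \<kappa>_def)
  have main: "L2 < \<epsilon>" if cu: "carc UNIV z w L1" "carc (reg R) w y L2" and h: "0 < h" "h \<le> \<kappa>" 
    and ty: "tau y < L1 + L2 + h" and q: "tau y - tau (cinv c (snd c y - h *\<^sub>R e)) \<ge> (2 + 2 * k1) * h" for z w y L1 L2 h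
  proof (rule ccontr)
    assume "\<not> L2 < \<epsilon>"
    then have L2: "\<epsilon> \<le> L2" by simp
    have "snd c w \<in> cball o\<^sub>c R" "snd c y \<in> cball o\<^sub>c R" using snd_reg[OF RR] carc_props[OF cu(2)] by auto
    from lam_ball[OF this(2,1)] have "lam (snd c y - snd c w) \<le> real (Suc n) * d" 
      unfolding d(3) M_def lam_lin by linarith
    from carc_pigeonhole[OF cu(2) this d(1)] obtain x' y' La L' Lb where
      P: "carc (reg R) w x' La" "carc (reg R) x' y' L'" "carc (reg R) y' y Lb" 
        "L2 = La + L' + Lb" "lam (snd c y' - snd c x') \<le> d" "L2 / real (Suc n) \<le> L'" by blast
    have P2: "carc (reg (2 * R)) x' y' L'" by (rule carc_mono[OF P(2) reg_mono[OF RR]])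
    let ?l = "lam (snd c y' - snd c x')"
    have "e1 \<le> L2 / real (Suc n)" unfolding e1_def using L2 by (intro divide_right_mono) auto
    then have L'e: "e1 \<le> L'" using P(6) by linarith
    have "L' \<le> (2 * C / m) * ?l" by (rule carc_lam(2)[OF P2])
    then have "e1 \<le> (2 * C / m) * ?l" using L'e by linarith
    then have le: "e1 * m / (2 * C) \<le> ?l" using m_pos C_ge by (simp add: field_simps)
    have l0: "0 < ?l"
    proof -
      have "0 < e1 * m / (2 * C)" using e1 m_pos C_ge by simp
      then show ?thesis using le by linarith
    qed
    have "\<delta> * ?l \<le> \<delta> * d" using P(5) \<delta> by (intro mult_left_mono) auto
    also have "\<dots> \<le> e1" using \<delta>(3) by (simp add: d_def e1_def divide_right_mono)
    finally have \<delta>l: "\<delta> * ?l \<le> L'" using L'e by linarith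
    obtain h' where h': "h \<le> h'" "h' \<le> 2 * h" 
      "tau (cinv c (snd c y' - h' *\<^sub>R e)) + Lb \<le> tau (cinv c (snd c y - h *\<^sub>R e))"
      using shift_tau[OF P(3) h(1)] h(2) \<kappa>(2) by auto
    have "h' \<le> 2 * \<kappa>" using h' h by linarith
    also have "\<dots> \<le> k2 * (e1 * m / (2 * C))" by (rule \<kappa>)
    also have "\<dots> \<le> k2 * ?l" using le l by (intro mult_left_mono) auto
    finally have hk: "h' \<le> k2 * ?l" .
    have "0 < h'" using h h' by linarith
    with dil[OF P(2) l0 _ \<delta>l _ hk] P(5) d(2) obtain M' where 
      M': "M' \<ge> L' - k1 * h'" "carc (reg (2 * R)) x' (cinv c (snd c y' - h' *\<^sub>R e)) M'" by auto
    have t1: "tau x' + M' \<le> tau (cinv c (snd c y' - h' *\<^sub>R e))" by (rule tau_add[OF M'(2)])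
    have "carc UNIV z x' (L1 + La)" by (rule carc_trans[OF carc_mono[OF P(1) subset_UNIV] cu(1)])
    then have t2: "L1 + La \<le> tau x'" by (rule tau_ge)
    have k: "k1 * h' \<le> k1 * (2 * h)" using h' l by (intro mult_left_mono) auto
    \<comment> \<open>Lowering the final part costs nothing, dilating the middle piece costs at most
      \<open>2 * k1 * h\<close>, and the first part is untouched; with the defect \<open>h\<close>
      of near maximality the drop of \<open>tau\<close> is below
      \<open>(1 + 2 * k1) * h\<close>.\<close>
    have "(2 + 2 * k1) * h = h + h + k1 * (2 * h)" by (simp add: algebra_simps)
    then show False using q ty P(4) t1 t2 M'(1) h'(3) k h(1) by linarith
  qed
  have "0 < 2 + 2 * k1" using l by simp
  then show ?thesis
    using main \<kappa>(1) by (intro exI[of _ \<kappa>] exI[of _ "2 + 2 * k1"] conjI) blast+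
qed

lemma nonlip_step_approx:
  assumes bad: "nonlip c c0 p" and p: "snd c p \<in> ball o\<^sub>c (R / 2)" and \<epsilon>: "0 < \<epsilon>"
  shows "\<exists>y w L h. carc (reg R) w y L \<and> norm (snd c y - snd c p) < \<epsilon> \<and> norm (snd c w - o\<^sub>c) = R \<and>
    0 < h \<and> h < \<epsilon> \<and> h < \<epsilon> * (tau w - tau (cinv c (snd c w - h *\<^sub>R e))) \<and> tau w > c0 - \<epsilon>"
proof -
  have RR: "R \<le> 2 * R" using R_pos by simp
  obtain \<kappa> K where \<kappa>: "\<kappa> > 0" "K > 0" and short: "\<And>z w y L1 L2 h. carc UNIV z w L1 \<Longrightarrow> carc (reg R) w y L2 \<Longrightarrow> 0 < h \<Longrightarrow> h \<le> \<kappa> \<Longrightarrow>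
    tau y < L1 + L2 + h \<Longrightarrow> tau y - tau (cinv c (snd c y - h *\<^sub>R e)) \<ge> K * h \<Longrightarrow> L2 < \<epsilon> / 2"
    using short_arc[of "\<epsilon> / 2"] \<epsilon> by (metis half_gt_zero)
  \<comment> \<open>With \<open>h = K1 * r\<close> the point \<open>x\<close>, at chart distance
    \<open>r\<close> from \<open>y\<close>, lies to the future of
    \<open>snd c y - h *\<^sub>R e\<close>. Steepness between \<open>x\<close> and \<open>y\<close>
    thus becomes steepness along \<open>e\<close>.\<close>
  define K1 where "K1 = 4 * C / m"
  have K1: "K1 \<ge> 1" using m_le m_pos C_ge by (simp add: K1_def field_simps)
  define b where "b = Min {\<epsilon>, R, t0, \<kappa>}"
  have b: "b > 0" "b \<le> \<epsilon>" "b \<le> R" "b \<le> t0" "b \<le> \<kappa>" using \<epsilon> R_pos t0_pos \<kappa> by (auto simp: b_def)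
  \<comment> \<open>\<open>K\<close> is what \<open>short_arc\<close> asks for. In the other bound
    the 1 covers the error \<open>h\<close> of near maximality, and the 2 the possible doubling of
    \<open>h\<close> under the shift.\<close>
  define N where "N = max K (2 / \<epsilon> + 1)"
  \<comment> \<open>The first bound gives \<open>4 * h < b\<close>; the second converts difference
    quotients above \<open>1 / \<epsilon>0\<close> into a drop of at least
    \<open>N * h\<close>.\<close>
  define \<epsilon>0 where "\<epsilon>0 = min (b / (8 * K1)) (1 / (K1 * N))"
  have N: "N > 0" "K \<le> N" "2 / \<epsilon> + 1 \<le> N" using \<kappa> by (auto simp: N_def)
  have e0: "\<epsilon>0 > 0" "8 * K1 * \<epsilon>0 \<le> b" "K1 * N * \<epsilon>0 \<le> 1"
  proof -
    show "\<epsilon>0 > 0" using b K1 N by (simp add: \<epsilon>0_def)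
    have "\<epsilon>0 \<le> b / (8 * K1)" "\<epsilon>0 \<le> 1 / (K1 * N)" by (auto simp: \<epsilon>0_def)
    then show "8 * K1 * \<epsilon>0 \<le> b" "K1 * N * \<epsilon>0 \<le> 1" using K1 N by (auto simp: field_simps)
  qed
  have e01: "8 * \<epsilon>0 \<le> b"
  proof -
    have "1 * (8 * \<epsilon>0) \<le> K1 * (8 * \<epsilon>0)" using e0(1) K1 by (intro mult_right_mono) auto
    then show ?thesis using e0(2) by simp
  qed
  obtain x y where xy: "x \<in> fst c" "y \<in> fst c" "norm (snd c x - snd c p) < \<epsilon>0" "norm (snd c y - snd c p) < \<epsilon>0"
      "norm (snd c y - snd c x) < \<epsilon>0 * (tau y - tau x)" "tau y > c0 - \<epsilon>0"
    using bad e0(1) unfolding nonlip_def by blast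
  define r where "r = norm (snd c y - snd c x)"
  have tyx: "0 < tau y - tau x"
  proof -
    have "0 < \<epsilon>0 * (tau y - tau x)" using xy(5) norm_ge_zero[of "snd c y - snd c x"] by linarith
    then show ?thesis using e0(1) by (simp add: zero_less_mult_iff)
  qed
  have r0: "r > 0"
  proof (rule ccontr)
    assume "\<not> r > 0"
    then have "snd c y = snd c x" by (simp add: r_def)
    then have "y = x" using cinv_snd[OF cA] xy(1,2) by metis
    then show False using tyx by simp
  qed
  have r2: "r < 2 * \<epsilon>0"
    using norm_triangle_ineq4[of "snd c y - snd c p" "snd c x - snd c p"] xy(3,4) by (simp add: r_def)
  define h where "h = K1 * r"
  have h0: "h > 0" using K1 r0 by (simp add: h_def)
  have h4: "4 * h < b"
  proof -
    have "K1 * r < K1 * (2 * \<epsilon>0)" using r2 K1 by simp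
    then show ?thesis using e0(2) by (simp add: h_def)
  qed
  have inb: "snd c z \<in> ball o\<^sub>c R" if "norm (snd c z - snd c p) < \<epsilon>0" for z
  proof -
    have "dist o\<^sub>c (snd c z) \<le> dist o\<^sub>c (snd c p) + dist (snd c p) (snd c z)" by (rule dist_triangle)
    then show ?thesis using that p e01 b by (simp add: dist_norm norm_minus_commute)
  qed
  have Nh: "N * h \<le> tau y - tau (cinv c (snd c y - h *\<^sub>R e))"
  proof -
    let ?z = "snd c y - h *\<^sub>R e"
    have "dist o\<^sub>c ?z \<le> dist o\<^sub>c (snd c y) + dist (snd c y) ?z" by (rule dist_triangle)
    then have z: "?z \<in> cball o\<^sub>c (2 * R)" using inb[OF xy(4)] h0 h4 b norm_e by (simp add: dist_norm)
    have eq: "?z + (h *\<^sub>R e + (snd c x - snd c y)) = snd c x" by simp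
    have xb: "?z + (h *\<^sub>R e + (snd c x - snd c y)) \<in> cball o\<^sub>c (2 * R)"
      unfolding eq using inb[OF xy(3)] R_pos by simp
    have "norm (snd c x - snd c y) \<le> m / (4 * C) * h"
      using m_pos C_ge by (simp add: h_def K1_def r_def norm_minus_commute)
    from carc_straight_line[OF z xb h0 this] obtain L where "carc (reg (2 * R)) (cinv c ?z) (cinv c (snd c x)) L"
      unfolding eq by blast
    then have "tau (cinv c ?z) \<le> tau x" using tau_mono cinv_snd[OF cA xy(1)] by metis
    moreover have "N * h \<le> tau y - tau x"
    proof -
      have "N * h \<le> N * (K1 * (\<epsilon>0 * (tau y - tau x)))"
        unfolding h_def using xy(5) N K1 by (intro mult_left_mono) (auto simp: r_def)
      also have "\<dots> = (K1 * N * \<epsilon>0) * (tau y - tau x)" by simp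
      also have "\<dots> \<le> 1 * (tau y - tau x)" using e0(3) tyx by (intro mult_right_mono) auto
      finally show ?thesis by simp
    qed
    ultimately show ?thesis by linarith
  qed
  have h2: "2 * h \<le> t0" and hR: "h \<le> R / 2" using h4 h0 b by linarith+
  obtain z w L1 L2 where w: "carc UNIV z w L1" "carc (reg R) w y L2" "norm (snd c w - o\<^sub>c) = R" "tau y < L1 + L2 + h"
    using near_max[OF inb[OF xy(4)] xy(2) h0 h2] by blast
  have "K * h \<le> N * h" using N h0 by (intro mult_right_mono) auto
  then have L2: "L2 < \<epsilon> / 2" using short[OF w(1,2) h0 _ w(4)] Nh h4 h0 b by linarith
  have tw: "L1 \<le> tau w" by (rule tau_ge[OF w(1)])
  \<comment> \<open>Since \<open>tau w\<close> is at least \<open>L1\<close>, and the shifted arc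
    keeps length \<open>L2\<close>, the drop of \<open>tau\<close> below \<open>w\<close> is at
    least the drop below \<open>y\<close> minus \<open>h\<close>.\<close>
  obtain h' where h': "h \<le> h'" "h' \<le> 2 * h" "tau (cinv c (snd c w - h' *\<^sub>R e)) + L2 \<le> tau (cinv c (snd c y - h *\<^sub>R e))"
    using shift_tau[OF w(2) h0 hR] by blast
  have "(2 / \<epsilon> + 1) * h \<le> N * h" using N h0 by (intro mult_right_mono) auto
  then have "(2 / \<epsilon>) * h < tau w - tau (cinv c (snd c w - h' *\<^sub>R e))"
    using Nh h'(3) w(4) tw by (simp add: algebra_simps)
  then have "\<epsilon> * ((2 / \<epsilon>) * h) < \<epsilon> * (tau w - tau (cinv c (snd c w - h' *\<^sub>R e)))" using \<epsilon> by (intro mult_strict_left_mono)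
  then have q: "h' < \<epsilon> * (tau w - tau (cinv c (snd c w - h' *\<^sub>R e)))" using h' \<epsilon> by simp
  have "tau w > c0 - \<epsilon>" using w(4) tw xy(6) L2 h4 h0 e01 b by linarith
  moreover have "norm (snd c y - snd c p) < \<epsilon>" using xy(4) e01 b e0(1) by linarith
  moreover have "0 < h'" "h' < \<epsilon>" using h' h0 h4 b by linarith+
  ultimately show ?thesis using w(2,3) q by blast
qed

text \<open>The final clause is what remains of an arc from \<open>p'\<close> to \<open>p\<close>:
  the arcs have ends converging to these points, and lifted slightly they join a point just above
  \<open>p'\<close> to a point below \<open>q\<close>.\<close>

lemma nonlip_step:
  assumes bad: "nonlip c c0 p" and p: "snd c p \<in> ball o\<^sub>c (R / 2)"
  shows "\<exists>p'. p' \<in> fst c \<and> norm (snd c p' - o\<^sub>c) = R \<and> nonlip c c0 p' \<and>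
    (\<forall>q W. beyond q p \<longrightarrow> open W \<longrightarrow> p' \<in> W \<longrightarrow> (\<exists>q'\<in>W. beyond q' p' \<and> causal_le A G T q' q))"
proof -
  have RR: "R \<le> 2 * R" using R_pos by simp
  have "\<forall>n. \<exists>y w L h. carc (reg R) w y L \<and> norm (snd c y - snd c p) < 1 / real (Suc n) \<and> norm (snd c w - o\<^sub>c) = R \<and>
    0 < h \<and> h < 1 / real (Suc n) \<and> h < 1 / real (Suc n) * (tau w - tau (cinv c (snd c w - h *\<^sub>R e))) \<and> tau w > c0 - 1 / real (Suc n)"
    by (intro allI nonlip_step_approx[OF bad p]) simp
  then obtain y w L h where S: "\<And>n. carc (reg R) (w n) (y n) (L n)" "\<And>n. norm (snd c (y n) - snd c p) < 1 / real (Suc n)"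
    "\<And>n. norm (snd c (w n) - o\<^sub>c) = R" "\<And>n. 0 < h n" "\<And>n. h n < 1 / real (Suc n)" 
    "\<And>n. h n < 1 / real (Suc n) * (tau (w n) - tau (cinv c (snd c (w n) - h n *\<^sub>R e)))" "\<And>n. tau (w n) > c0 - 1 / real (Suc n)"
    by metis
  have "compact (sphere o\<^sub>c R)" by simp
  moreover have "\<forall>n. snd c (w n) \<in> sphere o\<^sub>c R" using S(3) by (simp add: dist_norm norm_minus_commute)
  ultimately obtain p1 s where s: "p1 \<in> sphere o\<^sub>c R" "strict_mono s" "((\<lambda>n. snd c (w n)) \<circ> s) \<longlonglongrightarrow> p1"
    unfolding compact_def by meson
  have pick: "\<exists>n. norm (snd c (w n) - p1) < \<epsilon> \<and> 1 / real (Suc n) < \<epsilon>" if \<epsilon>: "\<epsilon> > 0" for \<epsilon>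
  proof -
    have "\<forall>\<^sub>F n in sequentially. dist (((\<lambda>n. snd c (w n)) \<circ> s) n) p1 < \<epsilon>" using s(3) \<epsilon> by (rule tendstoD)
    moreover have "\<forall>\<^sub>F n in sequentially. 1 / real (Suc n) < \<epsilon>"
      using order_tendstoD(2)[OF LIMSEQ_inverse_real_of_nat \<epsilon>] by (simp add: inverse_eq_divide)
    ultimately have "\<forall>\<^sub>F n in sequentially. norm (snd c (w (s n)) - p1) < \<epsilon> \<and> 1 / real (Suc (s n)) < \<epsilon>"
    proof eventually_elim
      case (elim n)
      have "1 / real (Suc (s n)) \<le> 1 / real (Suc n)" 
        using seq_suble[OF s(2), of n] by (intro divide_left_mono) auto
      then show ?case using elim by (simp add: dist_norm)
    qed
    then show ?thesis using eventually_happens'[OF sequentially_bot] by blast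
  qed
  have p1d: "p1 \<in> cdom c" using s(1) sub R_pos by (auto simp: subset_iff)
  define p' where "p' = cinv c p1"
  have p': "p' \<in> fst c" "snd c p' = p1" using p1d cinv_in[OF cA] snd_cinv[OF cA] by (auto simp: p'_def)
  have wf: "w n \<in> fst c" "snd c (w n) \<in> cball o\<^sub>c R" for n using S(1)[of n] carc_props reg_fst[OF RR] snd_reg[OF RR] by blast+
  have yf: "y n \<in> fst c" "snd c (y n) \<in> cball o\<^sub>c R" for n using S(1)[of n] carc_props reg_fst[OF RR] snd_reg[OF RR] by blast+
  have "norm (snd c p' - o\<^sub>c) = R" using p' s(1) by (simp add: dist_norm norm_minus_commute)
  moreover have "nonlip c c0 p'"
    unfolding nonlip_def
  proof (intro conjI cA p' allI impI)
    fix \<epsilon> :: real assume \<epsilon>: "\<epsilon> > 0"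
    define \<epsilon>' where "\<epsilon>' = min (\<epsilon> / 2) (R / 2)"
    have e': "\<epsilon>' > 0" "2 * \<epsilon>' \<le> \<epsilon>" "\<epsilon>' \<le> R" using \<epsilon> R_pos by (auto simp: \<epsilon>'_def)
    obtain n where n: "norm (snd c (w n) - p1) < \<epsilon>'" "1 / real (Suc n) < \<epsilon>'" using pick[OF e'(1)] by blast
    \<comment> \<open>The lower witness at \<open>p'\<close>: straight below \<open>w n\<close>, at
      distance \<open>h n\<close>.\<close>
    let ?u = "snd c (w n) - h n *\<^sub>R e"
    have hn: "h n < \<epsilon>'" using S(5)[of n] n by linarith
    have "dist o\<^sub>c ?u \<le> dist o\<^sub>c (snd c (w n)) + dist (snd c (w n)) ?u" by (rule dist_triangle)
    then have u: "?u \<in> cball o\<^sub>c (2 * R)" using wf(2)[of n] hn e' S(4)[of n] norm_e by (simp add: dist_norm)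
    then have ud: "?u \<in> cdom c" using sub by blast
    let ?x = "cinv c ?u"
    have x: "?x \<in> fst c" "snd c ?x = ?u" using ud cinv_in[OF cA] snd_cinv[OF cA] by auto
    have "norm (snd c ?x - snd c p') \<le> norm (snd c (w n) - p1) + norm (h n *\<^sub>R e)"
      unfolding x p' using norm_triangle_ineq4[of "snd c (w n) - p1" "h n *\<^sub>R e"] by (simp add: algebra_simps)
    then have 1: "norm (snd c ?x - snd c p') < \<epsilon>" using n hn e' S(4)[of n] norm_e by simp
    have 2: "norm (snd c (w n) - snd c p') < \<epsilon>" using n e' p' by simp
    have tp: "0 < tau (w n) - tau ?x"
    proof -
      have "0 < 1 / real (Suc n) * (tau (w n) - tau ?x)" using S(4)[of n] S(6)[of n] by linarith
      then show ?thesis by (simp add: zero_less_divide_iff)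
    qed
    have "1 / real (Suc n) * (tau (w n) - tau ?x) \<le> \<epsilon> * (tau (w n) - tau ?x)"
      using n e' tp by (intro mult_right_mono) auto
    then have 3: "norm (snd c (w n) - snd c ?x) < \<epsilon> * (tau (w n) - tau ?x)"
      using S(4)[of n] S(6)[of n] norm_e unfolding x by simp
    have 4: "tau (w n) > c0 - \<epsilon>" using S(7)[of n] n e' by linarith
    show "\<exists>x\<in>fst c. \<exists>y\<in>fst c. norm (snd c x - snd c p') < \<epsilon> \<and> norm (snd c y - snd c p') < \<epsilon> \<and>
        norm (snd c y - snd c x) < \<epsilon> * (tau y - tau x) \<and> c0 - \<epsilon> < tau y"
      using 1 2 3 4 x wf by blast
  qed
  moreover have "\<exists>q'\<in>W. beyond q' p' \<and> causal_le A G T q' q" if beyond: "beyond q p" and W: "open W" "p' \<in> W" for q W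
  proof -
    have pf: "p \<in> fst c" using bad by (simp add: nonlip_def)
    obtain U where U: "open U" "p \<in> U" "\<And>x. x \<in> U \<Longrightarrow> causal_le A G T x q" using beyond by (auto simp: beyond_def)
    have ocv: "open (cdom c \<inter> cinv c -` V)" if "open V" for V
      by (rule continuous_open_preimage[OF continuous_cinv[OF cA] chart_open(2)[OF cA] that])
    obtain \<eta>1 where \<eta>1: "\<eta>1 > 0" "ball (snd c p) \<eta>1 \<subseteq> cdom c \<inter> cinv c -` U"
    proof -
      have "snd c p \<in> cdom c \<inter> cinv c -` U" using pf U cA by simp
      then show ?thesis using ocv[OF U(1)] that unfolding open_contains_ball by blast
    qed
    obtain \<eta>2 where \<eta>2: "\<eta>2 > 0" "ball p1 \<eta>2 \<subseteq> cdom c \<inter> cinv c -` W"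
    proof -
      have "p1 \<in> cdom c \<inter> cinv c -` W" using p1d W by (simp add: p'_def)
      then show ?thesis using ocv[OF W(1)] that unfolding open_contains_ball by blast
    qed
    define \<eta> where "\<eta> = Min {\<eta>1 / 2, \<eta>2, R / 2}"
    have \<eta>: "\<eta> > 0" "2 * \<eta> \<le> \<eta>1" "\<eta> \<le> \<eta>2" "\<eta> \<le> R / 2" using \<eta>1 \<eta>2 R_pos by (auto simp: \<eta>_def)
    \<comment> \<open>The horizontal error allowed for a vertical step of \<open>\<eta> / 4\<close>,
      which is the least height difference occurring below.\<close>
    define \<sigma> where "\<sigma> = m / (4 * C) * (\<eta> / 4)"
    have \<sigma>: "\<sigma> > 0" "\<sigma> \<le> \<eta>"
    proof -
      show "\<sigma> > 0" using m_pos C_ge \<eta> by (simp add: \<sigma>_def)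
      have "m / (4 * C) \<le> 1" using m_le C_ge by (simp add: divide_le_eq)
      then have "m / (4 * C) * (\<eta> / 4) \<le> 1 * (\<eta> / 4)" using \<eta> by (intro mult_right_mono) auto
      then show "\<sigma> \<le> \<eta>" unfolding \<sigma>_def using \<eta>(1) by linarith
    qed
    obtain n where n: "norm (snd c (w n) - p1) < \<sigma>" "1 / real (Suc n) < \<sigma>" using pick[OF \<sigma>(1)] by blast
    have yU: "cinv c (snd c (y n) + \<eta> *\<^sub>R e) \<in> U"
    proof -
      have "norm (snd c (y n) + \<eta> *\<^sub>R e - snd c p) \<le> norm (snd c (y n) - snd c p) + norm (\<eta> *\<^sub>R e)"
        using norm_triangle_ineq[of "snd c (y n) - snd c p" "\<eta> *\<^sub>R e"] by (simp add: algebra_simps)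
      also have "\<dots> < \<eta>1" using S(2)[of n] n(2) \<sigma> \<eta> norm_e by simp
      finally have "snd c (y n) + \<eta> *\<^sub>R e \<in> ball (snd c p) \<eta>1" by (simp add: dist_norm norm_minus_commute)
      then show ?thesis using \<eta>1(2) by blast
    qed
    \<comment> \<open>The lifted arc ends in \<open>U\<close>, hence below \<open>q\<close>, and
      starts at least \<open>\<eta> / 2\<close> above \<open>w n\<close>. As \<open>w n\<close> is
      within \<sigma> of \<open>p1\<close>, this start is in the future of \<open>?q\<close>, which
      lies only \<open>\<eta> / 4\<close> above \<open>p1\<close>.\<close>
    obtain h' L' where h': "\<eta> / 2 \<le> h'" "h' \<le> \<eta>" 
      "carc (reg (2 * R)) (cinv c (snd c (w n) + h' *\<^sub>R e)) (cinv c (snd c (y n) + \<eta> *\<^sub>R e)) L'"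
      using carc_shift(2)[OF S(1) \<eta>(1,4)] by blast
    let ?q = "p1 + (\<eta> / 4) *\<^sub>R e"
    have sph: "dist o\<^sub>c p1 = R" using s(1) by simp
    have qb: "?q \<in> cball o\<^sub>c (2 * R)"
      using dist_triangle[of o\<^sub>c ?q p1] sph \<eta> norm_e by (simp add: dist_norm)
    have qW: "cinv c ?q \<in> W"
    proof -
      have "?q \<in> ball p1 \<eta>2" using \<eta> norm_e by (simp add: dist_norm)
      then show ?thesis using \<eta>2(2) by blast
    qed
    have q1: "\<exists>L. carc (reg (2 * R)) (cinv c ?q) (cinv c (snd c (w n) + h' *\<^sub>R e)) L"
    proof (rule carc_near[OF qb])
      show "snd c (w n) + h' *\<^sub>R e \<in> cball o\<^sub>c (2 * R)"
        using dist_triangle[of o\<^sub>c "snd c (w n) + h' *\<^sub>R e" "snd c (w n)"] wf(2)[of n] h' \<eta> norm_e by (simp add: dist_norm)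
      show "0 < h' - \<eta> / 4" using h' \<eta> by linarith
      have eq: "snd c (w n) + h' *\<^sub>R e - ?q - (h' - \<eta> / 4) *\<^sub>R e = snd c (w n) - p1" by (simp add: algebra_simps)
      have "\<sigma> \<le> m / (4 * C) * (h' - \<eta> / 4)"
        unfolding \<sigma>_def
      proof (rule mult_left_mono)
        show "\<eta> / 4 \<le> h' - \<eta> / 4" using h'(1) by simp
        show "0 \<le> m / (4 * C)" using m_pos C_ge by simp
      qed
      then show "norm (snd c (w n) + h' *\<^sub>R e - ?q - (h' - \<eta> / 4) *\<^sub>R e) \<le> m / (4 * C) * (h' - \<eta> / 4)" 
        unfolding eq by (rule order_trans[OF less_imp_le[OF n(1)]])
    qed
    obtain M where "carc (reg (2 * R)) (cinv c ?q) (cinv c (snd c (w n) + h' *\<^sub>R e)) M" using q1 by blast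
    then have "carc (reg (2 * R)) (cinv c ?q) (cinv c (snd c (y n) + \<eta> *\<^sub>R e)) (M + L')"
      by (rule carc_trans[OF h'(3)])
    then have c1: "carc UNIV (cinv c ?q) (cinv c (snd c (y n) + \<eta> *\<^sub>R e)) (M + L')"
      by (rule carc_mono[OF _ subset_UNIV])
    obtain M' where "carc UNIV (cinv c (snd c (y n) + \<eta> *\<^sub>R e)) q M'"
      using U(3)[OF yU] unfolding causal_le_carc by blast
    from carc_trans[OF this c1] have le: "causal_le A G T (cinv c ?q) q"
      unfolding causal_le_carc by blast
    have "beyond (cinv c ?q) p'"
      unfolding p'_def by (rule beyond_shift) (use sph \<eta> in auto)
    then show ?thesis using qW le by blast
  qed
  ultimately show ?thesis using p'(1) by blast
qed

end

section \<open>Concatenating curves\<close>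

context spacetime_ctx
begin

lemma past_seg_shift:
  assumes "past_causal_seg A G T s t \<alpha>" "s' + b = s" "t' + b = t"
    "\<And>\<tau>. \<tau> \<in> {s'..t'} \<Longrightarrow> \<alpha>' \<tau> = \<alpha> (\<tau> + b)"
  shows "past_causal_seg A G T s' t' \<alpha>'"
proof -
  have st: "s < t" using assms(1) by (auto simp: past_causal_seg_def smooth_seg_def)
  have "fut_causal_seg A G T (-t') (-s') (\<lambda>\<tau>. \<alpha>' (-\<tau>))"
    by (rule seglen_reparam(1)[OF past_causal_seg_reverse[OF assms(1)], of _ _ 1 "-b"]) (use assms st in auto)
  from fut_causal_seg_reverse[OF this] show ?thesis by simp
qed

definition pcurve :: "(real \<Rightarrow> 'a) \<Rightarrow> real \<Rightarrow> real \<Rightarrow> bool" where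
  "pcurve \<alpha> a b \<longleftrightarrow> (\<exists>k s. fut_causal_curve A G T \<alpha> a b k s)"

lemma pcurve_affine:
  assumes "pcurve \<alpha> a b" "m > 0" "m * a' + c = a" "m * b' + c = b"
    and eq: "\<And>\<tau>. \<tau> \<in> {a'..b'} \<Longrightarrow> \<alpha>' \<tau> = \<alpha> (m * \<tau> + c)"
  shows "pcurve \<alpha>' a' b'"
proof -
  obtain k s where c: "fut_causal_curve A G T \<alpha> a b k s" using assms(1) by (auto simp: pcurve_def)
  then have p: "is_partition a b k s" and sg: "\<And>i. i < k \<Longrightarrow> fut_causal_seg A G T (s i) (s (Suc i)) \<alpha>"
    by (auto simp: fut_causal_curve_def)
  let ?s = "\<lambda>i. (s i - c) / m"
  have p': "is_partition a' b' k ?s" using p assms(2-4) by (auto simp: is_partition_def field_simps)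
  have "fut_causal_seg A G T (?s i) (?s (Suc i)) \<alpha>'" if i: "i < k" for i
  proof (rule seglen_reparam(1)[OF sg[OF i] _ assms(2)])
    show "?s i < ?s (Suc i)" using p' i unfolding is_partition_def by blast
    show "m * ?s i + c = s i" "m * ?s (Suc i) + c = s (Suc i)" using assms(2) by auto
    fix \<tau> assume "\<tau> \<in> {?s i..?s (Suc i)}"
    moreover have "a' \<le> ?s i" "?s (Suc i) \<le> b'"
      using partition_mono[OF p', of 0 i] partition_mono[OF p', of "Suc i" k] p' i by (auto simp: is_partition_def)
    ultimately show "\<alpha>' \<tau> = \<alpha> (m * \<tau> + c)" by (intro eq) auto
  qed
  with p' show ?thesis unfolding pcurve_def fut_causal_curve_def by blast
qed

lemma pcurve_refl: "pcurve \<alpha> a a"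
  unfolding pcurve_def fut_causal_curve_def is_partition_def
  by (rule exI[of _ 0], rule exI[of _ "\<lambda>_. a"]) simp

lemma pcurve_append_seg:
  assumes "pcurve \<alpha> a b" "fut_causal_seg A G T b c \<alpha>" shows "pcurve \<alpha> a c"
proof -
  obtain k s where c: "is_partition a b k s" "\<And>i. i < k \<Longrightarrow> fut_causal_seg A G T (s i) (s (Suc i)) \<alpha>"
    using assms(1) by (auto simp: pcurve_def fut_causal_curve_def)
  have "is_partition a c (Suc k) (s(Suc k := c))"
    using c(1) seg_facts(1)[OF assms(2)] by (auto simp: is_partition_def less_Suc_eq)
  moreover have "fut_causal_seg A G T ((s(Suc k := c)) i) ((s(Suc k := c)) (Suc i)) \<alpha>" if "i < Suc k" for i
    using that c assms(2) by (cases "i = k") (auto simp: is_partition_def)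
  ultimately show ?thesis unfolding pcurve_def fut_causal_curve_def by blast
qed

lemma pcurve_trans:
  assumes "pcurve \<alpha> a b" "pcurve \<alpha> b c" shows "pcurve \<alpha> a c"
proof -
  obtain k s where c: "is_partition b c k s" "\<And>i. i < k \<Longrightarrow> fut_causal_seg A G T (s i) (s (Suc i)) \<alpha>"
    using assms(2) by (auto simp: pcurve_def fut_causal_curve_def)
  have "pcurve \<alpha> a (s i)" if "i \<le> k" for i
    using that
  proof (induction i)
    case 0 then show ?case using c(1) assms(1) by (simp add: is_partition_def)
  next
    case (Suc i) then show ?case using pcurve_append_seg c(2) by simp
  qed
  from this[of k] show ?thesis using c(1) by (simp add: is_partition_def)
qed

lemma pcurve_restrict:
  assumes "pcurve \<alpha> a b" "a \<le> c" "c \<le> b" shows "pcurve \<alpha> c b"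
proof -
  obtain k s where s: "is_partition a b k s" "\<And>i. i < k \<Longrightarrow> fut_causal_seg A G T (s i) (s (Suc i)) \<alpha>"
    using assms(1) by (auto simp: pcurve_def fut_causal_curve_def)
  have "pcurve \<alpha> c (s i)" if "i \<le> k" "c \<le> s i" for i
    using that
  proof (induction i)
    case 0 then show ?case using s(1) assms(2) pcurve_refl[of \<alpha> c] by (simp add: is_partition_def)
  next
    case (Suc i)
    show ?case
    proof (cases "c \<le> s i")
      case True then show ?thesis using Suc pcurve_append_seg s(2) by simp
    next
      case False
      then consider "c = s (Suc i)" | "s i < c" "c < s (Suc i)" using Suc by linarith
      then show ?thesis
      proof cases
        case 1 then show ?thesis using pcurve_refl by simp
      next
        case 2
        have "fut_causal_seg A G T (s i) (s (Suc i)) \<alpha>" using s(2) Suc by simp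
        from seg_restrict(1)[OF this _ 2(2)] 2 have "fut_causal_seg A G T c (s (Suc i)) \<alpha>" by simp
        then show ?thesis by (rule pcurve_append_seg[OF pcurve_refl])
      qed
    qed
  qed
  from this[of k] show ?thesis using s(1) assms(3) by (simp add: is_partition_def)
qed

lemma causal_le_pcurve:
  assumes "causal_le A G T x y" "x \<noteq> y" "a < b"
  obtains \<alpha> where "pcurve \<alpha> a b" "\<alpha> a = x" "\<alpha> b = y"
proof -
  obtain L where "carc UNIV x y L" using assms(1) causal_le_carc by blast
  from carc_curve[OF this, of a] obtain \<beta> b' k s where 
    b: "fut_causal_curve A G T \<beta> a b' k s" "\<beta> a = x" "\<beta> b' = y" "a < b'" using assms(2) by blast
  define m where "m = (b' - a) / (b - a)"
  have m: "m > 0" "m * a + (a - m * a) = a" "m * b + (a - m * a) = b'"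
  proof -
    show "m > 0" "m * a + (a - m * a) = a" using b(4) assms(3) by (auto simp: m_def)
    have "m * (b - a) = b' - a" using assms(3) by (simp add: m_def)
    then show "m * b + (a - m * a) = b'" by (simp add: algebra_simps)
  qed
  have "pcurve (\<lambda>\<tau>. \<beta> (m * \<tau> + (a - m * a))) a b"
    by (rule pcurve_affine[OF _ m]) (use b(1) in \<open>auto simp: pcurve_def\<close>)
  then show ?thesis using that[of "\<lambda>\<tau>. \<beta> (m * \<tau> + (a - m * a))"] m b by simp
qed

text \<open>The curve from \<open>q (Suc n)\<close> to \<open>q n\<close> is placed on the interval
  from \<open>1 / (n + 2)\<close> to \<open>1 / (n + 1)\<close>, so infinitely many pieces
  accumulate only at 0, and finitely many cover any interval bounded away from 0. Distinctness
  excludes constant pieces.\<close>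

lemma chain_curve:
  assumes q: "\<And>n. causal_le A G T (q (Suc n)) (q n)" "\<And>n. q (Suc n) \<noteq> q n"
  obtains \<gamma> where "\<And>c. 0 < c \<Longrightarrow> c \<le> 1 \<Longrightarrow> pcurve \<gamma> c 1" "\<And>n. \<gamma> (1 / real (Suc n)) = q n"
proof -
  have "\<exists>\<alpha>. pcurve \<alpha> (1 / real (Suc (Suc n))) (1 / real (Suc n)) \<and> \<alpha> (1 / real (Suc (Suc n))) = q (Suc n) \<and> \<alpha> (1 / real (Suc n)) = q n" for n
    by (rule causal_le_pcurve[OF q(1)[of n] q(2)[of n], of "1 / real (Suc (Suc n))" "1 / real (Suc n)"])
      (auto simp: field_simps)
  then obtain \<alpha> where \<alpha>: "\<And>n. pcurve (\<alpha> n) (1 / real (Suc (Suc n))) (1 / real (Suc n))" 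
    "\<And>n. \<alpha> n (1 / real (Suc (Suc n))) = q (Suc n)" "\<And>n. \<alpha> n (1 / real (Suc n)) = q n" by metis
  define \<gamma> where "\<gamma> = (\<lambda>t. \<alpha> (nat \<lfloor>1 / t\<rfloor> - 1) t)"
  \<comment> \<open>The floor selects piece \<open>n\<close> on the interval open at the left; at
    the junctions neighbouring pieces agree, which extends this to the closed interval.\<close>
  have g0: "\<gamma> t = \<alpha> n t" if t: "1 / real (Suc (Suc n)) < t" "t \<le> 1 / real (Suc n)" for n t
  proof -
    have t0: "t > 0" using t(1) by (meson less_trans of_nat_0_less_iff zero_less_Suc zero_less_divide_1_iff)
    have "real (Suc n) \<le> 1 / t" "1 / t < real (Suc (Suc n))" using t t0 by (auto simp: field_simps)
    then have "\<lfloor>1 / t\<rfloor> = int (Suc n)" by (intro floor_unique) auto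
    then have "nat \<lfloor>1 / t\<rfloor> = Suc n" by (simp only: nat_int)
    then show ?thesis by (simp add: \<gamma>_def)
  qed
  have gq: "\<gamma> (1 / real (Suc n)) = q n" for n
    using g0[of n "1 / real (Suc n)"] \<alpha>(3)[of n] by (simp add: field_simps)
  have g1: "\<gamma> t = \<alpha> n t" if t: "t \<in> {1 / real (Suc (Suc n))..1 / real (Suc n)}" for n t
  proof (cases "t = 1 / real (Suc (Suc n))")
    case True then show ?thesis using gq[of "Suc n"] \<alpha>(2)[of n] by simp
  next
    case False then show ?thesis using g0[of n t] t by simp
  qed
  have piece: "pcurve \<gamma> (1 / real (Suc (Suc n))) (1 / real (Suc n))" for n
    by (rule pcurve_affine[OF \<alpha>(1)[of n], of 1 _ 0]) (use g1 in auto)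
  have upto: "pcurve \<gamma> (1 / real (Suc n)) 1" for n
  proof (induction n)
    case 0 then show ?case by (simp add: pcurve_refl)
  next
    case (Suc n) then show ?case by (rule pcurve_trans[OF piece])
  qed
  have "pcurve \<gamma> c 1" if c: "0 < c" "c \<le> 1" for c
  proof -
    obtain n where "inverse (real (Suc n)) < c" using reals_Archimedean[OF c(1)] by blast
    then show ?thesis using pcurve_restrict[OF upto[of n]] c by (simp add: inverse_eq_divide)
  qed
  then show ?thesis using that gq by blast
qed

text \<open>One causal segment in either time direction; its transitive closure is reachability by
  piecewise causal curves.\<close>

definition linked :: "'a \<Rightarrow> 'a \<Rightarrow> bool" where
  "linked x y \<longleftrightarrow> (\<exists>s t \<alpha>. (fut_causal_seg A G T s t \<alpha> \<or> past_causal_seg A G T s t \<alpha>) \<and> \<alpha> s = x \<and> \<alpha> t = y)"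

lemma linked_sym: "linked x y \<Longrightarrow> linked y x"
proof -
  assume "linked x y"
  then obtain s t \<alpha> where *: "fut_causal_seg A G T s t \<alpha> \<or> past_causal_seg A G T s t \<alpha>" "\<alpha> s = x" "\<alpha> t = y"
    by (auto simp: linked_def)
  show ?thesis unfolding linked_def
    using * fut_causal_seg_reverse[of s t \<alpha>] past_causal_seg_reverse[of s t \<alpha>]
    by (intro exI[of _ "-t"] exI[of _ "-s"] exI[of _ "\<lambda>\<tau>. \<alpha> (-\<tau>)"]) auto
qed

lemma carc_linked: "carc S x y L \<Longrightarrow> linked\<^sup>*\<^sup>* x y"
proof (induction rule: carc.induct)
  case (carc_step x y L s t \<alpha>)
  have "linked y (\<alpha> t)" unfolding linked_def using carc_step.hyps by blast
  then show ?case using carc_step.IH by simp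
qed simp

lemma linked_piecewise:
  assumes "linked\<^sup>*\<^sup>* p q"
  shows "\<exists>\<beta> b k s. piecewise_causal A G T \<beta> 0 b k s \<and> \<beta> 0 = p \<and> \<beta> b = q"
  using assms
proof (induction rule: rtranclp_induct)
  case base
  show ?case
    by (intro exI[of _ "\<lambda>_. p"] exI[of _ 0] exI[of _ "0::nat"] exI[of _ "\<lambda>_. 0"])
      (simp add: piecewise_causal_def is_partition_def)
next
  case (step y z)
  then obtain \<beta> b k s where b: "piecewise_causal A G T \<beta> 0 b k s" "\<beta> 0 = p" "\<beta> b = y" by blast
  obtain s' t' \<alpha> where a: "fut_causal_seg A G T s' t' \<alpha> \<or> past_causal_seg A G T s' t' \<alpha>" "\<alpha> s' = y" "\<alpha> t' = z"
    using step.hyps(2) by (auto simp: linked_def)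
  have st: "s' < t'" using a(1) by (auto simp: fut_causal_seg_def past_causal_seg_def smooth_seg_def)
  have p: "is_partition 0 b k s" using b(1) by (simp add: piecewise_causal_def)
  then have sk: "s k = b" "s 0 = 0" by (auto simp: is_partition_def)
  have b0: "0 \<le> b" using partition_mono[OF p, of 0 k] sk by simp
  let ?b = "b + (t' - s')"
  define \<gamma> where "\<gamma> = (\<lambda>\<tau>. if \<tau> \<le> b then \<beta> \<tau> else \<alpha> (\<tau> + (s' - b)))"
  define r where "r = (\<lambda>i. if i \<le> k then s i else ?b)"
  have g2: "\<gamma> \<tau> = \<alpha> (\<tau> + (s' - b))" if "\<tau> \<in> {b..?b}" for \<tau>
    using that a(2) b(3) by (cases "\<tau> = b") (auto simp: \<gamma>_def)
  have e2: "fut_causal_seg A G T b ?b \<gamma> \<or> past_causal_seg A G T b ?b \<gamma>"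
    using a(1)
  proof
    assume "fut_causal_seg A G T s' t' \<alpha>"
    from seglen_reparam(1)[OF this, of b ?b 1 "s' - b" \<gamma>] show ?thesis using g2 st by simp
  next
    assume "past_causal_seg A G T s' t' \<alpha>"
    from past_seg_shift[OF this, of b "s' - b" ?b \<gamma>] show ?thesis using g2 st by simp
  qed
  have e1: "fut_causal_seg A G T (s i) (s (Suc i)) \<gamma> \<or> past_causal_seg A G T (s i) (s (Suc i)) \<gamma> \<or>
      (\<forall>\<tau>\<in>{s i..s (Suc i)}. \<gamma> \<tau> = \<gamma> (s i))" if i: "i < k" for i
  proof -
    have lt: "s i < s (Suc i)" using p i by (simp add: is_partition_def)
    have g: "\<gamma> \<tau> = \<beta> \<tau>" if "\<tau> \<in> {s i..s (Suc i)}" for \<tau>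
      using that partition_mono[OF p, of "Suc i" k] i sk by (auto simp: \<gamma>_def)
    consider "fut_causal_seg A G T (s i) (s (Suc i)) \<beta>" | "past_causal_seg A G T (s i) (s (Suc i)) \<beta>" 
      | "\<forall>\<tau>\<in>{s i..s (Suc i)}. \<beta> \<tau> = \<beta> (s i)" using b(1) i unfolding piecewise_causal_def by blast
    then show ?thesis
    proof cases
      case 1
      from seglen_reparam(1)[OF 1 lt, of 1 0 \<gamma>] g show ?thesis by simp
    next
      case 2
      from past_seg_shift[OF 2, of _ 0 _ \<gamma>] g show ?thesis by simp
    next
      case 3
      have "\<gamma> \<tau> = \<gamma> (s i)" if "\<tau> \<in> {s i..s (Suc i)}" for \<tau>
      proof -
        have "\<gamma> (s i) = \<beta> (s i)" using g[of "s i"] lt by simp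
        moreover have "\<beta> \<tau> = \<beta> (s i)" using 3 that by blast
        ultimately show ?thesis using g[OF that] by simp
      qed
      then show ?thesis by blast
    qed
  qed
  have "is_partition 0 ?b (Suc k) r"
    using p st sk by (auto simp: is_partition_def r_def less_Suc_eq)
  moreover have "fut_causal_seg A G T (r i) (r (Suc i)) \<gamma> \<or> past_causal_seg A G T (r i) (r (Suc i)) \<gamma> \<or>
      (\<forall>\<tau>\<in>{r i..r (Suc i)}. \<gamma> \<tau> = \<gamma> (r i))" if "i < Suc k" for i
  proof (cases "i = k")
    case True then show ?thesis using e2 sk by (auto simp: r_def)
  next
    case False then show ?thesis using e1[of i] that by (simp add: r_def)
  qed
  ultimately have "piecewise_causal A G T \<gamma> 0 ?b (Suc k) r" by (simp add: piecewise_causal_def)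
  moreover have "\<gamma> 0 = p" using b(2) b0 by (simp add: \<gamma>_def)
  moreover have "\<gamma> ?b = z" using st a(3) by (simp add: \<gamma>_def)
  ultimately show ?case by blast
qed

end

section \<open>Regularity excludes steep points\<close>

context regular_ctx
begin

text \<open>The neighbourhood in \<open>beyond\<close> contains witnesses with \<open>tau\<close>
  almost \<open>c0\<close>, and \<open>tau\<close> increases from them to \<open>q\<close>.\<close>

lemma nonlip_tau_ge:
  assumes b: "nonlip c c0 p" and f: "beyond q p" shows "c0 \<le> tau q"
proof (rule field_le_epsilon)
  fix \<epsilon> :: real assume e: "\<epsilon> > 0"
  have c: "c \<in> A" "p \<in> fst c" using b by (auto simp: nonlip_def)
  obtain U where U: "open U" "p \<in> U" "\<And>x. x \<in> U \<Longrightarrow> causal_le A G T x q" using f by (auto simp: beyond_def)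
  have "open (cdom c \<inter> cinv c -` U)"
    by (rule continuous_open_preimage[OF continuous_cinv[OF c(1)] chart_open(2)[OF c(1)] U(1)])
  moreover have "snd c p \<in> cdom c \<inter> cinv c -` U" using c U by simp
  ultimately obtain \<eta> where \<eta>: "\<eta> > 0" "ball (snd c p) \<eta> \<subseteq> cdom c \<inter> cinv c -` U"
    unfolding open_contains_ball by blast
  obtain y where y: "y \<in> fst c" "norm (snd c y - snd c p) < min \<epsilon> \<eta>" "tau y > c0 - min \<epsilon> \<eta>"
    using b e \<eta>(1) unfolding nonlip_def by (metis min_less_iff_conj)
  have "snd c y \<in> ball (snd c p) \<eta>" using y(2) by (simp add: dist_norm norm_minus_commute)
  then have "y \<in> U" using \<eta>(2) cinv_snd[OF c(1) y(1)] by auto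
  then obtain L where "carc UNIV y q L" using U(3) causal_le_carc by blast
  then have "tau y \<le> tau q" by (rule tau_mono)
  then show "c0 \<le> tau q + \<epsilon>" using y(3) by linarith
qed

text \<open>The chart ball left by each step is chosen with least index in a countable cover: if the points
  converged, one of finitely many balls would be left infinitely often, which is absurd.\<close>

lemma tau_not_nonlip:
  assumes "c0 > 0" shows "\<not> nonlip c c0 p"
proof
  assume bad0: "nonlip c c0 p"
  have "\<forall>x. \<exists>c R e m C t0. x \<in> fst c \<and> regular_patch A G T c (snd c x) R e m C t0"
  proof
    fix x
    obtain c where c: "c \<in> A" "x \<in> fst c" using chart_exists by blast
    then show "\<exists>c R e m C t0. x \<in> fst c \<and> regular_patch A G T c (snd c x) R e m C t0"
      using regular_patch_exists[OF c(2,1) zero_less_one] by blast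
  qed
  then obtain ch R e m C t0 where pt: "\<And>x. x \<in> fst (ch x)" "\<And>x. regular_patch A G T (ch x) (snd (ch x) x) (R x) (e x) (m x) (C x) (t0 x)"
    by metis
  \<comment> \<open>Four ratios are used: open balls of ratio 1/4 cover, closed ones of ratio 1/3
    define the index, the current point lies in ratio 1/2, and the next one is outside ratio 3/4.
    The gaps leave room for passing to nearby points and to limits.\<close>
  define BB where "BB = (\<lambda>x f. cinv (ch x) ` ball (snd (ch x) x) (f * R x))"
  define KK where "KK = (\<lambda>x f. cinv (ch x) ` cball (snd (ch x) x) (f * R x))"
  have R: "R x > 0" and chA: "ch x \<in> A" and sub: "f \<le> 2 \<Longrightarrow> cball (snd (ch x) x) (f * R x) \<subseteq> cdom (ch x)" for x f
  proof -
    interpret P: regular_patch A G T "ch x" "snd (ch x) x" "R x" "e x" "m x" "C x" "t0 x" by (rule pt)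
    show "R x > 0" "ch x \<in> A" by (rule P.R_pos P.cA)+
    assume "f \<le> 2"
    then have "f * R x \<le> 2 * R x" using P.R_pos by simp
    then show "cball (snd (ch x) x) (f * R x) \<subseteq> cdom (ch x)" using P.sub subset_cball[of "f * R x" "2 * R x"] by blast
  qed
  have Bop: "open (BB x f)" if "f \<le> 2" for x f
    unfolding BB_def using sub[OF that, of x] by (intro open_cinv_image chA) (auto simp: subset_iff)
  have Kcl: "closed (KK x f)" if "f \<le> 2" for x f
    unfolding KK_def
    by (intro compact_imp_closed compact_continuous_image compact_cball continuous_on_subset[OF continuous_cinv[OF chA]] sub that)
  have BK: "BB x f \<subseteq> KK x g" if "f \<le> g" for x f g
  proof -
    have "f * R x \<le> g * R x" using that R[of x] by simp
    then show ?thesis unfolding BB_def KK_def by (intro image_mono) (auto simp: subset_iff)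
  qed
  have KB: "KK x f \<subseteq> BB x g" if "f < g" for x f g
  proof -
    have "f * R x < g * R x" using that R[of x] by simp
    then show ?thesis unfolding BB_def KK_def by (intro image_mono) (auto simp: subset_iff)
  qed
  have KI: "z \<in> KK x f \<Longrightarrow> z \<in> fst (ch x) \<and> snd (ch x) z \<in> cball (snd (ch x) x) (f * R x)" if f2: "f \<le> 2" for z x f
  proof -
    assume "z \<in> KK x f"
    then obtain v where v: "v \<in> cball (snd (ch x) x) (f * R x)" "z = cinv (ch x) v" unfolding KK_def by blast
    from v(1) have "v \<in> cdom (ch x)" using sub[OF f2, of x] by blast
    then show ?thesis using cinv_in[OF chA, of v x] snd_cinv[OF chA, of v x] v by metis
  qed
  have xB: "x \<in> BB x (1/4)" for x
  proof -
    have "snd (ch x) x \<in> ball (snd (ch x) x) (1/4 * R x)" using R[of x] by simp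
    then show ?thesis unfolding BB_def using cinv_snd[OF chA pt(1)] by (metis imageI)
  qed
  obtain F' where F': "F' \<subseteq> range (\<lambda>x. BB x (1/4))" "countable F'" "\<Union>F' = \<Union>(range (\<lambda>x. BB x (1/4)))"
    by (rule Lindelof[of "range (\<lambda>x. BB x (1/4))"]) (use Bop in auto)
  obtain X where X: "countable X" "F' = (\<lambda>x. BB x (1/4)) ` X" using F'(1,2) by (metis countable_subset_image)
  have UX: "\<exists>x\<in>X. z \<in> BB x (1/4)" for z using xB[of z] F'(3) X(2) by blast
  then have Xne: "X \<noteq> {}" by blast
  define \<xi> where "\<xi> = from_nat_into X"
  have rX: "range \<xi> = X" unfolding \<xi>_def by (rule range_from_nat_into[OF Xne X(1)])
  have cov: "\<exists>i. z \<in> BB (\<xi> i) (1/4)" for z using UX[of z] rX by (metis rangeE)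
  define idx where "idx = (\<lambda>z. LEAST i. z \<in> KK (\<xi> i) (1/3))"
  have idx: "z \<in> KK (\<xi> (idx z)) (1/3)" for z
  proof -
    have "BB x (1/4) \<subseteq> KK x (1/3)" for x by (rule BK) simp
    then have "\<exists>i. z \<in> KK (\<xi> i) (1/3)" using cov[of z] by blast
    then show ?thesis unfolding idx_def by (rule LeastI_ex)
  qed
  have idx_min: "z \<notin> KK (\<xi> j) (1/3)" if "j < idx z" for z j using that not_less_Least unfolding idx_def by blast
  \<comment> \<open>An open neighbourhood on which what was arranged for the bad point persists:
    points in it stay in the half ball and avoid the 1/3-balls of smaller index.\<close>
  define W where "W = (\<lambda>z. BB (\<xi> (idx z)) (1/2) \<inter> (\<Inter>j\<in>{..<idx z}. - KK (\<xi> j) (1/3)))"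
  have W: "open (W z)" "z \<in> W z" for z
  proof -
    show "open (W z)" unfolding W_def by (intro open_Int Bop open_INT open_Compl Kcl ballI) auto
    have "KK x (1/3) \<subseteq> BB x (1/2)" for x by (rule KB) simp
    then show "z \<in> W z" unfolding W_def using idx[of z] idx_min[of _ z] by blast
  qed
  define P where "P = (\<lambda>z. (\<exists>c. nonlip c c0 (fst z)) \<and> beyond (snd z) (fst z) \<and> snd z \<in> W (fst z))"
  have step: "\<exists>z'. P z' \<and> causal_le A G T (snd z') (snd z) \<and> snd z' \<notin> KK (\<xi> (idx (fst z))) (3/4)" if Pz: "P z" for z
  proof -
    obtain p q where z: "z = (p, q)" by fastforce
    let ?x = "\<xi> (idx p)"
    interpret Q: regular_patch A G T "ch ?x" "snd (ch ?x) ?x" "R ?x" "e ?x" "m ?x" "C ?x" "t0 ?x" by (rule pt)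
    obtain c where bc: "nonlip c c0 p" using Pz by (auto simp: P_def z)
    have pK: "p \<in> fst (ch ?x)" "snd (ch ?x) p \<in> cball (snd (ch ?x) ?x) (1/3 * R ?x)" using KI[OF _ idx[of p]] by auto
    have bad: "nonlip (ch ?x) c0 p" by (rule nonlip_chart_change[OF bc chA pK(1)])
    have "snd (ch ?x) p \<in> ball (snd (ch ?x) ?x) (R ?x / 2)" using pK(2) R[of ?x] by simp
    from Q.nonlip_step[OF bad this] obtain p' where p': "p' \<in> fst (ch ?x)" "norm (snd (ch ?x) p' - snd (ch ?x) ?x) = R ?x"
      "nonlip (ch ?x) c0 p'" "\<And>q W. beyond q p \<Longrightarrow> open W \<Longrightarrow> p' \<in> W \<Longrightarrow> (\<exists>q'\<in>W. beyond q' p' \<and> causal_le A G T q' q)" by blast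
    have "p' \<notin> KK ?x (3/4)"
    proof
      assume "p' \<in> KK ?x (3/4)"
      then have "snd (ch ?x) p' \<in> cball (snd (ch ?x) ?x) (3/4 * R ?x)" 
        using KI[where f="3/4" and z=p' and x="?x"] by simp
      then show False using p'(2) R[of ?x] by (simp add: dist_norm norm_minus_commute)
    qed
    \<comment> \<open>The bad point moves to the full sphere, so it is outside the closed 3/4-ball.
      This is an open condition and can be imposed on the upper point \<open>q'\<close> as
      well.\<close>
    then have "p' \<in> W p' \<inter> - KK ?x (3/4)" using W(2) by blast
    moreover have "open (W p' \<inter> - KK ?x (3/4))" by (intro open_Int W open_Compl Kcl) simp
    moreover have "beyond q p" using Pz by (simp add: P_def z)
    ultimately obtain q' where "q' \<in> W p' \<inter> - KK ?x (3/4)" "beyond q' p'" "causal_le A G T q' q" using p'(4) by blast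
    then show ?thesis using p'(3) unfolding P_def z
      by (intro exI[of _ "(p', q')"]) (simp only: fst_conv snd_conv Int_iff Compl_iff, blast)
  qed
  have init: "\<exists>z. P z"
  proof -
    let ?x = "\<xi> (idx p)"
    interpret Q: regular_patch A G T "ch ?x" "snd (ch ?x) ?x" "R ?x" "e ?x" "m ?x" "C ?x" "t0 ?x" by (rule pt)
    have pK: "p \<in> fst (ch ?x)" "snd (ch ?x) p \<in> cball (snd (ch ?x) ?x) (1/3 * R ?x)" using KI[OF _ idx[of p]] by auto
    let ?v = "snd (ch ?x) p"
    have "open (cdom (ch ?x) \<inter> cinv (ch ?x) -` W p)"
      by (rule continuous_open_preimage[OF continuous_cinv[OF chA] chart_open(2)[OF chA] W(1)])
    moreover have "?v \<in> cdom (ch ?x) \<inter> cinv (ch ?x) -` W p" using pK W(2)[of p] chA by simp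
    ultimately obtain \<eta> where \<eta>: "\<eta> > 0" "ball ?v \<eta> \<subseteq> cdom (ch ?x) \<inter> cinv (ch ?x) -` W p"
      unfolding open_contains_ball by blast
    define h where "h = min (\<eta> / 2) (R ?x / 2)"
    have h: "0 < h" "h < \<eta>" "h \<le> R ?x / 2" using \<eta> R[of ?x] by (auto simp: h_def)
    let ?q = "cinv (ch ?x) (?v + h *\<^sub>R e ?x)"
    have "?v + h *\<^sub>R e ?x \<in> ball ?v \<eta>" using h Q.norm_e by (simp add: dist_norm)
    then have "?q \<in> W p" using \<eta>(2) by blast
    moreover have "beyond ?q (cinv (ch ?x) ?v)" by (rule Q.beyond_shift) (use pK R[of ?x] h in auto)
    moreover have "cinv (ch ?x) ?v = p" using pK chA by simp
    ultimately have "beyond ?q p" "?q \<in> W p" by simp_all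
    then have "P (p, ?q)" unfolding P_def fst_conv snd_conv using bad0 by blast
    then show ?thesis by blast
  qed
  obtain z where z: "\<And>n. P (z n)" "\<And>n. causal_le A G T (snd (z (Suc n))) (snd (z n))" 
    "\<And>n. snd (z (Suc n)) \<notin> KK (\<xi> (idx (fst (z n)))) (3/4)"
    using dependent_nat_choice[of "\<lambda>_. P" "\<lambda>_ z z'. causal_le A G T (snd z') (snd z) \<and> snd z' \<notin> KK (\<xi> (idx (fst z))) (3/4)"] init step
    by metis
  define q where "q = (\<lambda>n. snd (z n))"
  define i where "i = (\<lambda>n. idx (fst (z n)))"
  have qW: "q n \<in> BB (\<xi> (i n)) (1/2)" "\<And>j. j < i n \<Longrightarrow> q n \<notin> KK (\<xi> j) (1/3)" for n
    using z(1)[of n] by (auto simp: P_def W_def q_def i_def)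
  have qK: "q (Suc n) \<notin> KK (\<xi> (i n)) (3/4)" for n using z(3) by (simp add: q_def i_def)
  have tq: "c0 \<le> tau (q n)" for n using z(1)[of n] nonlip_tau_ge by (auto simp: P_def q_def)
  have "q (Suc n) \<noteq> q n" for n
  proof
    assume "q (Suc n) = q n"
    moreover have "BB (\<xi> (i n)) (1/2) \<subseteq> KK (\<xi> (i n)) (3/4)" by (rule BK) simp
    ultimately show False using qW(1)[of n] qK[of n] by auto
  qed
  moreover have "causal_le A G T (q (Suc n)) (q n)" for n using z(2) by (simp add: q_def)
  ultimately obtain \<gamma> where \<gamma>: "\<And>c. 0 < c \<Longrightarrow> c \<le> 1 \<Longrightarrow> pcurve \<gamma> c 1" "\<And>n. \<gamma> (1 / real (Suc n)) = q n"
    using chain_curve[of q] by metis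
  have flt: "filterlim (\<lambda>n. 1 / real (Suc n)) (at_right 0) sequentially"
    unfolding filterlim_at using LIMSEQ_inverse_real_of_nat by (auto simp: inverse_eq_divide)
  have nolim: "\<not> (\<gamma> \<longlongrightarrow> p') (at_right 0)" for p'
  proof
    assume "(\<gamma> \<longlongrightarrow> p') (at_right 0)"
    from filterlim_compose[OF this flt] have lim: "q \<longlonglongrightarrow> p'" by (simp only: \<gamma>(2))
    obtain j where j: "p' \<in> BB (\<xi> j) (1/4)" using cov by blast
    have "\<forall>\<^sub>F n in sequentially. q n \<in> BB (\<xi> j) (1/4)" by (rule topological_tendstoD[OF lim Bop j]) simp
    \<comment> \<open>Points near the limit lie in the 1/3-ball of index \<open>j\<close>, which the
      choice of least index forbids when \<open>j < i n\<close>.\<close>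
    then have 1: "\<forall>\<^sub>F n in sequentially. i n \<le> j"
    proof eventually_elim
      case (elim n)
      have "BB (\<xi> j) (1/4) \<subseteq> KK (\<xi> j) (1/3)" by (rule BK) simp
      then show ?case using elim qW(2)[of j n] by (meson linorder_not_less subsetD)
    qed
    \<comment> \<open>For a single ball, two consecutive late terms are close to the same limit, so
      they cannot straddle the gap between ratios 1/2 and 3/4. Only the finitely many indices up to
      \<open>j\<close> matter.\<close>
    have "\<forall>\<^sub>F n in sequentially. \<not> (q n \<in> BB (\<xi> l) (1/2) \<and> q (Suc n) \<notin> KK (\<xi> l) (3/4))" for l
    proof (cases "p' \<in> BB (\<xi> l) (3/4)")
      case True
      have "\<forall>\<^sub>F n in sequentially. q (Suc n) \<in> BB (\<xi> l) (3/4)"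
        by (rule topological_tendstoD[OF LIMSEQ_Suc[OF lim] Bop True]) simp
      then show ?thesis
      proof eventually_elim
        case (elim n)
        have "BB (\<xi> l) (3/4) \<subseteq> KK (\<xi> l) (3/4)" by (rule BK) simp
        then show ?case using elim by blast
      qed
    next
      case False
      have "KK (\<xi> l) (1/2) \<subseteq> BB (\<xi> l) (3/4)" by (rule KB) simp
      then have pn: "p' \<in> - KK (\<xi> l) (1/2)" using False by blast
      have "\<forall>\<^sub>F n in sequentially. q n \<in> - KK (\<xi> l) (1/2)"
        by (rule topological_tendstoD[OF lim open_Compl[OF Kcl] pn]) simp
      then show ?thesis
      proof eventually_elim
        case (elim n)
        have "BB (\<xi> l) (1/2) \<subseteq> KK (\<xi> l) (1/2)" by (rule BK) simp
        then show ?case using elim by blast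
      qed
    qed
    then have "\<forall>\<^sub>F n in sequentially. \<forall>l\<in>{..j}. \<not> (q n \<in> BB (\<xi> l) (1/2) \<and> q (Suc n) \<notin> KK (\<xi> l) (3/4))"
      by (intro eventually_ball_finite) auto
    with 1 have "\<forall>\<^sub>F n in sequentially. False"
    proof eventually_elim
      case (elim n)
      then show ?case using qW(1)[of n] qK[of n] by auto
    qed
    then show False by simp
  qed
  have "past_inext_causal_curve A G T \<gamma> 0 1"
    unfolding past_inext_causal_curve_def
  proof (intro conjI ballI)
    fix c :: real assume "c \<in> {0<..<1}"
    then show "causal_curve_on A G T \<gamma> c 1" using \<gamma>(1)[of c] unfolding causal_curve_on_def pcurve_def by auto
  qed (use nolim in auto)
  then have "((\<lambda>t. cosmo_time A G T (\<gamma> t)) \<longlongrightarrow> 0) (at_right 0)"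
    using regular unfolding regular_cosmo_time_def by blast
  from filterlim_compose[OF this flt] have "(\<lambda>n. cosmo_time A G T (q n)) \<longlonglongrightarrow> 0" by (simp only: \<gamma>(2))
  moreover have "ereal c0 \<le> cosmo_time A G T (q n)" for n
    unfolding ereal_tau[symmetric] using tq by simp
  ultimately have "ereal c0 \<le> 0" by (intro LIMSEQ_le_const) auto
  then show False using assms by (simp add: zero_ereal_def)
qed

section \<open>The anti-Lipschitz estimate\<close>

lemma anti_lipschitz_patch:
  assumes p: "p \<in> fst c" "c \<in> A" and \<rho>: "\<rho> > 0"
  obtains r \<kappa> where "0 < r" "r \<le> \<rho>" "0 < \<kappa>" "cball (snd c p) r \<subseteq> cdom c"
    "\<forall>x y L. carc (cinv c ` cball (snd c p) r) x y L \<longrightarrow> \<kappa> * norm (snd c y - snd c x) \<le> tau y - tau x"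
proof -
  obtain R0 e m C t0 where g: "regular_patch A G T c (snd c p) R0 e m C t0" "R0 \<le> \<rho>"
    using regular_patch_exists[OF p \<rho>] by blast
  interpret Q: regular_patch A G T c "snd c p" R0 e m C t0 by (rule g)
  \<comment> \<open>With \<open>c0 = t0\<close> the condition \<open>tau y > t0 - \<epsilon>\<close>
    is automatic in the ball, so its negation is an unconditional Lipschitz bound with constant
    \<open>1 / \<epsilon>\<close>.\<close>
  have "\<not> nonlip c t0 p" by (rule tau_not_nonlip[OF Q.t0_pos])
  then obtain \<epsilon> where \<epsilon>: "\<epsilon> > 0" and nb: "\<And>x y. x \<in> fst c \<Longrightarrow> y \<in> fst c \<Longrightarrow> norm (snd c x - snd c p) < \<epsilon> \<Longrightarrow>
     norm (snd c y - snd c p) < \<epsilon> \<Longrightarrow> tau y > t0 - \<epsilon> \<Longrightarrow> \<epsilon> * (tau y - tau x) \<le> norm (snd c y - snd c x)"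
    unfolding nonlip_def using p by (meson linorder_not_less)
  define r where "r = min R0 (\<epsilon> / 3)"
  have r: "0 < r" "r \<le> R0" "2 * r < \<epsilon>" using Q.R_pos \<epsilon> by (auto simp: r_def)
  interpret S: good_patch A G T c "snd c p" r e m C
    by (rule good_patch_shrink[OF Q.good_patch_axioms r(1,2)])
  \<comment> \<open>With \<open>k = 2 * u^2\<close> the tilt gains \<open>u * m / C\<close> and
    loses \<open>2 * u^2 / \<epsilon>\<close> per unit of \<open>lam\<close>; the second bound on
    \<open>u\<close> makes the loss at most half of the gain, the first keeps the tilt
    admissible.\<close>
  define u where "u = min (1 / (2 * C)) (m * \<epsilon> / (4 * C))"
  have u: "0 < u" "u \<le> 1 / (2 * C)" "u \<le> m * \<epsilon> / (4 * C)" using Q.C_ge Q.m_pos \<epsilon> by (auto simp: u_def)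
  define k where "k = 2 * u^2"
  have k0: "0 \<le> k" by (simp add: k_def)
  have sk: "sqrt (k / 2) = u" using u by (simp add: k_def)
  have uC: "2 * C * u \<le> 1" "4 * C * u \<le> m * \<epsilon>" using u(2,3) Q.C_ge by (auto simp: field_simps)
  have kC: "2 * C * k \<le> 1"
  proof -
    have "2 * C * k = (2 * C * u) * (2 * u)" by (simp add: k_def power2_eq_square)
    also have "\<dots> \<le> 1 * (2 * u)" using uC(1) u(1) by (intro mult_right_mono) auto
    also have "2 * u \<le> 2 * C * u" using u(1) Q.C_ge by simp
    finally show ?thesis using uC(1) by linarith
  qed
  define \<kappa> where "\<kappa> = u * m / (2 * C) * (m / 2)"
  have \<kappa>: "\<kappa> > 0" using u Q.m_pos Q.C_ge by (simp add: \<kappa>_def)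
  have main: "\<kappa> * norm (snd c y - snd c x) \<le> tau y - tau x" if cu: "carc (cinv c ` cball (snd c p) r) x y L" for x y L
  proof -
    define \<Lambda> where "\<Lambda> = S.lam (snd c y - snd c x)"
    have r2: "r \<le> 2 * r" using r by simp
    have cu2: "carc (S.reg (2 * r)) x y L" by (rule carc_mono[OF cu S.reg_mono[OF r2]])
    have lx: "x \<in> fst c" "snd c x \<in> cball (snd c p) r" and ly: "y \<in> fst c" "snd c y \<in> cball (snd c p) r"
      using carc_props[OF cu] S.reg_fst[OF r2] S.snd_reg[OF r2] by blast+
    have \<Lambda>: "(m/2) * norm (snd c y - snd c x) \<le> \<Lambda>" "0 \<le> \<Lambda>" "\<Lambda> \<le> 2 * C * r"
      using S.carc_lam[OF cu2] S.lam_ball[OF ly(2) lx(2)] by (auto simp: \<Lambda>_def S.lam_lin)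
    let ?v = "snd c x - (k * \<Lambda>) *\<^sub>R e"
    obtain L' where L': "L' \<ge> u * m / C * \<Lambda>" "carc (S.reg (2 * r)) (cinv c ?v) y L'"
      using S.carc_tilt[OF cu k0 kC] unfolding sk \<Lambda>_def[symmetric] by blast
    have t1: "tau (cinv c ?v) + L' \<le> tau y" by (rule tau_add[OF L'(2)])
    have vS: "cinv c ?v \<in> S.reg (2 * r)" using carc_props[OF L'(2)] by blast
    have vf: "cinv c ?v \<in> fst c" using vS S.reg_fst[of "2 * r"] by blast
    have kl: "0 \<le> k * \<Lambda>" "k * \<Lambda> \<le> r"
    proof -
      show "0 \<le> k * \<Lambda>" using k0 \<Lambda>(2) by simp
      have "k * \<Lambda> \<le> k * (2 * C * r)" using \<Lambda>(3) k0 by (intro mult_left_mono)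
      also have "\<dots> = (2 * C * k) * r" by simp
      also have "\<dots> \<le> 1 * r" using kC r by (intro mult_right_mono) auto
      finally show "k * \<Lambda> \<le> r" by simp
    qed
    have "dist (snd c p) ?v \<le> dist (snd c p) (snd c x) + dist (snd c x) ?v" by (rule dist_triangle)
    then have vb: "?v \<in> cball (snd c p) (2 * r)" using lx(2) kl Q.norm_e by (simp add: dist_norm)
    then have sv: "snd c (cinv c ?v) = ?v" using S.sub snd_cinv[OF p(2)] by blast
    have "\<epsilon> * (tau x - tau (cinv c ?v)) \<le> norm (snd c x - snd c (cinv c ?v))"
    proof (rule nb[OF vf lx(1)])
      show "norm (snd c (cinv c ?v) - snd c p) < \<epsilon>" unfolding sv using vb r by (simp add: dist_norm norm_minus_commute)
      show "norm (snd c x - snd c p) < \<epsilon>" using lx(2) r by (simp add: dist_norm norm_minus_commute)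
      have "x \<in> cinv c ` cball (snd c p) R0" using carc_props[OF cu] S.reg_mono[OF r(2)] by blast
      then show "t0 - \<epsilon> < tau x" using Q.tau_t0 \<epsilon> by fastforce
    qed
    also have "\<dots> = k * \<Lambda>" unfolding sv using kl Q.norm_e by simp
    finally have t2: "\<epsilon> * (tau x - tau (cinv c ?v)) \<le> k * \<Lambda>" .
    have kL: "k * \<Lambda> \<le> \<epsilon> * (u * m / (2 * C) * \<Lambda>)"
    proof -
      have "2 * u \<le> \<epsilon> * m / (2 * C)" using u(3) by (simp add: field_simps)
      then have "(2 * u) * (u * \<Lambda>) \<le> (\<epsilon> * m / (2 * C)) * (u * \<Lambda>)" using u \<Lambda> by (intro mult_right_mono) auto
      then show ?thesis by (simp add: k_def power2_eq_square algebra_simps)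
    qed
    have t3: "tau x - tau (cinv c ?v) \<le> u * m / (2 * C) * \<Lambda>"
      by (rule mult_left_le_imp_le[OF order_trans[OF t2 kL] \<epsilon>])
    have "u * m / C * \<Lambda> = u * m / (2 * C) * \<Lambda> + u * m / (2 * C) * \<Lambda>" by (simp add: field_simps)
    moreover have "a \<le> ty - tx" if "b = a + a" "tv + l \<le> ty" "tx - tv \<le> a" "b \<le> l" for a b l tv tx ty :: real
      using that by linarith
    ultimately have "u * m / (2 * C) * \<Lambda> \<le> tau y - tau x" using t1 t3 L'(1) by blast
    moreover have "\<kappa> * norm (snd c y - snd c x) \<le> u * m / (2 * C) * \<Lambda>"
      unfolding \<kappa>_def mult.assoc using \<Lambda>(1) u Q.m_pos Q.C_ge mult_left_mono[OF \<Lambda>(1), of "u * m / (2 * C)"] by (simp add: mult.assoc)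
    ultimately show ?thesis by linarith
  qed
  have "cball (snd c p) r \<subseteq> cdom c" using S.sub subset_cball[of r "2 * r" "snd c p"] r by auto
  moreover have "r \<le> \<rho>" using r(2) g(2) by linarith
  ultimately show ?thesis using that[OF r(1) _ \<kappa>] main by blast
qed

end

context spacetime_ctx
begin

text \<open>Compactness of the closed chart ball makes its image closed in the manifold, so leaving
  the open ball really means crossing the coordinate sphere.\<close>

lemma chart_closure:
  assumes c: "c \<in> A" and sub: "cball o\<^sub>c r \<subseteq> cdom c"
  shows "open (cinv c ` ball o\<^sub>c r)" "closure (cinv c ` ball o\<^sub>c r) \<subseteq> cinv c ` cball o\<^sub>c r"
    "z \<in> closure (cinv c ` ball o\<^sub>c r) - cinv c ` ball o\<^sub>c r \<Longrightarrow> norm (snd c z - o\<^sub>c) = r"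
proof -
  have bc: "ball o\<^sub>c r \<subseteq> cball o\<^sub>c r" by auto
  show "open (cinv c ` ball o\<^sub>c r)" using bc sub by (intro open_cinv_image c) blast+
  have "compact (cinv c ` cball o\<^sub>c r)"
    by (intro compact_continuous_image compact_cball continuous_on_subset[OF continuous_cinv[OF c] sub])
  then show cl: "closure (cinv c ` ball o\<^sub>c r) \<subseteq> cinv c ` cball o\<^sub>c r"
    by (intro closure_minimal image_mono bc compact_imp_closed)
  assume z: "z \<in> closure (cinv c ` ball o\<^sub>c r) - cinv c ` ball o\<^sub>c r"
  then obtain v where v: "v \<in> cball o\<^sub>c r" "z = cinv c v" using cl by blast
  then have "v \<notin> ball o\<^sub>c r" using z by blast
  moreover have "snd c z = v" using v sub snd_cinv[OF c] by blast
  ultimately show "norm (snd c z - o\<^sub>c) = r" using v(1) by (simp add: dist_norm norm_minus_commute)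
qed

end

context regular_ctx
begin

text \<open>Causally related points may be joined only by curves that leave the patch. Such a curve
  pays for the way between \<open>x\<close> and the sphere, and monotonicity of \<open>tau\<close>
  on the rest cannot refund it.\<close>

lemma exit_tau:
  assumes c: "c \<in> A" and sub: "cball o\<^sub>c r \<subseteq> cdom c" and \<kappa>: "0 < \<kappa>"
    and al': "\<forall>x y L. carc (cinv c ` cball o\<^sub>c r) x y L \<longrightarrow> \<kappa> * norm (snd c y - snd c x) \<le> tau y - tau x"
    and x: "x \<in> cinv c ` ball o\<^sub>c r" and rel: "causal_le A G T x y \<or> causal_le A G T y x"
  shows "(y \<in> cinv c ` ball o\<^sub>c r \<and> \<kappa> * norm (snd c y - snd c x) \<le> \<bar>tau y - tau x\<bar>) \<or>
    \<kappa> * (r - norm (snd c x - o\<^sub>c)) \<le> \<bar>tau y - tau x\<bar>"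
proof -
  let ?W = "cinv c ` ball o\<^sub>c r" and ?K = "cinv c ` cball o\<^sub>c r"
  note al = al'[rule_format] and W = chart_closure[OF c sub]
  have WK: "?W \<subseteq> ?K" by auto
  have far: "\<kappa> * (r - norm (snd c x - o\<^sub>c)) \<le> \<kappa> * norm (snd c z - snd c x)" if "z \<in> closure ?W - ?W" for z
  proof (rule mult_left_mono)
    have "r \<le> norm (snd c z - snd c x) + norm (snd c x - o\<^sub>c)"
      using norm_triangle_ineq[of "snd c z - snd c x" "snd c x - o\<^sub>c"] W(3)[OF that] by simp
    then show "r - norm (snd c x - o\<^sub>c) \<le> norm (snd c z - snd c x)" by simp
  qed (use \<kappa> in simp)
  show ?thesis
    using rel
  proof
    assume "causal_le A G T x y"
    then obtain L where L: "carc UNIV x y L" unfolding causal_le_carc by blast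
    from carc_first_exit[OF L W(1) x] show ?thesis
    proof
      assume i: "carc (UNIV \<inter> ?W) x y L"
      then have "y \<in> ?W" using carc_props by blast
      moreover have "carc ?K x y L" using carc_mono[OF i] WK by simp
      ultimately show ?thesis using al by fastforce
    next
      assume "\<exists>z L1 L2. carc (UNIV \<inter> closure ?W) x z L1 \<and> carc UNIV z y L2 \<and> z \<in> closure ?W - ?W \<and> L = L1 + L2"
      then obtain z L1 L2 where z: "carc (UNIV \<inter> closure ?W) x z L1" "carc UNIV z y L2" "z \<in> closure ?W - ?W" by blast
      have "carc ?K x z L1" using carc_mono[OF z(1)] W(2) by simp
      from al[OF this] far[OF z(3)] tau_mono[OF z(2)] show ?thesis by linarith
    qed
  next
    assume "causal_le A G T y x"
    then obtain L where L: "carc UNIV y x L" unfolding causal_le_carc by blast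
    from carc_last_exit[OF L W(1) x] show ?thesis
    proof
      assume i: "carc (UNIV \<inter> ?W) y x L"
      then have "y \<in> ?W" using carc_props by blast
      moreover have "carc ?K y x L" using carc_mono[OF i] WK by simp
      then have "\<kappa> * norm (snd c y - snd c x) \<le> tau x - tau y"
        unfolding norm_minus_commute[of "snd c y"] by (rule al)
      ultimately show ?thesis by auto
    next
      assume "\<exists>z L1 L2. carc UNIV y z L1 \<and> carc (UNIV \<inter> closure ?W) z x L2 \<and> z \<in> closure ?W - ?W \<and> L = L1 + L2"
      then obtain z L1 L2 where z: "carc UNIV y z L1" "carc (UNIV \<inter> closure ?W) z x L2" "z \<in> closure ?W - ?W" by blast
      have "carc ?K z x L2" using carc_mono[OF z(2)] W(2) by simp
      then have "\<kappa> * norm (snd c z - snd c x) \<le> tau x - tau z"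
        unfolding norm_minus_commute[of "snd c z"] by (rule al)
      with far[OF z(3)] tau_mono[OF z(1)] show ?thesis by linarith
    qed
  qed
qed

lemma tau_locally_anti_lipschitz: "locally_anti_lipschitz A G T tau"
  unfolding locally_anti_lipschitz_def
proof
  fix p
  obtain c where c: "c \<in> A" "p \<in> fst c" using chart_exists by blast
  obtain r \<kappa> where r: "0 < r" "0 < \<kappa>" "cball (snd c p) r \<subseteq> cdom c"
    and al': "\<forall>x y L. carc (cinv c ` cball (snd c p) r) x y L \<longrightarrow> \<kappa> * norm (snd c y - snd c x) \<le> tau y - tau x"
    by (rule anti_lipschitz_patch[OF c(2,1) zero_less_one])
  \<comment> \<open>Two points of the quarter ball are less than \<open>r / 2\<close> apart, while
    leaving the full ball costs more than \<open>3 * r / 4\<close> times \<kappa>; so the bound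
    holds in both cases of \<open>exit_tau\<close>.\<close>
  let ?U = "cinv c ` ball (snd c p) (r / 4)" and ?d = "\<lambda>x y. \<kappa> * norm (snd c y - snd c x)"
  have sub4: "ball (snd c p) (r / 4) \<subseteq> cdom c" using r by (auto simp: subset_iff)
  have U: "x \<in> fst c" "snd c x \<in> ball (snd c p) (r / 4)" if x: "x \<in> ?U" for x
  proof -
    obtain v where v: "v \<in> ball (snd c p) (r / 4)" "x = cinv c v" using x by blast
    then have "v \<in> cdom c" using sub4 by blast
    then show "x \<in> fst c" "snd c x \<in> ball (snd c p) (r / 4)" using v cinv_in[OF c(1)] snd_cinv[OF c(1)] by auto
  qed
  have "open ?U" by (rule open_cinv_image[OF c(1) open_ball sub4])
  moreover have "p \<in> ?U"
  proof -
    have "snd c p \<in> ball (snd c p) (r / 4)" using r by simp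
    then show ?thesis using cinv_snd[OF c] by (metis imageI)
  qed
  moreover have "distance_on ?U ?d"
    unfolding distance_on_def
  proof (intro conjI ballI)
    fix x y assume xy: "x \<in> ?U" "y \<in> ?U"
    show "0 \<le> ?d x y" using r by simp
    show "?d x y = 0 \<longleftrightarrow> x = y"
    proof
      assume "?d x y = 0"
      then have "snd c y = snd c x" using r by simp
      then show "x = y" using U(1)[OF xy(1)] U(1)[OF xy(2)] cinv_snd[OF c(1)] by metis
    qed simp
    show "?d x y = ?d y x" by (simp add: norm_minus_commute)
    fix z
    have "norm (snd c z - snd c x) \<le> norm (snd c y - snd c x) + norm (snd c z - snd c y)"
      using norm_triangle_ineq[of "snd c y - snd c x" "snd c z - snd c y"] by simp
    then have "\<kappa> * norm (snd c z - snd c x) \<le> \<kappa> * (norm (snd c y - snd c x) + norm (snd c z - snd c y))"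
      using r by (intro mult_left_mono) auto
    then show "?d x z \<le> ?d x y + ?d y z" by (simp add: distrib_left)
  qed
  moreover have "?d x y \<le> tau y - tau x" if xy: "x \<in> ?U" "y \<in> ?U" and le: "causal_le A G T x y" for x y
  proof -
    obtain L where "carc UNIV x y L" using le unfolding causal_le_carc by blast
    then have mono: "tau x \<le> tau y" by (rule tau_mono)
    have nx: "norm (snd c x - snd c p) < r / 4" and ny: "norm (snd c y - snd c p) < r / 4"
      using U(2)[OF xy(1)] U(2)[OF xy(2)] by (auto simp: dist_norm norm_minus_commute)
    have "?U \<subseteq> cinv c ` ball (snd c p) r" using r by (intro image_mono) (auto simp: subset_iff)
    then have "x \<in> cinv c ` ball (snd c p) r" using xy by blast
    from exit_tau[OF c(1) r(3,2) al' this disjI1[OF le]] have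
      "?d x y \<le> \<bar>tau y - tau x\<bar> \<or> \<kappa> * (r - norm (snd c x - snd c p)) \<le> \<bar>tau y - tau x\<bar>" by blast
    moreover have "?d x y \<le> \<kappa> * (r - norm (snd c x - snd c p))"
    proof (rule mult_left_mono)
      have "norm (snd c y - snd c x) \<le> norm (snd c y - snd c p) + norm (snd c x - snd c p)"
        using norm_triangle_ineq4[of "snd c y - snd c p" "snd c x - snd c p"] by simp
      then show "norm (snd c y - snd c x) \<le> r - norm (snd c x - snd c p)" using nx ny r by linarith
    qed (use r in simp)
    ultimately show ?thesis using mono by linarith
  qed
  ultimately show "\<exists>U d. open U \<and> p \<in> U \<and> distance_on U d \<and>
      (\<forall>x\<in>U. \<forall>y\<in>U. causal_le A G T x y \<longrightarrow> d x y \<le> tau y - tau x)" by blast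
qed

section \<open>Definiteness of the null distance\<close>

lemma segment_causal_le:
  assumes "fut_causal_seg A G T s t \<beta> \<or> past_causal_seg A G T s t \<beta> \<or> (\<forall>\<tau>\<in>{s..t}. \<beta> \<tau> = \<beta> s)" "s < t"
  shows "causal_le A G T (\<beta> s) (\<beta> t) \<or> causal_le A G T (\<beta> t) (\<beta> s)"
  using assms(1)
proof (elim disjE)
  assume "fut_causal_seg A G T s t \<beta>"
  then show ?thesis using carc_seg[of s t \<beta> UNIV] unfolding causal_le_carc by blast
next
  assume "past_causal_seg A G T s t \<beta>"
  from carc_seg[OF past_causal_seg_reverse[OF this], of UNIV] show ?thesis unfolding causal_le_carc by auto
next
  assume *: "\<forall>\<tau>\<in>{s..t}. \<beta> \<tau> = \<beta> s"
  have "t \<in> {s..t}" using assms(2) by simp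
  then have "\<beta> t = \<beta> s" using * by blast
  then show ?thesis unfolding causal_le_def by simp
qed

lemma null_length_ge:
  assumes c: "c \<in> A" "p \<in> fst c" and sub: "cball (snd c p) r \<subseteq> cdom c" and \<kappa>: "0 < \<kappa>" and r: "0 < r"
    and al': "\<forall>x y L. carc (cinv c ` cball (snd c p) r) x y L \<longrightarrow> \<kappa> * norm (snd c y - snd c x) \<le> tau y - tau x"
    and pc: "piecewise_causal A G T \<beta> a b k s" and p: "\<beta> a = p" and q: "\<beta> b \<notin> cinv c ` ball (snd c p) r"
  shows "\<kappa> * r \<le> null_length tau \<beta> k s"
proof -
  let ?W = "cinv c ` ball (snd c p) r"
  have pt: "is_partition a b k s" using pc by (simp add: piecewise_causal_def)
  \<comment> \<open>Invariant along the partition: either the price \<open>\<kappa> * r\<close> has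
    been paid already, or the curve is still in the ball and has paid for its distance from
    \<open>p\<close>. The end point lies outside, so finally the first case holds.\<close>
  have "\<kappa> * r \<le> null_length tau \<beta> i s \<or> (\<beta> (s i) \<in> ?W \<and> \<kappa> * norm (snd c (\<beta> (s i)) - snd c p) \<le> null_length tau \<beta> i s)"
    if "i \<le> k" for i
    using that
  proof (induction i)
    case 0
    have "snd c p \<in> ball (snd c p) r" using r by simp
    then have "p \<in> ?W" using cinv_snd[OF c] by (metis imageI)
    then show ?case using pt p by (simp add: is_partition_def null_length_def)
  next
    case (Suc i)
    let ?x = "\<beta> (s i)" and ?y = "\<beta> (s (Suc i))"
    have nl: "null_length tau \<beta> (Suc i) s = null_length tau \<beta> i s + \<bar>tau ?y - tau ?x\<bar>" by (simp add: null_length_def)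
    show ?case
    proof (cases "\<kappa> * r \<le> null_length tau \<beta> i s")
      case True then show ?thesis unfolding nl by linarith
    next
      case False
      then have x: "?x \<in> ?W" "\<kappa> * norm (snd c ?x - snd c p) \<le> null_length tau \<beta> i s" using Suc by auto
      have "s i < s (Suc i)" using pt Suc.prems by (simp add: is_partition_def)
      moreover have "fut_causal_seg A G T (s i) (s (Suc i)) \<beta> \<or> past_causal_seg A G T (s i) (s (Suc i)) \<beta> \<or>
            (\<forall>\<tau>\<in>{s i..s (Suc i)}. \<beta> \<tau> = \<beta> (s i))" using pc Suc.prems by (simp add: piecewise_causal_def)
      ultimately have "causal_le A G T ?x ?y \<or> causal_le A G T ?y ?x" by (intro segment_causal_le)
      from exit_tau[OF c(1) sub \<kappa> al' x(1) this] show ?thesis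
      proof
        assume *: "?y \<in> ?W \<and> \<kappa> * norm (snd c ?y - snd c ?x) \<le> \<bar>tau ?y - tau ?x\<bar>"
        have "norm (snd c ?y - snd c p) \<le> norm (snd c ?x - snd c p) + norm (snd c ?y - snd c ?x)"
          using norm_triangle_ineq[of "snd c ?x - snd c p" "snd c ?y - snd c ?x"] by simp
        then have "\<kappa> * norm (snd c ?y - snd c p) \<le> \<kappa> * (norm (snd c ?x - snd c p) + norm (snd c ?y - snd c ?x))"
          using \<kappa> by (intro mult_left_mono) auto
        then have "\<kappa> * norm (snd c ?y - snd c p) \<le> null_length tau \<beta> (Suc i) s"
          unfolding nl using x(2) * by (simp add: distrib_left)
        then show ?thesis using * by blast
      next
        assume "\<kappa> * (r - norm (snd c ?x - snd c p)) \<le> \<bar>tau ?y - tau ?x\<bar>"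
        then have "\<kappa> * r - \<kappa> * norm (snd c ?x - snd c p) \<le> \<bar>tau ?y - tau ?x\<bar>" by (simp add: right_diff_distrib)
        then show ?thesis unfolding nl using x(2) by linarith
      qed
    qed
  qed
  from this[of k] show ?thesis using pt q by (auto simp: is_partition_def)
qed

text \<open>Needed because \<open>Inf {}\<close> on the reals, hence \<open>null_dist\<close> of points not joined by a piecewise causal curve, is a junk value.\<close>

lemma linked_all: "linked\<^sup>*\<^sup>* p q"
proof (rule connected_equivalence_relation[OF conn UNIV_I UNIV_I])
  have sym: "symp linked" using linked_sym by (auto intro: sympI)
  show "linked\<^sup>*\<^sup>* y x" if "linked\<^sup>*\<^sup>* x y" for x y using symp_rtranclp[OF sym] that by (auto dest: sympD)
  show "linked\<^sup>*\<^sup>* x z" if "linked\<^sup>*\<^sup>* x y" "linked\<^sup>*\<^sup>* y z" for x y z using that by (rule rtranclp_trans)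
  fix x
  obtain c where c: "c \<in> A" "x \<in> fst c" using chart_exists by blast
  obtain R e m C t0 where "regular_patch A G T c (snd c x) R e m C t0"
    using regular_patch_exists[OF c(2,1) zero_less_one] by blast
  then interpret Q: regular_patch A G T c "snd c x" R e m C t0 .
  \<comment> \<open>All points near \<open>x\<close> reach one point slightly above
    \<open>x\<close>, so they are linked to each other through it.\<close>
  have "beyond (cinv c (snd c x + (R / 2) *\<^sub>R e)) (cinv c (snd c x))"
    by (rule Q.beyond_shift) (use Q.R_pos in auto)
  then obtain q where "beyond q x" using cinv_snd[OF c] by auto
  then obtain U where U: "open U" "x \<in> U" "\<And>z. z \<in> U \<Longrightarrow> causal_le A G T z q" by (auto simp: beyond_def)
  have toq: "linked\<^sup>*\<^sup>* z q" if "z \<in> U" for z using U(3)[OF that] carc_linked unfolding causal_le_carc by blast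
  have "linked\<^sup>*\<^sup>* x z" if "z \<in> U" for z
  proof -
    have "linked\<^sup>*\<^sup>* q z" using symp_rtranclp[OF sym] toq[OF that] by (auto dest: sympD)
    then show ?thesis using toq[OF U(2)] by (rule rtranclp_trans[rotated])
  qed
  then show "\<exists>T. openin (top_of_set UNIV) T \<and> x \<in> T \<and> (\<forall>z\<in>T. linked\<^sup>*\<^sup>* x z)" using U by auto
qed

lemma null_dist_definite:
  assumes "null_dist A G T tau p q = 0" shows "p = q"
proof (rule ccontr)
  assume pq: "p \<noteq> q"
  obtain c where c: "c \<in> A" "p \<in> fst c" using chart_exists by blast
  \<comment> \<open>A radius that keeps \<open>q\<close> outside the chart ball around
    \<open>p\<close>, whether or not \<open>q\<close> lies in the chart.\<close>
  obtain \<rho> where \<rho>: "\<rho> > 0" "q \<notin> fst c \<or> \<rho> \<le> norm (snd c q - snd c p)"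
  proof (cases "q \<in> fst c")
    case True
    then have "snd c q \<noteq> snd c p" using pq c cinv_snd[OF c(1)] by metis
    then show ?thesis using that[of "norm (snd c q - snd c p)"] by simp
  qed (use that[of 1] in auto)
  obtain r \<kappa> where r: "0 < r" "r \<le> \<rho>" "0 < \<kappa>" "cball (snd c p) r \<subseteq> cdom c"
    and al': "\<forall>x y L. carc (cinv c ` cball (snd c p) r) x y L \<longrightarrow> \<kappa> * norm (snd c y - snd c x) \<le> tau y - tau x"
    by (rule anti_lipschitz_patch[OF c(2,1) \<rho>(1)])
  have qW: "q \<notin> cinv c ` ball (snd c p) r"
  proof
    assume "q \<in> cinv c ` ball (snd c p) r"
    then obtain v where v: "v \<in> ball (snd c p) r" "q = cinv c v" by blast
    then have "v \<in> cdom c" using r(4) by (auto simp: subset_iff)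
    then have "q \<in> fst c" "snd c q = v" using v(2) cinv_in[OF c(1)] snd_cinv[OF c(1)] by auto
    then show False using \<rho>(2) r(2) v(1) by (simp add: dist_norm norm_minus_commute)
  qed
  let ?S = "{null_length tau \<beta> k s | \<beta> a b k s. piecewise_causal A G T \<beta> a b k s \<and> \<beta> a = p \<and> \<beta> b = q}"
  have "?S \<noteq> {}" using linked_piecewise[OF linked_all[of p q]] by blast
  moreover have "\<kappa> * r \<le> x" if xS: "x \<in> ?S" for x
  proof -
    obtain \<beta> a b k s where x: "x = null_length tau \<beta> k s" "piecewise_causal A G T \<beta> a b k s" "\<beta> a = p" "\<beta> b = q"
      using xS by blast
    have "\<beta> b \<notin> cinv c ` ball (snd c p) r" using qW x(4) by simp
    from null_length_ge[OF c r(4,3,1) al' x(2,3) this] show ?thesis using x(1) by simp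
  qed
  ultimately have "\<kappa> * r \<le> Inf ?S" by (rule cInf_greatest)
  moreover have "0 < \<kappa> * r" using r by simp
  ultimately show False using assms unfolding null_dist_def by linarith
qed

end

theorem theorem5p4:
  fixes A :: "('a::{t2_space,second_countable_topology}, 'n::finite) chart set"
    and G :: "('a,'n) chart \<Rightarrow> 'a \<Rightarrow> real^'n^'n"
    and T :: "('a,'n) chart \<Rightarrow> 'a \<Rightarrow> real^'n"
  assumes "spacetime A G T"
    and "regular_cosmo_time A G T"
  shows "locally_anti_lipschitz A G T (\<lambda>q. real_of_ereal (cosmo_time A G T q)) \<and>
         (\<forall>p q. null_dist A G T (\<lambda>x. real_of_ereal (cosmo_time A G T x)) p q = 0 \<longrightarrow> p = q)"
proof -
  interpret regular_ctx A G T by unfold_locales (rule assms)+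
  have "tau = (\<lambda>q. real_of_ereal (cosmo_time A G T q))" by (rule ext) (rule tau_def)
  then show ?thesis using tau_locally_anti_lipschitz null_dist_definite by metis
qed

end
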